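(* Let $\mu:\mathcal{B}_0(\mathbf{R}^4)\to\mathbf{C}$ be a Lorentz invariant Borel complex measure on Minkowski space. Then there exist $c\in\mathbf{C}$ and Borel complex measures $\sigma_1,\sigma_2,\sigma_3:\mathcal{B}_0([0,\infty))\to\mathbf{C}$ such that for all $\Gamma\in\mathcal{B}_0(\mathbf{R}^4)$ $$\mu(\Gamma)=c\,\delta(\Gamma)+\int_{m=0}^{\infty}\Omega^{+}_m(\Gamma)\,\sigma_1(dm)+\int_{m=0}^{\infty}\Omega_m^{-}(\Gamma)\,\sigma_2(dm)+\int_{m=0}^{\infty}\Omega_{im}(\Gamma)\,\sigma_3(dm),$$ where $\delta$ is the Dirac measure at the origin of $\mathbf{R}^4$.
   Context: For $S=\mathbf{R}^4$ or $S=[0,\infty)$, $\mathcal{B}_0(S)$ denotes the collection of relatively compact Borel subsets of $S$. A Borel complex measure on $S$ is a map $\mu:\mathcal{B}_0(S)\to\mathbf{C}$ such that for every $C\in\mathcal{B}_0(S)$ the restriction of $\mu$ to the Borel subsets of $C$ is a complex measure on $C$ in the usual (countably additive) sense. $\mathbf{R}^4$ carries the Minkowski form $p^2=(p^0)^2-(p^1)^2-(p^2)^2-(p^3)^2$; for $p=(p^0,p^1,p^2,p^3)$ write $\vec p=\pi(p)=(p^1,p^2,p^3)$. A Borel complex measure $\mu$ on $\mathbf{R}^4$ is Lorentz invariant if $\mu(\Lambda\Gamma)=\mu(\Gamma)$ for all $\Lambda$ in the proper orthochronous Lorentz group $O(1,3)^{+\uparrow}$ and all $\Gamma\in\mathcal{B}_0(\mathbf{R}^4)$.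 For $m\ge 0$ let $\omega_m(\vec p)=(m^2+|\vec p|^2)^{1/2}$, $H_m^{\pm}=\{p\in\mathbf{R}^4:p^2=m^2,\ \pm p^0>0\}$, and $\Omega_m^{\pm}(\Gamma)=\int_{\pi(\Gamma\cap H_m^{\pm})}\frac{d\vec p}{\omega_m(\vec p)}$. For $m\ge0$ let $\omega_{im}(\vec p)=(|\vec p|^2-m^2)^{1/2}$ for $|\vec p|\ge m$, let $H_{im}^{\pm}=\{p\in\mathbf{R}^4:p^2=-m^2,\ \pm p^0\ge 0\}$, $\Omega_{im}^{\pm}(\Gamma)=\int_{\pi(\Gamma\cap H_{im}^{\pm})}\frac{d\vec p}{\omega_{im}(\vec p)}$ and $\Omega_{im}=\Omega_{im}^{+}+\Omega_{im}^{-}$ (for $m=0$ this is $\Omega_0^{+}+\Omega_0^{-}$). *)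

theory Defs
  imports "HOL-Analysis.Analysis"
begin

definition relcompact_borel :: "'a::topological_space set \<Rightarrow> 'a set set" where
  "relcompact_borel S = {A \<in> sets (restrict_space borel S). compact (S \<inter> closure A)}"

(* Taking every set in the sequence to be empty forces \<nu> {} = 0, and invariance of the union
   under reordering makes the convergence absolute. *)
definition complex_measure :: "'a measure \<Rightarrow> ('a set \<Rightarrow> complex) \<Rightarrow> bool" where
  "complex_measure M \<nu> \<longleftrightarrow>
     (\<forall>A::nat \<Rightarrow> 'a set. range A \<subseteq> sets M \<longrightarrow> disjoint_family A \<longrightarrow>
        (\<lambda>i. \<nu> (A i)) sums \<nu> (\<Union>i. A i))"

(* Only the values of \<mu> on relcompact_borel S matter. *)
definition borel_complex_measure :: "'a::topological_space set \<Rightarrow> ('a set \<Rightarrow> complex) \<Rightarrow> bool" where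
  "borel_complex_measure S \<mu> \<longleftrightarrow>
     (\<forall>C\<in>relcompact_borel S. complex_measure (restrict_space borel C) \<mu>)"

(* The positive part of the Jordan decomposition of a real set function \<nu> on relcompact_borel S,
   as a (locally finite) positive measure on the Borel sets of S. The function ennreal truncates
   negative values to 0, which does not affect the supremum because B = {} contributes 0. *)
definition pos_variation :: "'a::topological_space set \<Rightarrow> ('a set \<Rightarrow> real) \<Rightarrow> 'a measure" where
  "pos_variation S \<nu> =
     measure_of S (sets (restrict_space borel S))
       (\<lambda>A. SUP B\<in>{B \<in> relcompact_borel S. B \<subseteq> A}. ennreal (\<nu> B))"

definition neg_variation :: "'a::topological_space set \<Rightarrow> ('a set \<Rightarrow> real) \<Rightarrow> 'a measure" where
  "neg_variation S \<nu> = pos_variation S (\<lambda>B. - \<nu> B)"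

(* The integral of f over S against a Borel complex measure \<sigma> is the Lebesgue integral,
   extended linearly through the Jordan decompositions of the real and imaginary parts of \<sigma>. *)
definition cm_integrable ::
    "'a::topological_space set \<Rightarrow> ('a set \<Rightarrow> complex) \<Rightarrow> ('a \<Rightarrow> real) \<Rightarrow> bool" where
  "cm_integrable S \<sigma> f \<longleftrightarrow>
     integrable (pos_variation S (\<lambda>A. Re (\<sigma> A))) f \<and>
     integrable (neg_variation S (\<lambda>A. Re (\<sigma> A))) f \<and>
     integrable (pos_variation S (\<lambda>A. Im (\<sigma> A))) f \<and>
     integrable (neg_variation S (\<lambda>A. Im (\<sigma> A))) f"

definition cm_integral ::
    "'a::topological_space set \<Rightarrow> ('a set \<Rightarrow> complex) \<Rightarrow> ('a \<Rightarrow> real) \<Rightarrow> complex" where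
  "cm_integral S \<sigma> f =
     Complex
       (integral\<^sup>L (pos_variation S (\<lambda>A. Re (\<sigma> A))) f -
        integral\<^sup>L (neg_variation S (\<lambda>A. Re (\<sigma> A))) f)
       (integral\<^sup>L (pos_variation S (\<lambda>A. Im (\<sigma> A))) f -
        integral\<^sup>L (neg_variation S (\<lambda>A. Im (\<sigma> A))) f)"

(* The index type 4 is arithmetic modulo 4, so its four elements are 0, 1, 2, 3 (with 0 = 4);
   the time coordinate is p $ 0. *)
definition minkowski_sq :: "real^4 \<Rightarrow> real" where
  "minkowski_sq p = (p $ 0)\<^sup>2 - (p $ 1)\<^sup>2 - (p $ 2)\<^sup>2 - (p $ 3)\<^sup>2"

definition spatial :: "real^4 \<Rightarrow> real^3" where
  "spatial p = vector [p $ 1, p $ 2, p $ 3]"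

definition proper_orthochronous_lorentz :: "(real^4^4) set" where
  "proper_orthochronous_lorentz =
     {\<Lambda>. (\<forall>p. minkowski_sq (\<Lambda> *v p) = minkowski_sq p) \<and> det \<Lambda> = 1 \<and> \<Lambda> $ 0 $ 0 > 0}"

definition lorentz_invariant :: "((real^4) set \<Rightarrow> complex) \<Rightarrow> bool" where
  "lorentz_invariant \<mu> \<longleftrightarrow>
     (\<forall>\<Lambda>\<in>proper_orthochronous_lorentz. \<forall>\<Gamma>\<in>relcompact_borel UNIV. \<mu> ((*v) \<Lambda> ` \<Gamma>) = \<mu> \<Gamma>)"

(* In the following definitions the argument s is the sign, 1 or -1, written as a superscript
   in the usual notation. *)
definition energy :: "real \<Rightarrow> real^3 \<Rightarrow> real" where
  "energy m q = sqrt (m\<^sup>2 + (norm q)\<^sup>2)"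

definition mass_shell :: "real \<Rightarrow> real \<Rightarrow> (real^4) set" where
  "mass_shell s m = {p. minkowski_sq p = m\<^sup>2 \<and> s * (p $ 0) > 0}"

definition Omega :: "real \<Rightarrow> real \<Rightarrow> (real^4) set \<Rightarrow> real" where
  "Omega s m \<Gamma> = (LINT q:spatial ` (\<Gamma> \<inter> mass_shell s m)|lborel. 1 / energy m q)"

definition energy_im :: "real \<Rightarrow> real^3 \<Rightarrow> real" where
  "energy_im m q = sqrt ((norm q)\<^sup>2 - m\<^sup>2)"

definition mass_shell_im :: "real \<Rightarrow> real \<Rightarrow> (real^4) set" where
  "mass_shell_im s m = {p. minkowski_sq p = - m\<^sup>2 \<and> s * (p $ 0) \<ge> 0}"

(* On the projected set norm q \<ge> m, and the integrand vanishes by convention (division by zero)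
   only on the null set norm q = m. *)
definition Omega_im_half :: "real \<Rightarrow> real \<Rightarrow> (real^4) set \<Rightarrow> real" where
  "Omega_im_half s m \<Gamma> =
     (LINT q:spatial ` (\<Gamma> \<inter> mass_shell_im s m)|lborel. 1 / energy_im m q)"

definition Omega_im :: "real \<Rightarrow> (real^4) set \<Rightarrow> real" where
  "Omega_im m \<Gamma> = Omega_im_half 1 m \<Gamma> + Omega_im_half (-1) m \<Gamma>"

end

theory Submission
  imports Defs
begin

text \<open>
  The positive and negative variations of the real and imaginary parts of \<open>\<mu>\<close> are locally finite
  Lorentz invariant positive measures, so it suffices to treat such a measure \<open>M\<close>. With
  \<open>x = p\<^sup>0 + p\<^sup>3\<close>, the two families of null rotations fixing \<open>x\<close> and the boosts along the third axis
  generate a group acting simply transitively on each half \<open>{p\<^sup>2 = s, \<plusminus>x > 0}\<close> of each shell, and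
  the measure \<open>dx dp\<^sup>1 dp\<^sup>2 / \<bar>x\<bar>\<close>, which is \<open>d\<^sup>3p / \<bar>p\<^sup>0\<bar>\<close> in other coordinates, is invariant.
  Writing \<open>J\<^sub>s(f)\<close> for its integral of \<open>f\<close> over the half shell, Fubini's theorem over that group and
  the invariance of \<open>M\<close> give the symmetry
  \<open>\<integral> f(p) J\<^bsub>p\<^sup>2\<^esub>(h) dM(p) = \<integral> h(p) J\<^bsub>p\<^sup>2\<^esub>(f) dM(p)\<close> over \<open>\<plusminus>x > 0\<close>.
  Choosing for \<open>h\<close> the indicator of a box with \<open>J\<^sub>s(h) = 1\<close> for all \<open>s\<close> disintegrates \<open>M\<close> over the
  values of \<open>p\<^sup>2\<close>. The plane \<open>x = 0\<close> carries no mass outside the origin, because rotations move its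
  points off the plane, and for \<open>s < 0\<close> the rotation exchanging \<open>p\<^sup>0 + p\<^sup>3\<close> and \<open>p\<^sup>0 - p\<^sup>3\<close> shows that
  both halves carry the same distribution of \<open>s\<close>.
\<close>

section \<open>Jordan decomposition of locally finite signed set functions\<close>

text \<open>The group of null rotations and boosts is not unimodular: in one order of composition
  the Jacobian of the orbit map is 1/x^2 at the starting point, in the other at the boosted point.
  The Fubini argument reverses the order, so it carries the weight
  \<open>(plus_coord p)\<^sup>2\<close>. Light-cone coordinates treat every value of p^2, zero
  included, by one formula.

  The sign of the energy agrees with the sign of x for p^2 \<ge> 0, but for p^2 < 0 the energy
  changes sign inside a half shell. There only the sum of both energy branches can be matched with
  the two halves, hence the single \<sigma>3 and the need for equal distributions.

  Positivity lets all interchanges of integrals take place in [0,\<infinity>]. It has a price at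
  both ends: \<mu> is given only on relatively compact sets, so local finiteness of its variations
  has to be proved, and integrals against \<sigma> are defined through its own Jordan decomposition,
  whereas the construction yields differences of positive measures that need not be mutually
  singular.\<close>

lemma relcompact_borel_iff:
  assumes "S \<in> sets borel"
  shows "A \<in> relcompact_borel S \<longleftrightarrow> A \<in> sets borel \<and> A \<subseteq> S \<and> compact (S \<inter> closure A)"
  using assms by (auto simp: relcompact_borel_def sets_restrict_space_iff)

lemma relcompact_borel_subset:
  assumes "S \<in> sets borel" "C \<in> relcompact_borel S" "A \<in> sets borel" "A \<subseteq> C"
  shows "A \<in> relcompact_borel S"
proof -
  have "S \<inter> closure A = (S \<inter> closure C) \<inter> closure A"
    using closure_mono[OF assms(4)] by auto
  then show ?thesis
    using assms compact_Int_closed[of "S \<inter> closure C" "closure A"]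
    by (auto simp: relcompact_borel_iff)
qed

lemma relcompact_borel_Un:
  assumes "S \<in> sets borel" "A \<in> relcompact_borel S" "B \<in> relcompact_borel S"
  shows "A \<union> B \<in> relcompact_borel S"
  using assms compact_Un[of "S \<inter> closure A" "S \<inter> closure B"]
  by (auto simp: relcompact_borel_iff closure_Un Int_Un_distrib)

lemma empty_relcompact_borel [simp]: "{} \<in> relcompact_borel S"
  by (simp add: relcompact_borel_def)

lemma complex_measure_restrict_borelD:
  assumes "complex_measure (restrict_space borel C) \<mu>" "C \<in> sets borel"
    and "\<And>i::nat. A i \<in> sets borel" "disjoint_family A" "(\<Union>i. A i) \<subseteq> C"
  shows "(\<lambda>i. \<mu> (A i)) sums \<mu> (\<Union>i. A i)"
proof -
  have "A i \<subseteq> C" for i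
    using assms(5) by auto
  then have "range A \<subseteq> sets (restrict_space borel C)"
    using assms(2,3) by (auto simp: sets_restrict_space_iff)
  then show ?thesis
    using assms(1,4) by (auto simp: complex_measure_def)
qed

text \<open>The real counterpart of \<open>borel_complex_measure\<close>. It serves the real and
  imaginary parts of \<mu> on Minkowski space and the differences of mass distributions on the half
  line.\<close>

locale signed_borel =
  fixes S :: "'a::topological_space set" and \<nu> :: "'a set \<Rightarrow> real"
  assumes S: "S \<in> sets borel"
    and countably_additive: "\<And>C A. C \<in> relcompact_borel S \<Longrightarrow> (\<And>i::nat. A i \<in> sets borel) \<Longrightarrow>
      disjoint_family A \<Longrightarrow> (\<Union>i. A i) \<subseteq> C \<Longrightarrow> (\<lambda>i. \<nu> (A i)) sums \<nu> (\<Union>i. A i)"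
begin

lemma nu_empty: "\<nu> {} = 0"
proof -
  have "(\<lambda>i::nat. \<nu> {}) sums \<nu> (\<Union>i::nat. {})"
    by (rule countably_additive[of "{}"]) (auto simp: disjoint_family_on_def)
  then have "summable (\<lambda>i::nat. \<nu> {})"
    by (rule sums_summable)
  then show ?thesis
    by (simp add: summable_const_iff)
qed

lemma nu_Un:
  assumes "A \<in> relcompact_borel S" "B \<in> relcompact_borel S" "A \<inter> B = {}"
  shows "\<nu> (A \<union> B) = \<nu> A + \<nu> B"
proof -
  have "(\<lambda>i. \<nu> (binaryset A B i)) sums \<nu> (\<Union>i. binaryset A B i)"
    using assms S
    by (intro countably_additive[OF relcompact_borel_Un[OF S assms(1,2)]])
       (auto simp: relcompact_borel_iff binaryset_def disjoint_family_on_def split: if_splits)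
  moreover have "(\<lambda>i. \<nu> (binaryset A B i)) sums (\<nu> A + \<nu> B)"
    using binaryset_sums[of \<nu> A B] nu_empty by simp
  ultimately show ?thesis
    by (simp add: UN_binaryset_eq sums_unique2)
qed

lemma nu_Diff:
  assumes "A \<in> relcompact_borel S" "B \<in> sets borel" "B \<subseteq> A"
  shows "\<nu> (A - B) = \<nu> A - \<nu> B"
proof -
  have "A \<in> sets borel"
    using assms S by (auto simp: relcompact_borel_iff)
  then have "B \<in> relcompact_borel S" "A - B \<in> relcompact_borel S"
    using assms by (auto intro: relcompact_borel_subset[OF S assms(1)])
  then show ?thesis
    using nu_Un[of B "A - B"] assms(3) by (simp add: Un_absorb1)
qed

definition unbounded_on :: "'a set \<Rightarrow> bool" where
  "unbounded_on E \<longleftrightarrow> (\<forall>r. \<exists>B\<in>sets borel. B \<subseteq> E \<and> r < \<bar>\<nu> B\<bar>)"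

text \<open>The classical reason why a signed measure is bounded: additivity passes unboundedness
  from \<open>E\<close> to \<open>B\<close> or to \<open>E - B\<close>, and both pieces carry a
  large value, so the discarded piece does too, whichever one is kept.\<close>

lemma unbounded_on_split:
  assumes "E \<in> relcompact_borel S" "unbounded_on E"
  shows "\<exists>F\<in>sets borel. F \<subseteq> E \<and> unbounded_on F \<and> 1 \<le> \<bar>\<nu> (E - F)\<bar>"
proof -
  have Eb: "E \<in> sets borel"
    using assms S by (simp add: relcompact_borel_iff)
  \<comment> \<open>The threshold exceeds \<open>\<bar>\<nu> E\<bar>\<close> by 1 so that
    \<open>\<nu> E - \<nu> B\<close>, the value on the complement, is also at least 1 in absolute
    value.\<close>
  obtain B where B: "B \<in> sets borel" "B \<subseteq> E" "1 + \<bar>\<nu> E\<bar> < \<bar>\<nu> B\<bar>"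
    using assms(2) unfolding unbounded_on_def by blast
  have sub: "D \<in> relcompact_borel S" if "D \<in> sets borel" "D \<subseteq> E" for D
    using that by (auto intro: relcompact_borel_subset[OF S assms(1)])
  have big: "1 \<le> \<bar>\<nu> B\<bar>" "1 \<le> \<bar>\<nu> (E - B)\<bar>"
    using B nu_Diff[OF assms(1) B(1,2)] by auto
  have "unbounded_on B \<or> unbounded_on (E - B)"
  proof (rule ccontr)
    assume "\<not> ?thesis"
    then obtain r1 r2 where r: "\<And>D. D \<in> sets borel \<Longrightarrow> D \<subseteq> B \<Longrightarrow> \<bar>\<nu> D\<bar> \<le> r1"
      "\<And>D. D \<in> sets borel \<Longrightarrow> D \<subseteq> E - B \<Longrightarrow> \<bar>\<nu> D\<bar> \<le> r2"
      unfolding unbounded_on_def by (meson not_less)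
    obtain D where D: "D \<in> sets borel" "D \<subseteq> E" "r1 + r2 < \<bar>\<nu> D\<bar>"
      using assms(2) unfolding unbounded_on_def by blast
    have "\<nu> D = \<nu> (D \<inter> B) + \<nu> (D \<inter> (E - B))"
      using D B Eb by (subst nu_Un[symmetric]) (auto intro!: sub arg_cong[where f=\<nu>])
    moreover have "\<bar>\<nu> (D \<inter> B)\<bar> \<le> r1" "\<bar>\<nu> (D \<inter> (E - B))\<bar> \<le> r2"
      using r D B Eb by auto
    ultimately show False
      using D(3) by linarith
  qed
  then show ?thesis
  proof
    assume "unbounded_on B" then show ?thesis
      using B big by auto
  next
    assume u: "unbounded_on (E - B)"
    have "E - (E - B) = B"
      using B by auto
    then show ?thesis
      using u B Eb big by (intro bexI[of _ "E - B"]) auto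
  qed
qed

text \<open>Splitting repeatedly would yield infinitely many disjoint pieces of one relatively compact
  set, each with \<open>\<bar>\<nu>\<bar> \<ge> 1\<close>, which contradicts the convergence required by countable additivity.\<close>

lemma bounded_on_relcompact:
  assumes "E \<in> relcompact_borel S"
  shows "\<not> unbounded_on E"
proof
  assume u: "unbounded_on E"
  let ?P = "\<lambda>F. F \<in> relcompact_borel S \<and> F \<subseteq> E \<and> unbounded_on F"
  have "\<exists>F::nat \<Rightarrow> 'a set. \<forall>n. ?P (F n) \<and> (F (Suc n) \<subseteq> F n \<and> 1 \<le> \<bar>\<nu> (F n - F (Suc n))\<bar>)"
  proof (rule dependent_nat_choice)
    show "\<exists>F. ?P F"
      using u assms by blast
  next
    fix F and n :: nat assume F: "?P F"
    then obtain G where "G \<in> sets borel" "G \<subseteq> F" "unbounded_on G" "1 \<le> \<bar>\<nu> (F - G)\<bar>"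
      using unbounded_on_split[of F] by blast
    then show "\<exists>G. ?P G \<and> G \<subseteq> F \<and> 1 \<le> \<bar>\<nu> (F - G)\<bar>"
      using F relcompact_borel_subset[OF S, of F G] by blast
  qed
  then obtain F :: "nat \<Rightarrow> 'a set" where F: "\<And>n. ?P (F n)" "\<And>n. F (Suc n) \<subseteq> F n"
    "\<And>n. 1 \<le> \<bar>\<nu> (F n - F (Suc n))\<bar>"
    by metis
  have anti: "F n \<subseteq> F m" if "m \<le> n" for m n
    using lift_Suc_antimono_le[of F, OF F(2) that] .
  define D where "D n = F n - F (Suc n)" for n
  have "D m \<inter> D n = {}" if "m < n" for m n
    using anti[of "Suc m" n] that by (auto simp: D_def)
  then have "disjoint_family D"
    unfolding disjoint_family_on_def by (metis inf_commute linorder_neqE_nat)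
  moreover have "D n \<in> sets borel" "D n \<subseteq> E" for n
    using F(1)[of n] F(1)[of "Suc n"] S by (auto simp: D_def relcompact_borel_iff)
  ultimately have "(\<lambda>n. \<nu> (D n)) sums \<nu> (\<Union>n. D n)"
    by (intro countably_additive[OF assms]) auto
  then have "(\<lambda>n. \<nu> (D n)) \<longlonglongrightarrow> 0"
    by (intro summable_LIMSEQ_zero sums_summable)
  then have "(\<lambda>n. \<bar>\<nu> (D n)\<bar>) \<longlonglongrightarrow> 0"
    by (rule tendsto_rabs_zero)
  then have "1 \<le> (0::real)"
    by (rule LIMSEQ_le_const) (use F(3) in \<open>auto simp: D_def\<close>)
  then show False
    by simp
qed

text \<open>The set function inside \<open>pos_variation\<close>, named separately because
  \<open>measure_of\<close> returns it as the \<open>emeasure\<close> only once countable additivity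
  is known.\<close>

definition upper_variation :: "'a set \<Rightarrow> ennreal" where
  "upper_variation A = (SUP B\<in>{B \<in> relcompact_borel S. B \<subseteq> A}. ennreal (\<nu> B))"

lemma upper_variation_upper: "B \<in> relcompact_borel S \<Longrightarrow> B \<subseteq> A \<Longrightarrow> ennreal (\<nu> B) \<le> upper_variation A"
  unfolding upper_variation_def by (rule SUP_upper) auto

lemma upper_variation_mono: "A \<subseteq> B \<Longrightarrow> upper_variation A \<le> upper_variation B"
  unfolding upper_variation_def by (rule SUP_subset_mono) auto

lemma upper_variation_empty: "upper_variation {} = 0"
proof -
  have "{B \<in> relcompact_borel S. B \<subseteq> {}} = {{}}"
    by auto
  then show ?thesis
    by (simp add: upper_variation_def nu_empty)
qed

lemma upper_variation_superadditive:
  assumes "A \<inter> B = {}"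
  shows "upper_variation A + upper_variation B \<le> upper_variation (A \<union> B)"
proof -
  have "ennreal (\<nu> C) + ennreal (\<nu> D) \<le> upper_variation (A \<union> B)"
    if C: "C \<in> relcompact_borel S" "C \<subseteq> A" and D: "D \<in> relcompact_borel S" "D \<subseteq> B" for C D
  \<comment> \<open>If one value is nonpositive, truncation turns its term into 0, and the other set
    alone is the competitor to use instead of the union.\<close>
  proof (cases "\<nu> C \<le> 0 \<or> \<nu> D \<le> 0")
    case True
    then show ?thesis
      using upper_variation_upper[of C "A \<union> B"] upper_variation_upper[of D "A \<union> B"] C D
      by (auto simp: ennreal_neg le_supI1 le_supI2)
  next
    case False
    then have "ennreal (\<nu> C) + ennreal (\<nu> D) = ennreal (\<nu> (C \<union> D))"
      using nu_Un[of C D] C D assms by (subst nu_Un) (auto simp: ennreal_plus)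
    also have "\<dots> \<le> upper_variation (A \<union> B)"
      using C D relcompact_borel_Un[OF S C(1) D(1)] by (intro upper_variation_upper) auto
    finally show ?thesis .
  qed
  then have "(SUP C\<in>{C \<in> relcompact_borel S. C \<subseteq> A}. SUP D\<in>{D \<in> relcompact_borel S. D \<subseteq> B}.
      ennreal (\<nu> C) + ennreal (\<nu> D)) \<le> upper_variation (A \<union> B)"
    by (intro SUP_least) blast
  moreover have "upper_variation A + upper_variation B = (SUP C\<in>{C \<in> relcompact_borel S. C \<subseteq> A}. SUP D\<in>{D \<in> relcompact_borel S. D \<subseteq> B}.
      ennreal (\<nu> C) + ennreal (\<nu> D))"
  proof -
    have ne: "{C \<in> relcompact_borel S. C \<subseteq> E} \<noteq> {}" for E
      using empty_relcompact_borel[of S] by blast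
    show ?thesis
      unfolding upper_variation_def ennreal_SUP_add_left[OF ne, symmetric] ennreal_SUP_add_right[OF ne]
      by (rule SUP_commute)
  qed
  ultimately show ?thesis
    by simp
qed

lemma upper_variation_superadditive_sum:
  fixes A :: "nat \<Rightarrow> 'a set"
  assumes "disjoint_family A"
  shows "(\<Sum>i<n. upper_variation (A i)) \<le> upper_variation (\<Union>i<n. A i)"
proof (induction n)
  case (Suc n)
  have "A i \<inter> A n = {}" if "i < n" for i
    using assms that by (simp add: disjoint_family_on_def)
  then have "(\<Union>i<n. A i) \<inter> A n = {}"
    by auto
  then have le: "upper_variation (\<Union>i<n. A i) + upper_variation (A n) \<le> upper_variation ((\<Union>i<n. A i) \<union> A n)"
    by (rule upper_variation_superadditive)
  have "(\<Sum>i<Suc n. upper_variation (A i)) \<le> upper_variation (\<Union>i<n. A i) + upper_variation (A n)"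
    using Suc by (simp add: add_right_mono)
  also note le
  also have "(\<Union>i<n. A i) \<union> A n = (\<Union>i<Suc n. A i)"
    by (auto simp: less_Suc_eq)
  finally show ?case .
qed (simp add: upper_variation_empty)

text \<open>One inequality is superadditivity of finite unions. For the other, a competitor
  \<open>B\<close> is cut into the pieces \<open>B \<inter> A i\<close>, over which
  \<open>\<nu>\<close> is countably additive because \<open>B\<close> is relatively compact.\<close>

lemma upper_variation_countably_additive: "countably_additive (sets (restrict_space borel S)) upper_variation"
proof (rule countably_additiveI)
  fix A :: "nat \<Rightarrow> 'a set"
  assume A: "range A \<subseteq> sets (restrict_space borel S)" "disjoint_family A"
  have Ab: "A i \<in> sets borel" for i
    using subsetD[OF A(1) rangeI, of i] S by (simp add: sets_restrict_space_iff)
  show "(\<Sum>i. upper_variation (A i)) = upper_variation (\<Union>i. A i)"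
  proof (rule antisym)
    show "(\<Sum>i. upper_variation (A i)) \<le> upper_variation (\<Union>i. A i)"
    proof (rule suminf_le_const)
      fix n
      have "(\<Sum>i<n. upper_variation (A i)) \<le> upper_variation (\<Union>i<n. A i)"
        using A(2) by (rule upper_variation_superadditive_sum)
      also have "\<dots> \<le> upper_variation (\<Union>i. A i)"
        by (rule upper_variation_mono) auto
      finally show "(\<Sum>i<n. upper_variation (A i)) \<le> upper_variation (\<Union>i. A i)" .
    qed simp
  next
    show "upper_variation (\<Union>i. A i) \<le> (\<Sum>i. upper_variation (A i))"
      unfolding upper_variation_def[of "\<Union>i. A i"]
    proof (rule SUP_least, clarify)
      fix B assume B: "B \<in> relcompact_borel S" "B \<subseteq> (\<Union>i. A i)"
      have Bb: "B \<in> sets borel"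
        using B S by (simp add: relcompact_borel_iff)
      have BA: "B \<inter> A i \<in> relcompact_borel S" for i
        using Ab Bb by (intro relcompact_borel_subset[OF S B(1)]) auto
      have "(\<lambda>i. \<nu> (B \<inter> A i)) sums \<nu> (\<Union>i. B \<inter> A i)"
        using Ab Bb A(2) by (intro countably_additive[OF B(1)]) (auto simp: disjoint_family_on_def)
      moreover have "(\<Union>i. B \<inter> A i) = B"
        using B by auto
      ultimately have lim: "(\<lambda>n. ennreal (\<Sum>i<n. \<nu> (B \<inter> A i))) \<longlonglongrightarrow> ennreal (\<nu> B)"
        by (simp add: sums_def)
      have "ennreal (\<Sum>i<n. \<nu> (B \<inter> A i)) \<le> (\<Sum>i. upper_variation (A i))" for n
      proof -
        \<comment> \<open>\<open>ennreal\<close> truncates at 0 and commutes with sums only for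
          nonnegative terms, hence the detour through \<open>max 0\<close>.\<close>
        have "ennreal (\<Sum>i<n. \<nu> (B \<inter> A i)) \<le> ennreal (\<Sum>i<n. max 0 (\<nu> (B \<inter> A i)))"
          by (intro ennreal_leI sum_mono) simp
        also have "\<dots> = (\<Sum>i<n. ennreal (max 0 (\<nu> (B \<inter> A i))))"
          by (rule sum_ennreal[symmetric]) simp
        also have "\<dots> = (\<Sum>i<n. ennreal (\<nu> (B \<inter> A i)))"
          by (intro sum.cong) (auto simp: max_def ennreal_neg)
        also have "\<dots> \<le> (\<Sum>i<n. upper_variation (A i))"
          by (intro sum_mono upper_variation_upper BA) auto
        also have "\<dots> \<le> (\<Sum>i. upper_variation (A i))"
          by (rule sum_le_suminf) auto
        finally show ?thesis .
      qed
      then show "ennreal (\<nu> B) \<le> (\<Sum>i. upper_variation (A i))"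
        by (intro LIMSEQ_le_const2[OF lim]) auto
    qed
  qed
qed

lemma space_pos_variation [simp]: "space (pos_variation S \<nu>) = S"
  unfolding pos_variation_def
  by (subst space_measure_of) (use S in \<open>auto simp: sets_restrict_space_iff\<close>)

lemma sets_pos_variation [simp]: "sets (pos_variation S \<nu>) = sets (restrict_space borel S)"
proof -
  have "space (restrict_space borel S) = S"
    using S by simp
  then show ?thesis
    unfolding pos_variation_def
    by (metis sets.sets_measure_of_eq)
qed

lemma emeasure_pos_variation:
  assumes "A \<in> sets borel" "A \<subseteq> S"
  shows "emeasure (pos_variation S \<nu>) A = upper_variation A"
proof -
  have "space (restrict_space borel S) = S"
    using S by simp
  then have sa: "sigma_algebra S (sets (restrict_space borel S))"
    by (metis sets.sigma_algebra_axioms)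
  show ?thesis
    unfolding pos_variation_def
    using emeasure_measure_of_sigma[OF sa _ upper_variation_countably_additive, of A] assms S
    by (simp add: upper_variation_def[symmetric] upper_variation_empty positive_def sets_restrict_space_iff)
qed

lemma upper_variation_finite:
  assumes "A \<in> relcompact_borel S"
  shows "upper_variation A < \<infinity>"
proof -
  obtain r where r: "\<And>B. B \<in> sets borel \<Longrightarrow> B \<subseteq> A \<Longrightarrow> \<bar>\<nu> B\<bar> \<le> r"
    using bounded_on_relcompact[OF assms] unfolding unbounded_on_def by (meson not_less)
  have "upper_variation A \<le> ennreal r"
    unfolding upper_variation_def using r S
    by (intro SUP_least ennreal_leI) (force simp: relcompact_borel_iff)
  then show ?thesis
    using ennreal_less_top[of r] by (simp add: le_less_trans)
qed

end

section \<open>A signed set function as the difference of its two variations\<close>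

lemma signed_borel_uminus:
  assumes "signed_borel S \<nu>"
  shows "signed_borel S (\<lambda>B. - \<nu> B)"
proof -
  interpret signed_borel S \<nu> by fact
  show ?thesis
    by unfold_locales (auto intro!: S sums_minus countably_additive)
qed

lemma ennreal_add_mono_max:
  assumes "max 0 a + max 0 b \<le> max 0 c + max 0 d"
  shows "ennreal a + ennreal b \<le> ennreal c + ennreal d"
proof -
  have "ennreal (max 0 x) + ennreal (max 0 y) = ennreal (max 0 x + max 0 y)" for x y
    by (simp add: ennreal_plus)
  moreover have "ennreal (max 0 x) = ennreal x" for x
    by (auto simp: max_def ennreal_neg)
  ultimately show ?thesis
    using ennreal_leI[OF assms] by simp
qed

context signed_borel
begin

text \<open>The Jordan identity rearranged into sums, since subtraction of \<open>ennreal\<close>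
  values is truncated. Complementation inside \<open>A\<close> exchanges the competitors for the two
  variations, because \<open>\<nu> (A - B) = \<nu> A - \<nu> B\<close>.\<close>

lemma upper_variation_eq_add_nu:
  assumes "A \<in> relcompact_borel S"
  shows "upper_variation A + ennreal (- \<nu> A) = signed_borel.upper_variation S (\<lambda>B. - \<nu> B) A + ennreal (\<nu> A)"
proof -
  \<comment> \<open>One inequality suffices: applied to the negated set function it becomes the
    reverse one.\<close>
  have *: "signed_borel.upper_variation S (\<lambda>B. - \<nu>' B) A + ennreal (\<nu>' A) \<le> signed_borel.upper_variation S \<nu>' A + ennreal (- \<nu>' A)"
    if sb: "signed_borel S \<nu>'" for \<nu>'
  proof -
    interpret N: signed_borel S \<nu>' by fact
    interpret N': signed_borel S "\<lambda>B. - \<nu>' B" by (rule signed_borel_uminus) fact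
    have "ennreal (- \<nu>' B) + ennreal (\<nu>' A) \<le> N.upper_variation A + ennreal (- \<nu>' A)"
      if B: "B \<in> relcompact_borel S" "B \<subseteq> A" for B
    proof -
      have "B \<in> sets borel" "A \<in> sets borel"
        using B assms S by (auto simp: relcompact_borel_iff)
      then have d: "\<nu>' (A - B) = \<nu>' A - \<nu>' B" "A - B \<in> relcompact_borel S"
        using B N.nu_Diff[OF assms] by (auto intro: relcompact_borel_subset[OF S assms])
      \<comment> \<open>For \<open>\<nu>' B \<le> 0\<close> the competitor \<open>A - B\<close> is
        large enough; otherwise the first truncated term vanishes and \<open>A\<close> itself
        is.\<close>
      have "max 0 (- \<nu>' B) + max 0 (\<nu>' A) \<le> max 0 (\<nu>' (A - B)) + max 0 (- \<nu>' A)
        \<or> max 0 (- \<nu>' B) + max 0 (\<nu>' A) \<le> max 0 (\<nu>' A) + max 0 (- \<nu>' A)"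
        unfolding d by linarith
      then have "ennreal (- \<nu>' B) + ennreal (\<nu>' A) \<le> ennreal (\<nu>' (A - B)) + ennreal (- \<nu>' A)
        \<or> ennreal (- \<nu>' B) + ennreal (\<nu>' A) \<le> ennreal (\<nu>' A) + ennreal (- \<nu>' A)"
        using ennreal_add_mono_max by blast
      moreover have "ennreal (\<nu>' (A - B)) \<le> N.upper_variation A" "ennreal (\<nu>' A) \<le> N.upper_variation A"
        using d(2) assms by (auto intro: N.upper_variation_upper)
      ultimately show ?thesis
        by (meson add_right_mono order_trans)
    qed
    then show ?thesis
      unfolding N'.upper_variation_def
      by (subst ennreal_SUP_add_left[symmetric], force) (auto intro!: SUP_least)
  qed
  show ?thesis
    using *[OF signed_borel_axioms] *[OF signed_borel_uminus[OF signed_borel_axioms]]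
    by (simp add: upper_variation_def signed_borel.upper_variation_def[OF signed_borel_axioms] antisym)
qed

lemma measure_pos_minus_neg:
  assumes "A \<in> relcompact_borel S"
  shows "measure (pos_variation S \<nu>) A - measure (neg_variation S \<nu>) A = \<nu> A"
proof -
  interpret N: signed_borel S "\<lambda>B. - \<nu> B"
    by (rule signed_borel_uminus) (rule signed_borel_axioms)
  have A: "A \<in> sets borel" "A \<subseteq> S"
    using assms S by (auto simp: relcompact_borel_iff)
  obtain v where v: "0 \<le> v" "upper_variation A = ennreal v"
    using upper_variation_finite[OF assms] by (cases "upper_variation A") auto
  obtain w where w: "0 \<le> w" "N.upper_variation A = ennreal w"
    using N.upper_variation_finite[OF assms] by (cases "N.upper_variation A") auto
  have m: "measure (pos_variation S \<nu>) A = v" "measure (neg_variation S \<nu>) A = w"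
    using v w by (simp_all add: measure_def neg_variation_def emeasure_pos_variation[OF A]
      N.emeasure_pos_variation[OF A])
  have "ennreal v + ennreal (- \<nu> A) = ennreal w + ennreal (\<nu> A)"
    using upper_variation_eq_add_nu[OF assms] v w by simp
  then have "v - w = \<nu> A"
    using v(1) w(1)
    by (cases "\<nu> A \<ge> 0") (auto simp: ennreal_neg ennreal_plus[symmetric] simp del: ennreal_plus)
  then show ?thesis
    using m by simp
qed

end

section \<open>Integration against a difference of positive measures\<close>

lemma nn_integral_add_measure_eq:
  assumes sets: "sets N1 = sets M1" "sets M2 = sets M1" "sets N2 = sets M1"
    and eq: "\<And>A. A \<in> sets M1 \<Longrightarrow> emeasure M1 A + emeasure N1 A = emeasure M2 A + emeasure N2 A"
    and f: "f \<in> borel_measurable M1"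
  shows "(\<integral>\<^sup>+x. f x \<partial>M1) + (\<integral>\<^sup>+x. f x \<partial>N1) = (\<integral>\<^sup>+x. f x \<partial>M2) + (\<integral>\<^sup>+x. f x \<partial>N2)"
  using f
proof induction
  case (cong f g)
  have "nn_integral M f = nn_integral M g" if "sets M = sets M1" for M
    using cong(3) sets_eq_imp_space_eq[OF that] by (intro nn_integral_cong) auto
  then show ?case
    using cong sets by simp
next
  case (set A)
  then show ?case
    using eq sets by simp
next
  case (mult u c)
  have "(\<integral>\<^sup>+x. c * u x \<partial>M) = c * (\<integral>\<^sup>+x. u x \<partial>M)" if "sets M = sets M1" for M
    using mult measurable_cong_sets[OF that refl] by (intro nn_integral_cmult) auto
  then show ?case
    using mult sets by (simp add: distrib_left[symmetric])
next
  case (add u v)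
  have *: "(\<integral>\<^sup>+x. v x + u x \<partial>M) = (\<integral>\<^sup>+x. v x \<partial>M) + (\<integral>\<^sup>+x. u x \<partial>M)" if "sets M = sets M1" for M
  proof (rule nn_integral_add)
    show "v \<in> borel_measurable M" "u \<in> borel_measurable M"
      using add.hyps measurable_cong_sets[OF that refl] by blast+
  qed
  have "(\<integral>\<^sup>+x. v x + u x \<partial>M1) + (\<integral>\<^sup>+x. v x + u x \<partial>N1)
      = ((\<integral>\<^sup>+x. v x \<partial>M1) + (\<integral>\<^sup>+x. v x \<partial>N1)) + ((\<integral>\<^sup>+x. u x \<partial>M1) + (\<integral>\<^sup>+x. u x \<partial>N1))"
    unfolding *[OF refl] *[OF sets(1)] by (simp add: ac_simps)
  also have "\<dots> = ((\<integral>\<^sup>+x. v x \<partial>M2) + (\<integral>\<^sup>+x. v x \<partial>N2)) + ((\<integral>\<^sup>+x. u x \<partial>M2) + (\<integral>\<^sup>+x. u x \<partial>N2))"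
    unfolding add.IH ..
  also have "\<dots> = (\<integral>\<^sup>+x. v x + u x \<partial>M2) + (\<integral>\<^sup>+x. v x + u x \<partial>N2)"
    unfolding *[OF sets(2)] *[OF sets(3)] by (simp add: ac_simps)
  finally show ?case .
next
  case (seq U)
  have *: "(\<integral>\<^sup>+x. (SUP i. U i) x \<partial>M) = (SUP i. \<integral>\<^sup>+x. U i x \<partial>M)"
    "incseq (\<lambda>i. \<integral>\<^sup>+x. U i x \<partial>M)" if "sets M = sets M1" for M
  proof -
    have "U i \<in> borel_measurable M" for i
      using seq.hyps(1) measurable_cong_sets[OF that refl] by blast
    then show "(\<integral>\<^sup>+x. (SUP i. U i) x \<partial>M) = (SUP i. \<integral>\<^sup>+x. U i x \<partial>M)"
      using nn_integral_monotone_convergence_SUP[OF seq.hyps(3)] by (simp add: image_comp)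
    show "incseq (\<lambda>i. \<integral>\<^sup>+x. U i x \<partial>M)"
      using seq.hyps(3) by (auto simp: incseq_def le_fun_def intro!: nn_integral_mono)
  qed
  show ?case
    unfolding *(1)[OF refl] *(1)[OF sets(1)] *(1)[OF sets(2)] *(1)[OF sets(3)]
      ennreal_SUP_add[OF *(2)[OF refl] *(2)[OF sets(1)], symmetric]
      ennreal_SUP_add[OF *(2)[OF sets(2)] *(2)[OF sets(3)], symmetric] seq.IH ..
qed

text \<open>The Jordan decomposition of \<open>\<nu>\<close> is the smallest way to write it as a
  difference, so its parts lie below \<open>\<rho>a\<close> and \<open>\<rho>b\<close> and inherit
  integrability. The measures may be infinite, so the comparison of integrals rests on equality of
  the sums \<open>?P + \<rho>b\<close> and \<open>?N + \<rho>a\<close>; subtraction happens only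
  after the integrals are known to be finite.\<close>

lemma relcompact_borel_measure_difference:
  fixes \<rho>a \<rho>b :: "'a::topological_space measure" and S K
  defines "\<nu> \<equiv> \<lambda>B. measure \<rho>a B - measure \<rho>b B"
  assumes S: "S \<in> sets borel"
    and K: "\<And>n::nat. K n \<in> relcompact_borel S" "incseq K" "(\<Union>n. K n) = S"
    and sets: "sets \<rho>a = sets (restrict_space borel S)" "sets \<rho>b = sets (restrict_space borel S)"
    and fin: "\<And>B. B \<in> relcompact_borel S \<Longrightarrow> emeasure \<rho>a B < \<infinity>"
      "\<And>B. B \<in> relcompact_borel S \<Longrightarrow> emeasure \<rho>b B < \<infinity>"
  shows signed_borel_measure_difference: "signed_borel S \<nu>"
    and integral_measure_difference: "f \<in> borel_measurable (restrict_space borel S) \<Longrightarrow>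
      (\<And>x. 0 \<le> f x) \<Longrightarrow> (\<integral>\<^sup>+x. ennreal (f x) \<partial>\<rho>a) < \<infinity> \<Longrightarrow> (\<integral>\<^sup>+x. ennreal (f x) \<partial>\<rho>b) < \<infinity> \<Longrightarrow>
      integrable (pos_variation S \<nu>) f \<and> integrable (neg_variation S \<nu>) f \<and>
      integral\<^sup>L (pos_variation S \<nu>) f - integral\<^sup>L (neg_variation S \<nu>) f
        = integral\<^sup>L \<rho>a f - integral\<^sup>L \<rho>b f"
proof -
  have rc: "B \<in> sets \<rho>a" "B \<in> sets \<rho>b" if "B \<in> relcompact_borel S" for B
    using that sets by (auto simp: relcompact_borel_def)
  have sb: "signed_borel S (\<lambda>B. measure M B - measure N B)"
    if M: "sets M = sets (restrict_space borel S)" "sets N = sets (restrict_space borel S)"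
      "\<And>B. B \<in> relcompact_borel S \<Longrightarrow> emeasure M B < \<infinity>"
      "\<And>B. B \<in> relcompact_borel S \<Longrightarrow> emeasure N B < \<infinity>" for M N
  proof
    fix C and A :: "nat \<Rightarrow> 'a set"
    assume C: "C \<in> relcompact_borel S" "\<And>i. A i \<in> sets borel" "disjoint_family A" "(\<Union>i. A i) \<subseteq> C"
    have "D \<in> relcompact_borel S" if "D \<subseteq> C" "D \<in> sets borel" for D
      using that by (intro relcompact_borel_subset[OF S C(1)]) auto
    moreover have "A i \<subseteq> C" for i
      using C(4) by auto
    ultimately have D: "(\<Union>i. A i) \<in> relcompact_borel S" "A i \<in> relcompact_borel S" for i
      using C(2,4) by auto
    then show "(\<lambda>i. measure M (A i) - measure N (A i)) sums (measure M (\<Union>i. A i) - measure N (\<Union>i. A i))"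
      using C(3) M(3,4)[OF D(1)] M(1,2)
      by (intro sums_diff measure_UNION) (auto simp: relcompact_borel_def)
  qed (rule S)
  show "signed_borel S \<nu>"
    unfolding \<nu>_def using sets fin by (rule sb)
  then interpret P: signed_borel S \<nu> .
  have neg: "(\<lambda>B. - \<nu> B) = (\<lambda>B. measure \<rho>b B - measure \<rho>a B)"
    by (auto simp: \<nu>_def)
  interpret N: signed_borel S "\<lambda>B. - \<nu> B"
    by (rule signed_borel_uminus) (rule P.signed_borel_axioms)
  let ?P = "pos_variation S \<nu>" and ?N = "neg_variation S \<nu>"
  have sets_var: "sets ?P = sets (restrict_space borel S)" "sets ?N = sets (restrict_space borel S)"
    by (simp_all add: neg_variation_def)
  have borelD: "A \<in> sets borel" "A \<subseteq> S" if "A \<in> sets (restrict_space borel S)" for A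
    using that S by (auto simp: sets_restrict_space_iff)
  \<comment> \<open>Each competitor \<open>B\<close> for the positive part satisfies
    \<open>\<nu> B \<le> \<rho>a B \<le> \<rho>a A\<close>, and similarly for the negative
    part.\<close>
  have le: "emeasure ?P A \<le> emeasure \<rho>a A" "emeasure ?N A \<le> emeasure \<rho>b A"
    if A: "A \<in> sets (restrict_space borel S)" for A
  proof -
    have "ennreal (\<nu> B) \<le> emeasure \<rho>a A \<and> ennreal (- \<nu> B) \<le> emeasure \<rho>b A"
      if B: "B \<in> relcompact_borel S" "B \<subseteq> A" for B
    proof -
      have "ennreal (\<nu> B) \<le> emeasure \<rho>a B" "ennreal (- \<nu> B) \<le> emeasure \<rho>b B"
        using fin[OF B(1)] by (auto simp: emeasure_eq_ennreal_measure \<nu>_def intro!: ennreal_leI)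
      moreover have "emeasure \<rho>a B \<le> emeasure \<rho>a A" "emeasure \<rho>b B \<le> emeasure \<rho>b A"
        using A B sets by (auto intro!: emeasure_mono)
      ultimately show ?thesis
        by (auto intro: order_trans)
    qed
    then show "emeasure ?P A \<le> emeasure \<rho>a A" "emeasure ?N A \<le> emeasure \<rho>b A"
      unfolding neg_variation_def P.emeasure_pos_variation[OF borelD[OF A]]
        N.emeasure_pos_variation[OF borelD[OF A]] P.upper_variation_def N.upper_variation_def
      by (auto intro!: SUP_least)
  qed
  have eq_rc: "emeasure ?P A + emeasure \<rho>b A = emeasure ?N A + emeasure \<rho>a A"
    if A: "A \<in> relcompact_borel S" for A
  proof -
    have A': "A \<in> sets (restrict_space borel S)"
      using A by (simp add: relcompact_borel_def)
    have f: "emeasure ?P A < \<infinity>" "emeasure ?N A < \<infinity>"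
      using le[OF A'] fin[OF A] by auto
    have "measure ?P A + measure \<rho>b A = measure ?N A + measure \<rho>a A"
      using P.measure_pos_minus_neg[OF A] by (simp add: \<nu>_def)
    then show ?thesis
      using f fin[OF A]
      by (simp add: emeasure_eq_ennreal_measure ennreal_plus[symmetric] del: ennreal_plus)
  qed
  \<comment> \<open>A general \<open>A\<close> may have infinite mass; both sides are monotone
    limits along the exhaustion \<open>A \<inter> K n\<close>.\<close>
  have eq: "emeasure ?P A + emeasure \<rho>b A = emeasure ?N A + emeasure \<rho>a A"
    if A: "A \<in> sets (restrict_space borel S)" for A
  proof -
    have AK: "A \<inter> K n \<in> relcompact_borel S" for n
    proof -
      have "K n \<in> sets borel"
        using K(1)[of n] S by (simp add: relcompact_borel_iff)
      then show ?thesis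
        using borelD[OF A] by (intro relcompact_borel_subset[OF S K(1)[of n]]) auto
    qed
    have UN: "(\<Union>n. A \<inter> K n) = A"
      using K(3) borelD(2)[OF A] by auto
    have inc: "incseq (\<lambda>n. A \<inter> K n)"
      using K(2) by (auto simp: incseq_def)
    have sup: "emeasure M A = (SUP n. emeasure M (A \<inter> K n))" "incseq (\<lambda>n. emeasure M (A \<inter> K n))"
      if M: "sets M = sets (restrict_space borel S)" for M
    proof -
      have AM: "range (\<lambda>n. A \<inter> K n) \<subseteq> sets M"
        using AK M by (auto simp: relcompact_borel_def)
      show "emeasure M A = (SUP n. emeasure M (A \<inter> K n))"
        using SUP_emeasure_incseq[OF AM inc] UN by simp
      show "incseq (\<lambda>n. emeasure M (A \<inter> K n))"
        using inc AM by (auto simp: incseq_def intro!: emeasure_mono)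
    qed
    show ?thesis
      using eq_rc[OF AK]
      by (simp add: sup sets_var sets ennreal_SUP_add[symmetric])
  qed
  assume f: "f \<in> borel_measurable (restrict_space borel S)" "\<And>x. 0 \<le> f x"
    and fa: "(\<integral>\<^sup>+x. ennreal (f x) \<partial>\<rho>a) < \<infinity>" and fb: "(\<integral>\<^sup>+x. ennreal (f x) \<partial>\<rho>b) < \<infinity>"
  have meas: "f \<in> borel_measurable M" if "sets M = sets (restrict_space borel S)" for M
    using f(1) measurable_cong_sets[OF that refl] by blast
  have "(\<integral>\<^sup>+x. ennreal (f x) \<partial>?P) \<le> (\<integral>\<^sup>+x. ennreal (f x) \<partial>\<rho>a)"
    "(\<integral>\<^sup>+x. ennreal (f x) \<partial>?N) \<le> (\<integral>\<^sup>+x. ennreal (f x) \<partial>\<rho>b)"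
    using le sets sets_var by (auto intro!: nn_integral_mono_measure simp: le_measure)
  then have fin_var: "(\<integral>\<^sup>+x. ennreal (f x) \<partial>?P) < \<infinity>" "(\<integral>\<^sup>+x. ennreal (f x) \<partial>?N) < \<infinity>"
    using fa fb by auto
  have int: "integrable M f" "ennreal (integral\<^sup>L M f) = (\<integral>\<^sup>+x. ennreal (f x) \<partial>M)"
    if "sets M = sets (restrict_space borel S)" "(\<integral>\<^sup>+x. ennreal (f x) \<partial>M) < \<infinity>" for M
  proof -
    show int: "integrable M f"
      using meas[OF that(1)] f(2) that(2) by (intro integrableI_nonneg) auto
    show "ennreal (integral\<^sup>L M f) = (\<integral>\<^sup>+x. ennreal (f x) \<partial>M)"
      using f(2) by (intro nn_integral_eq_integral[symmetric] int) auto
  qed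
  have "(\<integral>\<^sup>+x. ennreal (f x) \<partial>?P) + (\<integral>\<^sup>+x. ennreal (f x) \<partial>\<rho>b)
      = (\<integral>\<^sup>+x. ennreal (f x) \<partial>?N) + (\<integral>\<^sup>+x. ennreal (f x) \<partial>\<rho>a)"
    using eq sets sets_var meas[OF sets_var(1)] by (intro nn_integral_add_measure_eq) auto
  then have "ennreal (integral\<^sup>L ?P f) + ennreal (integral\<^sup>L \<rho>b f) = ennreal (integral\<^sup>L ?N f) + ennreal (integral\<^sup>L \<rho>a f)"
    unfolding int(2)[OF sets_var(1) fin_var(1)] int(2)[OF sets_var(2) fin_var(2)]
      int(2)[OF sets(1) fa] int(2)[OF sets(2) fb] .
  moreover have "0 \<le> integral\<^sup>L M f" for M
    using f(2) by simp
  ultimately have "integral\<^sup>L ?P f + integral\<^sup>L \<rho>b f = integral\<^sup>L ?N f + integral\<^sup>L \<rho>a f"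
    by (simp add: ennreal_plus[symmetric] del: ennreal_plus)
  then show "integrable ?P f \<and> integrable ?N f \<and>
      integral\<^sup>L ?P f - integral\<^sup>L ?N f = integral\<^sup>L \<rho>a f - integral\<^sup>L \<rho>b f"
    using int(1) sets_var fin_var by auto
qed

section \<open>Lorentz transformations and invariant measures\<close>

lemma UNIV_4_zero: "UNIV = {0, 1, 2, 3 :: 4}"
proof -
  have "(4::4) = 0"
    by simp
  then show ?thesis
    unfolding UNIV_4 by auto
qed

lemma forall_4_zero: "(\<forall>i::4. P i) \<longleftrightarrow> P 0 \<and> P 1 \<and> P 2 \<and> P 3"
  using UNIV_4_zero by (metis UNIV_I empty_iff insert_iff)

text \<open>Cofactor expansion along the time row, so that determinant 1 can be checked by
  evaluation for explicit maps.\<close>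

lemma det_4:
  "det (A::'a::comm_ring_1^4^4) =
    A$0$0 * (A$1$1 * (A$2$2 * A$3$3 - A$2$3 * A$3$2) - A$1$2 * (A$2$1 * A$3$3 - A$2$3 * A$3$1) + A$1$3 * (A$2$1 * A$3$2 - A$2$2 * A$3$1))
  - A$0$1 * (A$1$0 * (A$2$2 * A$3$3 - A$2$3 * A$3$2) - A$1$2 * (A$2$0 * A$3$3 - A$2$3 * A$3$0) + A$1$3 * (A$2$0 * A$3$2 - A$2$2 * A$3$0))
  + A$0$2 * (A$1$0 * (A$2$1 * A$3$3 - A$2$3 * A$3$1) - A$1$1 * (A$2$0 * A$3$3 - A$2$3 * A$3$0) + A$1$3 * (A$2$0 * A$3$1 - A$2$1 * A$3$0))
  - A$0$3 * (A$1$0 * (A$2$1 * A$3$2 - A$2$2 * A$3$1) - A$1$1 * (A$2$0 * A$3$2 - A$2$2 * A$3$0) + A$1$2 * (A$2$0 * A$3$1 - A$2$1 * A$3$0))"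
proof -
  have f0: "finite {1::4, 2, 3}" "0 \<notin> {1::4, 2, 3}"
    by auto
  have f1: "finite {2::4, 3}" "1 \<notin> {2::4, 3}"
    by auto
  have f2: "finite {3::4}" "2 \<notin> {3::4}"
    by auto
  show ?thesis
    unfolding det_def UNIV_4_zero
    unfolding sum_over_permutations_insert[OF f0]
    unfolding sum_over_permutations_insert[OF f1]
    unfolding sum_over_permutations_insert[OF f2]
    unfolding permutes_sing
    by (simp add: sign_swap_id permutation_swap_id permutation_compose sign_compose sign_id swap_id_eq algebra_simps)
qed

text \<open>A combination of axis vectors, so that linearity and measurability in the entries follow
  from those of addition and scaling.\<close>

definition pt :: "real \<Rightarrow> real \<Rightarrow> real \<Rightarrow> real \<Rightarrow> real^4" where
  "pt a b c d = a *\<^sub>R axis 0 1 + b *\<^sub>R axis 1 1 + c *\<^sub>R axis 2 1 + d *\<^sub>R axis 3 1"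

lemma pt_nth [simp]: "pt a b c d $ 0 = a" "pt a b c d $ 1 = b" "pt a b c d $ 2 = c" "pt a b c d $ 3 = d"
  by (simp_all add: pt_def axis_def)

lemma vec4_eq_iff: "(p :: real^4) = q \<longleftrightarrow> p $ 0 = q $ 0 \<and> p $ 1 = q $ 1 \<and> p $ 2 = q $ 2 \<and> p $ 3 = q $ 3"
  by (simp add: vec_eq_iff forall_4_zero)

lemma pt_measurable [measurable]:
  assumes [measurable]: "a \<in> borel_measurable M" "b \<in> borel_measurable M"
    "c \<in> borel_measurable M" "d \<in> borel_measurable M"
  shows "(\<lambda>x. pt (a x) (b x) (c x) (d x)) \<in> borel_measurable M"
  unfolding pt_def by measurable

lemma vec_nth_measurable [measurable (raw)]:
  fixes f :: "'a \<Rightarrow> real^'n"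
  assumes "f \<in> borel_measurable M"
  shows "(\<lambda>x. f x $ i) \<in> borel_measurable M"
  by (rule measurable_compose[OF assms]) (intro borel_measurable_continuous_onI continuous_intros)

lemma minkowski_sq_measurable [measurable (raw)]:
  assumes [measurable]: "f \<in> borel_measurable M"
  shows "(\<lambda>x. minkowski_sq (f x)) \<in> borel_measurable M"
  unfolding minkowski_sq_def by measurable

text \<open>Membership in the proper orthochronous group, phrased for maps given by coordinate
  formulas; the last condition is the entry \<open>\<Lambda> $ 0 $ 0\<close>.\<close>

definition lorentz_map :: "(real^4 \<Rightarrow> real^4) \<Rightarrow> bool" where
  "lorentz_map f \<longleftrightarrow> linear f \<and> (\<forall>p. minkowski_sq (f p) = minkowski_sq p) \<and>
     det (matrix f) = 1 \<and> f (axis 0 1) $ 0 > 0"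

lemma lorentz_map_matrix:
  assumes "lorentz_map f"
  shows "matrix f \<in> proper_orthochronous_lorentz" "(*v) (matrix f) = f"
proof -
  show eq: "(*v) (matrix f) = f"
    using assms by (simp add: lorentz_map_def matrix_vector_mul)
  then show "matrix f \<in> proper_orthochronous_lorentz"
    using assms by (simp add: lorentz_map_def proper_orthochronous_lorentz_def) (simp add: matrix_def)
qed

lemma matrix_nth: "matrix f $ i $ j = f (axis j 1) $ i"
  by (simp add: matrix_def)

lemma axis_4_nth [simp]:
  "axis (0::4) (1::real) $ 0 = 1" "axis (0::4) (1::real) $ 1 = 0" "axis (0::4) (1::real) $ 2 = 0" "axis (0::4) (1::real) $ 3 = 0"
  "axis (1::4) (1::real) $ 0 = 0" "axis (1::4) (1::real) $ 1 = 1" "axis (1::4) (1::real) $ 2 = 0" "axis (1::4) (1::real) $ 3 = 0"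
  "axis (2::4) (1::real) $ 0 = 0" "axis (2::4) (1::real) $ 1 = 0" "axis (2::4) (1::real) $ 2 = 1" "axis (2::4) (1::real) $ 3 = 0"
  "axis (3::4) (1::real) $ 0 = 0" "axis (3::4) (1::real) $ 1 = 0" "axis (3::4) (1::real) $ 2 = 0" "axis (3::4) (1::real) $ 3 = 1"
  by (simp_all add: axis_def)

lemma lorentz_map_ptI:
  assumes f: "\<And>p. f p = pt (fa p) (fb p) (fc p) (fd p)"
    and lin: "linear fa" "linear fb" "linear fc" "linear fd"
    and "\<And>p. (fa p)\<^sup>2 - (fb p)\<^sup>2 - (fc p)\<^sup>2 - (fd p)\<^sup>2 = minkowski_sq p"
    and "det (matrix f) = 1" "fa (axis 0 1) > 0"
  shows "lorentz_map f"
proof -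
  have "f = (\<lambda>p. pt (fa p) (fb p) (fc p) (fd p))"
    using f by auto
  moreover have "linear (\<lambda>p. pt (fa p) (fb p) (fc p) (fd p))"
    unfolding pt_def by (intro linear_compose_add linear_compose_scale_right linear_compose[unfolded o_def, OF _ linear_scaleR_left] lin) 
  ultimately show ?thesis
    using assms(6-) by (simp add: lorentz_map_def minkowski_sq_def)
qed

definition boost :: "real \<Rightarrow> real^4 \<Rightarrow> real^4" where
  "boost t p = pt (cosh t * p $ 0 + sinh t * p $ 3) (p $ 1) (p $ 2) (sinh t * p $ 0 + cosh t * p $ 3)"

text \<open>A parabolic transformation: it fixes x, shifts p1 by v x and shifts p0 - p3 by 2 v p1 +
  v^2 x. The quadratic term keeps x (p0 - p3) - p1^2 constant.\<close>

definition null_rotation1 :: "real \<Rightarrow> real^4 \<Rightarrow> real^4" where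
  "null_rotation1 v p =
     pt (p $ 0 + v * p $ 1 + v\<^sup>2 / 2 * (p $ 0 + p $ 3)) (p $ 1 + v * (p $ 0 + p $ 3)) (p $ 2)
        (p $ 3 - v * p $ 1 - v\<^sup>2 / 2 * (p $ 0 + p $ 3))"

definition null_rotation2 :: "real \<Rightarrow> real^4 \<Rightarrow> real^4" where
  "null_rotation2 v p =
     pt (p $ 0 + v * p $ 2 + v\<^sup>2 / 2 * (p $ 0 + p $ 3)) (p $ 1) (p $ 2 + v * (p $ 0 + p $ 3))
        (p $ 3 - v * p $ 2 - v\<^sup>2 / 2 * (p $ 0 + p $ 3))"

lemma lorentz_map_boost: "lorentz_map (boost t)"
proof (rule lorentz_map_ptI[OF boost_def])
  have 1: "(cosh t)\<^sup>2 = 1 + (sinh t)\<^sup>2"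
    using hyperbolic_pythagoras[of t] by simp
  show "(cosh t * p $ 0 + sinh t * p $ 3)\<^sup>2 - (p $ 1)\<^sup>2 - (p $ 2)\<^sup>2 - (sinh t * p $ 0 + cosh t * p $ 3)\<^sup>2 = minkowski_sq p" for p
    unfolding minkowski_sq_def using 1 by algebra
  show "det (matrix (boost t)) = 1"
    unfolding det_4 matrix_nth using 1 by (simp add: boost_def power2_eq_square)
qed (auto intro!: linearI simp: algebra_simps)

lemma lorentz_map_null_rotation1: "lorentz_map (null_rotation1 v)"
proof (rule lorentz_map_ptI[OF null_rotation1_def])
  show "det (matrix (null_rotation1 v)) = 1"
    unfolding det_4 matrix_nth by (simp add: null_rotation1_def power2_eq_square field_simps)
  show "0 < (axis 0 1 :: real^4) $ 0 + v * (axis 0 1 :: real^4) $ 1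
      + v\<^sup>2 / 2 * ((axis 0 1 :: real^4) $ 0 + (axis 0 1 :: real^4) $ 3)"
    by (simp add: add_pos_nonneg)
qed (auto intro!: linearI simp: minkowski_sq_def algebra_simps power2_eq_square field_simps)

lemma lorentz_map_null_rotation2: "lorentz_map (null_rotation2 v)"
proof (rule lorentz_map_ptI[OF null_rotation2_def])
  show "det (matrix (null_rotation2 v)) = 1"
    unfolding det_4 matrix_nth by (simp add: null_rotation2_def power2_eq_square field_simps)
  show "0 < (axis 0 1 :: real^4) $ 0 + v * (axis 0 1 :: real^4) $ 2
      + v\<^sup>2 / 2 * ((axis 0 1 :: real^4) $ 0 + (axis 0 1 :: real^4) $ 3)"
    by (simp add: add_pos_nonneg)
qed (auto intro!: linearI simp: minkowski_sq_def algebra_simps power2_eq_square field_simps)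

text \<open>Half-turns about the axes e1, e1 + e3, e1 - e3 and e2 + e3, each its own inverse. The
  first exchanges p0 + p3 and p0 - p3; the others send p0 + p3 to p0 + p1, p0 - p1 and p0 +
  p2.\<close>

lemma lorentz_map_rotations:
  "lorentz_map (\<lambda>p. pt (p $ 0) (p $ 1) (- p $ 2) (- p $ 3))"
  "lorentz_map (\<lambda>p. pt (p $ 0) (p $ 3) (- p $ 2) (p $ 1))"
  "lorentz_map (\<lambda>p. pt (p $ 0) (- p $ 3) (- p $ 2) (- p $ 1))"
  "lorentz_map (\<lambda>p. pt (p $ 0) (- p $ 1) (p $ 3) (p $ 2))"
  by (rule lorentz_map_ptI[OF refl],
      auto intro!: linearI simp: minkowski_sq_def algebra_simps matrix_nth det_4)+

section \<open>Positive Lorentz invariant measures and one-parameter flows\<close>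

locale lorentz_invariant_measure =
  fixes M :: "(real^4) measure"
  assumes sets_M [measurable_cong, simp]: "sets M = sets borel"
    and invariant: "\<And>\<Lambda> A. \<Lambda> \<in> proper_orthochronous_lorentz \<Longrightarrow> A \<in> sets borel \<Longrightarrow>
      emeasure M ((*v) \<Lambda> ` A) = emeasure M A"
    and finite_bounded: "\<And>A. A \<in> sets borel \<Longrightarrow> bounded A \<Longrightarrow> emeasure M A < \<infinity>"
begin

lemma space_M [simp]: "space M = UNIV"
  using sets_eq_imp_space_eq[OF sets_M] by simp

sublocale sigma_finite_measure M
proof
  show "\<exists>A. countable A \<and> A \<subseteq> sets M \<and> \<Union> A = space M \<and> (\<forall>a\<in>A. emeasure M a \<noteq> \<infinity>)"
  proof (intro exI conjI)
    show "(\<Union>n. ball 0 (real n)) = space M"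
      by (auto intro: reals_Archimedean2)
    have "emeasure M (ball 0 r) \<noteq> \<infinity>" for r
      using finite_bounded[of "ball 0 r"] by auto
    then show "\<forall>a\<in>range (\<lambda>n. ball 0 (real n)). emeasure M a \<noteq> \<infinity>"
      by auto
  qed auto
qed

lemma distr_lorentz_map:
  assumes [measurable]: "f \<in> borel_measurable borel"
    and "lorentz_map g" "\<And>p. f (g p) = p" "\<And>p. g (f p) = p"
  shows "distr M borel f = M"
proof (rule measure_eqI)
  fix A assume "A \<in> sets (distr M borel f)"
  then have A[measurable]: "A \<in> sets borel" by simp
  \<comment> \<open>Invariance is stated for images, so the preimage under \<open>f\<close> becomes
    the image under its Lorentz inverse \<open>g\<close>.\<close>
  have "f -` A = g ` A"
    using assms(3,4) by (auto simp: image_iff) metis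
  then have "f -` A = (*v) (matrix g) ` A"
    by (simp add: lorentz_map_matrix(2)[OF assms(2)])
  then show "emeasure (distr M borel f) A = emeasure M A"
    using invariant[OF lorentz_map_matrix(1)[OF assms(2)] A] by (simp add: emeasure_distr)
qed simp

lemma nn_integral_lorentz_map:
  assumes [measurable]: "f \<in> borel_measurable borel"
    and g: "lorentz_map g" "\<And>p. f (g p) = p" "\<And>p. g (f p) = p"
    and [measurable]: "h \<in> borel_measurable borel"
  shows "(\<integral>\<^sup>+p. h (f p) \<partial>M) = (\<integral>\<^sup>+p. h p \<partial>M)"
proof -
  have "(\<integral>\<^sup>+p. h (f p) \<partial>M) = (\<integral>\<^sup>+p. h p \<partial>distr M borel f)"
    by (subst nn_integral_distr) auto
  then show ?thesis
    by (simp add: distr_lorentz_map[OF assms(1) g])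
qed

text \<open>Fubini exchanges the flow parameter with p, invariance of \<open>M\<close> moves the
  flow from \<open>h\<close> to \<open>f\<close> at the price of inverting it, and the reflection t
  -> -t of Lebesgue measure removes the inversion.\<close>

lemma nn_integral_flow_symmetric:
  fixes \<phi> :: "real \<Rightarrow> real^4 \<Rightarrow> real^4"
  assumes [measurable]: "case_prod \<phi> \<in> borel_measurable (borel \<Otimes>\<^sub>M borel)"
    and lm: "\<And>t. lorentz_map (\<phi> t)" and inv: "\<And>t p. \<phi> t (\<phi> (- t) p) = p"
    and [measurable]: "f \<in> borel_measurable borel" "h \<in> borel_measurable borel"
  shows "(\<integral>\<^sup>+p. f p * (\<integral>\<^sup>+t. h (\<phi> t p) \<partial>lborel) \<partial>M) = (\<integral>\<^sup>+p. h p * (\<integral>\<^sup>+t. f (\<phi> t p) \<partial>lborel) \<partial>M)"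
proof -
  interpret pair_sigma_finite lborel M ..
  have inv': "\<phi> (- t) (\<phi> t p) = p" for t p
    using inv[of "- t"] by simp
  have [measurable]: "\<phi> t \<in> borel_measurable borel" for t
    by (rule measurable_compose[of "\<lambda>p. (t, p)" _ "borel \<Otimes>\<^sub>M borel" "case_prod \<phi>", simplified]) auto
  have "(\<integral>\<^sup>+p. f p * (\<integral>\<^sup>+t. h (\<phi> t p) \<partial>lborel) \<partial>M) = (\<integral>\<^sup>+p. (\<integral>\<^sup>+t. f p * h (\<phi> t p) \<partial>lborel) \<partial>M)"
    by (intro nn_integral_cong nn_integral_cmult[symmetric]) simp
  also have "\<dots> = (\<integral>\<^sup>+t. (\<integral>\<^sup>+p. f p * h (\<phi> t p) \<partial>M) \<partial>lborel)"
    by (rule Fubini') measurable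
  also have "\<dots> = (\<integral>\<^sup>+t. (\<integral>\<^sup>+p. f (\<phi> (- t) p) * h p \<partial>M) \<partial>lborel)"
  proof (rule nn_integral_cong)
    fix t
    show "(\<integral>\<^sup>+p. f p * h (\<phi> t p) \<partial>M) = (\<integral>\<^sup>+p. f (\<phi> (- t) p) * h p \<partial>M)"
      using nn_integral_lorentz_map[of "\<phi> t" "\<phi> (- t)" "\<lambda>p. f (\<phi> (- t) p) * h p"] lm inv inv' by simp
  qed
  also have "\<dots> = (\<integral>\<^sup>+p. (\<integral>\<^sup>+t. f (\<phi> (- t) p) * h p \<partial>lborel) \<partial>M)"
    by (rule Fubini'[symmetric]) measurable
  also have "\<dots> = (\<integral>\<^sup>+p. h p * (\<integral>\<^sup>+t. f (\<phi> (- t) p) \<partial>lborel) \<partial>M)"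
    by (subst mult.commute, intro nn_integral_cong nn_integral_cmult) simp
  also have "\<dots> = (\<integral>\<^sup>+p. h p * (\<integral>\<^sup>+t. f (\<phi> t p) \<partial>lborel) \<partial>M)"
  proof -
    have "(\<integral>\<^sup>+t. f (\<phi> (- t) p) \<partial>lborel) = (\<integral>\<^sup>+t. f (\<phi> t p) \<partial>lborel)" for p
      using nn_integral_real_affine[where f="\<lambda>t. f (\<phi> t p)" and c="-1" and t=0] by simp
    then show ?thesis
      by simp
  qed
  finally show ?thesis .
qed

end

section \<open>Light-cone coordinates\<close>

text \<open>The point with \<open>p\<^sup>0 + p\<^sup>3 = x\<close>, transverse momentum \<open>(y1, y2)\<close> and Minkowski square \<open>s\<close>; this
  determines \<open>p\<^sup>0 - p\<^sup>3 = (s + y1\<^sup>2 + y2\<^sup>2) / x\<close>. Meaningless for \<open>x = 0\<close>.\<close>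

definition light_cone :: "real \<Rightarrow> real \<Rightarrow> real \<Rightarrow> real \<Rightarrow> real^4" where
  "light_cone s x y1 y2 = pt ((x + (s + y1\<^sup>2 + y2\<^sup>2) / x) / 2) y1 y2 ((x - (s + y1\<^sup>2 + y2\<^sup>2) / x) / 2)"

definition plus_coord :: "real^4 \<Rightarrow> real" where
  "plus_coord p = p $ 0 + p $ 3"

lemma light_cone_measurable [measurable (raw)]:
  assumes [measurable]: "s \<in> borel_measurable M" "x \<in> borel_measurable M"
    "y1 \<in> borel_measurable M" "y2 \<in> borel_measurable M"
  shows "(\<lambda>a. light_cone (s a) (x a) (y1 a) (y2 a)) \<in> borel_measurable M"
  unfolding light_cone_def by measurable

lemma plus_coord_measurable [measurable (raw)]:
  assumes [measurable]: "f \<in> borel_measurable M"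
  shows "(\<lambda>x. plus_coord (f x)) \<in> borel_measurable M"
  unfolding plus_coord_def by measurable

lemma plus_coord_light_cone [simp]: "plus_coord (light_cone s x y1 y2) = x"
  by (simp add: plus_coord_def light_cone_def field_simps)

lemma light_cone_nth [simp]: "light_cone s x y1 y2 $ 1 = y1" "light_cone s x y1 y2 $ 2 = y2"
  by (simp_all add: light_cone_def)

lemma minkowski_sq_pt: "minkowski_sq (pt a b c d) = a\<^sup>2 - b\<^sup>2 - c\<^sup>2 - d\<^sup>2"
  by (simp add: minkowski_sq_def)

lemma minkowski_sq_light_cone: "x \<noteq> 0 \<Longrightarrow> minkowski_sq (light_cone s x y1 y2) = s"
  by (simp add: minkowski_sq_pt light_cone_def field_simps power2_eq_square)

text \<open>For x \<noteq> 0 the equation p^2 = x (p0 - p3) - p1^2 - p2^2 can be solved for the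
  missing coordinate p0 - p3.\<close>

lemma light_cone_eqI:
  assumes "x \<noteq> 0" "plus_coord p = x" "p $ 1 = y1" "p $ 2 = y2" "minkowski_sq p = s"
  shows "p = light_cone s x y1 y2"
proof -
  have "(p $ 0 - p $ 3) * x = s + y1\<^sup>2 + y2\<^sup>2"
    using assms(2-) by (auto simp: minkowski_sq_def plus_coord_def algebra_simps power2_eq_square)
  then have "p $ 0 - p $ 3 = (s + y1\<^sup>2 + y2\<^sup>2) / x"
    using assms(1) by (simp add: field_simps)
  then show ?thesis
    using assms(2-4) by (simp add: vec4_eq_iff light_cone_def plus_coord_def)
qed

section \<open>The flows in light-cone coordinates\<close>

lemma plus_coord_flow [simp]:
  "plus_coord (boost t p) = exp t * plus_coord p"
  "plus_coord (null_rotation1 v p) = plus_coord p"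
  "plus_coord (null_rotation2 v p) = plus_coord p"
  by (simp_all add: plus_coord_def boost_def null_rotation1_def null_rotation2_def
      cosh_def sinh_def field_simps)

lemma flow_nth [simp]:
  "boost t p $ 1 = p $ 1" "boost t p $ 2 = p $ 2"
  "null_rotation1 v p $ 1 = p $ 1 + v * plus_coord p" "null_rotation1 v p $ 2 = p $ 2"
  "null_rotation2 v p $ 1 = p $ 1" "null_rotation2 v p $ 2 = p $ 2 + v * plus_coord p"
  by (simp_all add: plus_coord_def boost_def null_rotation1_def null_rotation2_def)

lemma minkowski_sq_flow [simp]:
  "minkowski_sq (boost t p) = minkowski_sq p"
  "minkowski_sq (null_rotation1 v p) = minkowski_sq p"
  "minkowski_sq (null_rotation2 v p) = minkowski_sq p"
  using lorentz_map_boost lorentz_map_null_rotation1 lorentz_map_null_rotation2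
  by (auto simp: lorentz_map_def)

lemma boost_inverse: "boost t (boost (- t) p) = p"
proof -
  have "(cosh t)\<^sup>2 = 1 + (sinh t)\<^sup>2"
    using hyperbolic_pythagoras[of t] by simp
  then show ?thesis
    unfolding vec4_eq_iff boost_def by (auto simp: algebra_simps) (algebra+)
qed

lemma null_rotation1_inverse: "null_rotation1 v (null_rotation1 (- v) p) = p"
  by (simp add: vec4_eq_iff null_rotation1_def algebra_simps power2_eq_square)

lemma null_rotation2_inverse: "null_rotation2 v (null_rotation2 (- v) p) = p"
  by (simp add: vec4_eq_iff null_rotation2_def algebra_simps power2_eq_square)

lemma flow_measurable:
  "case_prod boost \<in> borel_measurable (borel \<Otimes>\<^sub>M borel)"
  "case_prod null_rotation1 \<in> borel_measurable (borel \<Otimes>\<^sub>M borel)"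
  "case_prod null_rotation2 \<in> borel_measurable (borel \<Otimes>\<^sub>M borel)"
  unfolding boost_def null_rotation1_def null_rotation2_def cosh_def sinh_def by measurable

lemma flow_measurable' [measurable (raw)]:
  assumes [measurable]: "t \<in> borel_measurable M" "f \<in> borel_measurable M"
  shows "(\<lambda>x. boost (t x) (f x)) \<in> borel_measurable M"
    "(\<lambda>x. null_rotation1 (t x) (f x)) \<in> borel_measurable M"
    "(\<lambda>x. null_rotation2 (t x) (f x)) \<in> borel_measurable M"
  unfolding boost_def null_rotation1_def null_rotation2_def cosh_def sinh_def by measurable

text \<open>The substitution \<open>x = \<epsilon> e\<^sup>t\<close> turns \<open>dx / \<bar>x\<bar>\<close> into Lebesgue measure.\<close>

definition shell_integral :: "real \<Rightarrow> real \<Rightarrow> (real^4 \<Rightarrow> ennreal) \<Rightarrow> ennreal" where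
  "shell_integral \<epsilon> s f =
     (\<integral>\<^sup>+y1. \<integral>\<^sup>+y2. \<integral>\<^sup>+t. f (light_cone s (\<epsilon> * exp t) y1 y2) \<partial>lborel \<partial>lborel \<partial>lborel)"

lemma shell_integral_measurable [measurable (raw)]:
  assumes [measurable]: "s \<in> borel_measurable M" "f \<in> borel_measurable borel"
  shows "(\<lambda>x. shell_integral \<epsilon> (s x) f) \<in> borel_measurable M"
  unfolding shell_integral_def by measurable

text \<open>Prepares \<open>shell_integral_orbit'\<close>, where the boost acts first and is
  therefore integrated last.\<close>

lemma shell_integral_swap:
  assumes [measurable]: "f \<in> borel_measurable borel"
  shows "shell_integral \<epsilon> s f =
     (\<integral>\<^sup>+t. \<integral>\<^sup>+y2. \<integral>\<^sup>+y1. f (light_cone s (\<epsilon> * exp t) y1 y2) \<partial>lborel \<partial>lborel \<partial>lborel)"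
proof -
  have "shell_integral \<epsilon> s f =
     (\<integral>\<^sup>+y1. \<integral>\<^sup>+t. \<integral>\<^sup>+y2. f (light_cone s (\<epsilon> * exp t) y1 y2) \<partial>lborel \<partial>lborel \<partial>lborel)"
    unfolding shell_integral_def by (intro nn_integral_cong lborel_pair.Fubini') measurable
  also have "\<dots> = (\<integral>\<^sup>+t. \<integral>\<^sup>+y1. \<integral>\<^sup>+y2. f (light_cone s (\<epsilon> * exp t) y1 y2) \<partial>lborel \<partial>lborel \<partial>lborel)"
    by (rule lborel_pair.Fubini') measurable
  also have "\<dots> = (\<integral>\<^sup>+t. \<integral>\<^sup>+y2. \<integral>\<^sup>+y1. f (light_cone s (\<epsilon> * exp t) y1 y2) \<partial>lborel \<partial>lborel \<partial>lborel)"
    by (intro nn_integral_cong lborel_pair.Fubini') measurable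
  finally show ?thesis .
qed

lemma nn_integral_affine:
  fixes f :: "real \<Rightarrow> ennreal"
  assumes "f \<in> borel_measurable borel" "c \<noteq> 0"
  shows "(\<integral>\<^sup>+v. f (y + v * c) \<partial>lborel) = ennreal (1 / \<bar>c\<bar>) * (\<integral>\<^sup>+x. f x \<partial>lborel)"
  using nn_integral_real_affine[OF assms, of y] assms(2)
  by (simp add: mult.assoc[symmetric] ennreal_mult[symmetric] mult.commute)

lemma nn_integral_translate:
  fixes f :: "real \<Rightarrow> ennreal"
  assumes "f \<in> borel_measurable borel"
  shows "(\<integral>\<^sup>+v. f (y + v) \<partial>lborel) = (\<integral>\<^sup>+x. f x \<partial>lborel)"
  using nn_integral_affine[OF assms, of 1 y] by simp

context
  fixes \<epsilon> :: real and p :: "real^4" and f :: "real^4 \<Rightarrow> ennreal"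
  assumes \<epsilon>: "\<epsilon> = 1 \<or> \<epsilon> = -1" and p: "\<epsilon> * plus_coord p > 0"
    and f [measurable]: "f \<in> borel_measurable borel"
begin

lemma plus_coord_exp: "plus_coord p = \<epsilon> * exp (ln \<bar>plus_coord p\<bar>)" "plus_coord p \<noteq> 0"
  using \<epsilon> p by auto

text \<open>The null rotations act first and shift each transverse coordinate by a multiple of the x
  of \<open>p\<close> itself, so each contributes the constant factor 1/|x|. The boost then merely
  translates ln |x|.\<close>

lemma shell_integral_orbit:
  "(\<integral>\<^sup>+v1. \<integral>\<^sup>+v2. \<integral>\<^sup>+t. f (boost t (null_rotation2 v2 (null_rotation1 v1 p))) \<partial>lborel \<partial>lborel \<partial>lborel)
   = ennreal (1 / (plus_coord p)\<^sup>2) * shell_integral \<epsilon> (minkowski_sq p) f"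
proof -
  define x s l where "x = plus_coord p" "s = minkowski_sq p" "l = ln \<bar>plus_coord p\<bar>"
  have x0: "x \<noteq> 0" and x: "x = \<epsilon> * exp l"
    using plus_coord_exp by (simp_all add: x_s_l_def)
  have "boost t (null_rotation2 v2 (null_rotation1 v1 p))
      = light_cone s (\<epsilon> * exp (l + t)) (p $ 1 + v1 * x) (p $ 2 + v2 * x)" for t v1 v2
    using x0 unfolding exp_add mult.assoc[symmetric] x[symmetric]
    by (intro light_cone_eqI) (simp_all add: x_s_l_def)
  then have "(\<integral>\<^sup>+v1. \<integral>\<^sup>+v2. \<integral>\<^sup>+t. f (boost t (null_rotation2 v2 (null_rotation1 v1 p))) \<partial>lborel \<partial>lborel \<partial>lborel)
    = (\<integral>\<^sup>+v1. \<integral>\<^sup>+v2. \<integral>\<^sup>+t. f (light_cone s (\<epsilon> * exp (l + t)) (p $ 1 + v1 * x) (p $ 2 + v2 * x)) \<partial>lborel \<partial>lborel \<partial>lborel)"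
    by simp
  also have "\<dots> = (\<integral>\<^sup>+v1. \<integral>\<^sup>+v2. \<integral>\<^sup>+t. f (light_cone s (\<epsilon> * exp t) (p $ 1 + v1 * x) (p $ 2 + v2 * x)) \<partial>lborel \<partial>lborel \<partial>lborel)"
    by (intro nn_integral_cong nn_integral_translate) measurable
  also have "\<dots> = (\<integral>\<^sup>+v1. ennreal (1 / \<bar>x\<bar>) * (\<integral>\<^sup>+y2. \<integral>\<^sup>+t. f (light_cone s (\<epsilon> * exp t) (p $ 1 + v1 * x) y2) \<partial>lborel \<partial>lborel) \<partial>lborel)"
    by (intro nn_integral_cong nn_integral_affine x0) measurable
  also have "\<dots> = ennreal (1 / \<bar>x\<bar>) * (\<integral>\<^sup>+v1. (\<integral>\<^sup>+y2. \<integral>\<^sup>+t. f (light_cone s (\<epsilon> * exp t) (p $ 1 + v1 * x) y2) \<partial>lborel \<partial>lborel) \<partial>lborel)"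
    by (intro nn_integral_cmult) measurable
  also have "(\<integral>\<^sup>+v1. (\<integral>\<^sup>+y2. \<integral>\<^sup>+t. f (light_cone s (\<epsilon> * exp t) (p $ 1 + v1 * x) y2) \<partial>lborel \<partial>lborel) \<partial>lborel)
    = ennreal (1 / \<bar>x\<bar>) * shell_integral \<epsilon> s f"
    unfolding shell_integral_def by (intro nn_integral_affine x0) measurable
  also have "ennreal (1 / \<bar>x\<bar>) * (ennreal (1 / \<bar>x\<bar>) * shell_integral \<epsilon> s f) = ennreal (1 / x\<^sup>2) * shell_integral \<epsilon> s f"
    by (simp add: mult.assoc[symmetric] ennreal_mult[symmetric] power2_eq_square)
  finally show ?thesis
    by (simp add: x_s_l_def)
qed

text \<open>With the boost acting first, the null rotations shift by multiples of the x of the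
  boosted point. Their Jacobian now varies with \<open>t\<close>, and the weight is exactly what
  cancels it.\<close>

lemma shell_integral_orbit':
  "(\<integral>\<^sup>+t. \<integral>\<^sup>+v2. \<integral>\<^sup>+v1. ennreal ((plus_coord (boost t p))\<^sup>2) * f (null_rotation1 v1 (null_rotation2 v2 (boost t p))) \<partial>lborel \<partial>lborel \<partial>lborel)
   = shell_integral \<epsilon> (minkowski_sq p) f"
proof -
  define x s l where "x = plus_coord p" "s = minkowski_sq p" "l = ln \<bar>plus_coord p\<bar>"
  have x0: "x \<noteq> 0" and x: "x = \<epsilon> * exp l"
    using plus_coord_exp by (simp_all add: x_s_l_def)
  have e0: "\<epsilon> * exp u \<noteq> 0" for u
    using \<epsilon> by auto
  have "null_rotation1 v1 (null_rotation2 v2 (boost t p))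
      = light_cone s (\<epsilon> * exp (l + t)) (p $ 1 + v1 * (\<epsilon> * exp (l + t))) (p $ 2 + v2 * (\<epsilon> * exp (l + t)))" for t v1 v2
    using x0 unfolding exp_add mult.assoc[symmetric] x[symmetric]
    by (intro light_cone_eqI) (simp_all add: x_s_l_def mult_ac)
  moreover have "plus_coord (boost t p) = \<epsilon> * exp (l + t)" for t
    unfolding exp_add mult.assoc[symmetric] x[symmetric] by (simp add: x_s_l_def)
  ultimately have "(\<integral>\<^sup>+t. \<integral>\<^sup>+v2. \<integral>\<^sup>+v1. ennreal ((plus_coord (boost t p))\<^sup>2) * f (null_rotation1 v1 (null_rotation2 v2 (boost t p))) \<partial>lborel \<partial>lborel \<partial>lborel)
    = (\<integral>\<^sup>+t. \<integral>\<^sup>+v2. \<integral>\<^sup>+v1. ennreal ((\<epsilon> * exp (l + t))\<^sup>2) * f (light_cone s (\<epsilon> * exp (l + t)) (p $ 1 + v1 * (\<epsilon> * exp (l + t))) (p $ 2 + v2 * (\<epsilon> * exp (l + t)))) \<partial>lborel \<partial>lborel \<partial>lborel)"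
    by simp
  also have "\<dots> = (\<integral>\<^sup>+t. \<integral>\<^sup>+v2. \<integral>\<^sup>+v1. ennreal ((\<epsilon> * exp t)\<^sup>2) * f (light_cone s (\<epsilon> * exp t) (p $ 1 + v1 * (\<epsilon> * exp t)) (p $ 2 + v2 * (\<epsilon> * exp t))) \<partial>lborel \<partial>lborel \<partial>lborel)"
    by (rule nn_integral_translate) measurable
  also have "\<dots> = (\<integral>\<^sup>+t. \<integral>\<^sup>+y2. \<integral>\<^sup>+y1. f (light_cone s (\<epsilon> * exp t) y1 y2) \<partial>lborel \<partial>lborel \<partial>lborel)"
  proof (rule nn_integral_cong)
    fix t
    let ?c = "\<epsilon> * exp t"
    have "(\<integral>\<^sup>+v2. \<integral>\<^sup>+v1. ennreal (?c\<^sup>2) * f (light_cone s ?c (p $ 1 + v1 * ?c) (p $ 2 + v2 * ?c)) \<partial>lborel \<partial>lborel)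
      = (\<integral>\<^sup>+v2. ennreal (?c\<^sup>2) * (\<integral>\<^sup>+v1. f (light_cone s ?c (p $ 1 + v1 * ?c) (p $ 2 + v2 * ?c)) \<partial>lborel) \<partial>lborel)"
      by (intro nn_integral_cong nn_integral_cmult) measurable
    also have "\<dots> = ennreal (?c\<^sup>2) * (\<integral>\<^sup>+v2. (\<integral>\<^sup>+v1. f (light_cone s ?c (p $ 1 + v1 * ?c) (p $ 2 + v2 * ?c)) \<partial>lborel) \<partial>lborel)"
      by (rule nn_integral_cmult) measurable
    also have "(\<integral>\<^sup>+v2. (\<integral>\<^sup>+v1. f (light_cone s ?c (p $ 1 + v1 * ?c) (p $ 2 + v2 * ?c)) \<partial>lborel) \<partial>lborel)
      = ennreal (1 / \<bar>?c\<bar>) * (\<integral>\<^sup>+y2. (\<integral>\<^sup>+v1. f (light_cone s ?c (p $ 1 + v1 * ?c) y2) \<partial>lborel) \<partial>lborel)"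
      by (rule nn_integral_affine[OF _ e0]) measurable
    also have "(\<integral>\<^sup>+y2. (\<integral>\<^sup>+v1. f (light_cone s ?c (p $ 1 + v1 * ?c) y2) \<partial>lborel) \<partial>lborel)
      = (\<integral>\<^sup>+y2. ennreal (1 / \<bar>?c\<bar>) * (\<integral>\<^sup>+y1. f (light_cone s ?c y1 y2) \<partial>lborel) \<partial>lborel)"
      by (intro nn_integral_cong nn_integral_affine e0) measurable
    also have "\<dots> = ennreal (1 / \<bar>?c\<bar>) * (\<integral>\<^sup>+y2. (\<integral>\<^sup>+y1. f (light_cone s ?c y1 y2) \<partial>lborel) \<partial>lborel)"
      by (rule nn_integral_cmult) measurable
    also have "ennreal (?c\<^sup>2) * (ennreal (1 / \<bar>?c\<bar>) * \<dots>) = (\<integral>\<^sup>+y2. (\<integral>\<^sup>+y1. f (light_cone s ?c y1 y2) \<partial>lborel) \<partial>lborel)"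
    proof -
      have "?c\<^sup>2 * (1 / \<bar>?c\<bar>) * (1 / \<bar>?c\<bar>) = 1"
        using e0[of t] by (simp add: power2_eq_square field_simps abs_mult_self_eq flip: abs_mult)
      then show ?thesis
        by (simp add: mult.assoc[symmetric] ennreal_mult[symmetric])
    qed
    finally show "(\<integral>\<^sup>+v2. \<integral>\<^sup>+v1. ennreal (?c\<^sup>2) * f (light_cone s ?c (p $ 1 + v1 * ?c) (p $ 2 + v2 * ?c)) \<partial>lborel \<partial>lborel)
      = (\<integral>\<^sup>+y2. (\<integral>\<^sup>+y1. f (light_cone s ?c y1 y2) \<partial>lborel) \<partial>lborel)" .
  qed
  also have "\<dots> = shell_integral \<epsilon> s f"
    by (rule shell_integral_swap[symmetric]) measurable
  finally show ?thesis
    by (simp add: x_s_l_def)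
qed

end

section \<open>Symmetry of shell integrals under an invariant measure\<close>

context lorentz_invariant_measure
begin

text \<open>The three flows are moved from \<open>h\<close> to \<open>f\<close> one at a time,
  outermost last, which reverses their order: \<open>h\<close> starts with the composition of
  \<open>shell_integral_orbit\<close> and \<open>f\<close> ends with that of
  \<open>shell_integral_orbit'\<close>.\<close>

theorem shell_integral_symmetric:
  assumes \<epsilon>: "\<epsilon> = 1 \<or> \<epsilon> = -1"
    and [measurable]: "f \<in> borel_measurable borel" "h \<in> borel_measurable borel"
  shows "(\<integral>\<^sup>+p. indicator {p. \<epsilon> * plus_coord p > 0} p * f p * shell_integral \<epsilon> (minkowski_sq p) h \<partial>M)
    = (\<integral>\<^sup>+p. indicator {p. \<epsilon> * plus_coord p > 0} p * h p * shell_integral \<epsilon> (minkowski_sq p) f \<partial>M)"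
proof -
  \<comment> \<open>The square of x cancels the factor 1/x^2 of the first orbit formula; after the
    transfer it is evaluated at the boosted point, where the second one demands it.\<close>
  define F where "F p = indicator {p. \<epsilon> * plus_coord p > 0} p * (ennreal ((plus_coord p)\<^sup>2) * f p)" for p
  define H2 where "H2 p = (\<integral>\<^sup>+t. h (boost t p) \<partial>lborel)" for p
  define H1 where "H1 p = (\<integral>\<^sup>+v. H2 (null_rotation2 v p) \<partial>lborel)" for p
  define F1 where "F1 p = (\<integral>\<^sup>+v. F (null_rotation1 v p) \<partial>lborel)" for p
  define F2 where "F2 p = (\<integral>\<^sup>+v. F1 (null_rotation2 v p) \<partial>lborel)" for p
  have [measurable]: "F \<in> borel_measurable borel"
    unfolding F_def[abs_def] by measurable
  have [measurable]: "H2 \<in> borel_measurable borel"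
    unfolding H2_def[abs_def] by measurable
  have [measurable]: "H1 \<in> borel_measurable borel"
    unfolding H1_def[abs_def] by measurable
  have [measurable]: "F1 \<in> borel_measurable borel"
    unfolding F1_def[abs_def] by measurable
  have [measurable]: "F2 \<in> borel_measurable borel"
    unfolding F2_def[abs_def] by measurable
  have "indicator {p. \<epsilon> * plus_coord p > 0} p * f p * shell_integral \<epsilon> (minkowski_sq p) h
      = F p * (\<integral>\<^sup>+v. H1 (null_rotation1 v p) \<partial>lborel)" for p
  proof (cases "\<epsilon> * plus_coord p > 0")
    case True
    then have "(plus_coord p)\<^sup>2 * (1 / (plus_coord p)\<^sup>2) = 1"
      by auto
    then have "ennreal ((plus_coord p)\<^sup>2) * ennreal (1 / (plus_coord p)\<^sup>2) = 1"
      by (simp add: ennreal_mult[symmetric])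
    then have "ennreal ((plus_coord p)\<^sup>2) * f p * (ennreal (1 / (plus_coord p)\<^sup>2) * shell_integral \<epsilon> (minkowski_sq p) h)
      = f p * shell_integral \<epsilon> (minkowski_sq p) h"
      by (metis (no_types, opaque_lifting) mult.commute mult.left_commute mult_1)
    then show ?thesis
      using True shell_integral_orbit[OF \<epsilon> True, of h] by (simp add: F_def H1_def H2_def)
  qed (simp add: F_def)
  then have "(\<integral>\<^sup>+p. indicator {p. \<epsilon> * plus_coord p > 0} p * f p * shell_integral \<epsilon> (minkowski_sq p) h \<partial>M)
      = (\<integral>\<^sup>+p. F p * (\<integral>\<^sup>+v. H1 (null_rotation1 v p) \<partial>lborel) \<partial>M)"
    by simp
  also have "\<dots> = (\<integral>\<^sup>+p. H1 p * F1 p \<partial>M)"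
    unfolding F1_def
    by (intro nn_integral_flow_symmetric flow_measurable lorentz_map_null_rotation1 null_rotation1_inverse) measurable
  also have "\<dots> = (\<integral>\<^sup>+p. F1 p * (\<integral>\<^sup>+v. H2 (null_rotation2 v p) \<partial>lborel) \<partial>M)"
    by (simp add: H1_def mult.commute)
  also have "\<dots> = (\<integral>\<^sup>+p. H2 p * F2 p \<partial>M)"
    unfolding F2_def
    by (intro nn_integral_flow_symmetric flow_measurable lorentz_map_null_rotation2 null_rotation2_inverse) measurable
  also have "\<dots> = (\<integral>\<^sup>+p. F2 p * (\<integral>\<^sup>+t. h (boost t p) \<partial>lborel) \<partial>M)"
    by (simp add: H2_def mult.commute)
  also have "\<dots> = (\<integral>\<^sup>+p. h p * (\<integral>\<^sup>+t. F2 (boost t p) \<partial>lborel) \<partial>M)"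
    by (intro nn_integral_flow_symmetric flow_measurable lorentz_map_boost boost_inverse) measurable
  also have "\<dots> = (\<integral>\<^sup>+p. indicator {p. \<epsilon> * plus_coord p > 0} p * h p * shell_integral \<epsilon> (minkowski_sq p) f \<partial>M)"
  proof (rule nn_integral_cong)
    fix p
    \<comment> \<open>Boosts keep the sign of x, so the half-space indicator hidden in
      \<open>F\<close> is constant along the orbit and comes out again.\<close>
    have "\<epsilon> * (exp t * plus_coord p) > 0 \<longleftrightarrow> \<epsilon> * plus_coord p > 0" for t
      by (simp add: zero_less_mult_iff mult_less_0_iff)
    then show "h p * (\<integral>\<^sup>+t. F2 (boost t p) \<partial>lborel)
        = indicator {p. \<epsilon> * plus_coord p > 0} p * h p * shell_integral \<epsilon> (minkowski_sq p) f"
      using shell_integral_orbit'[OF \<epsilon>, of p f]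
      by (cases "\<epsilon> * plus_coord p > 0") (simp_all add: F2_def F1_def F_def)
  qed
  finally show ?thesis .
qed

end

section \<open>The shell measures in light-cone coordinates\<close>

text \<open>The change of variables theorem gives joint absolute integrability and equal integrals.
  For nonnegative functions, failure of integrability means the value \<infinity> on both sides, so
  the equality holds in every case.\<close>

lemma nn_integral_substitution_inj:
  fixes g g' F :: "real \<Rightarrow> real"
  assumes [measurable]: "T \<in> sets borel" "g ` T \<in> sets borel" "g \<in> borel_measurable borel"
      "g' \<in> borel_measurable borel" "F \<in> borel_measurable borel"
    and deriv: "\<And>t. t \<in> T \<Longrightarrow> (g has_real_derivative g' t) (at t within T)"
    and inj: "inj_on g T" and F: "\<And>q. 0 \<le> F q"
  shows "(\<integral>\<^sup>+q. ennreal (F q) * indicator (g ` T) q \<partial>lborel)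
    = (\<integral>\<^sup>+t. ennreal (\<bar>g' t\<bar> * F (g t)) * indicator T t \<partial>lborel)"
proof -
  let ?a = "\<lambda>t. \<bar>g' t\<bar> * F (g t)"
  have T: "T \<in> sets lebesgue"
    using assms(1) by auto
  have finite_iff: "f absolutely_integrable_on A \<longleftrightarrow> (\<integral>\<^sup>+x. ennreal (f x) * indicator A x \<partial>lborel) < \<infinity>"
    and eq: "f absolutely_integrable_on A \<Longrightarrow>
      (\<integral>\<^sup>+x. ennreal (f x) * indicator A x \<partial>lborel) = ennreal (integral A f)"
    if [measurable]: "A \<in> sets borel" "f \<in> borel_measurable borel" and f: "\<And>x. 0 \<le> f x" for A and f :: "real \<Rightarrow> real"
  proof -
    have n: "(\<integral>\<^sup>+x. ennreal (f x) * indicator A x \<partial>lborel) = (\<integral>\<^sup>+x. ennreal (indicator A x *\<^sub>R f x) \<partial>lebesgue)"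
      unfolding nn_integral_completion by (intro nn_integral_cong) (auto simp: indicator_def)
    have m: "(\<lambda>x. indicator A x *\<^sub>R f x) \<in> borel_measurable lebesgue"
      by (rule measurable_completion) measurable
    show "f absolutely_integrable_on A \<longleftrightarrow> (\<integral>\<^sup>+x. ennreal (f x) * indicator A x \<partial>lborel) < \<infinity>"
      unfolding n set_integrable_def integrable_iff_bounded using m f by (auto simp: abs_mult)
    assume i: "f absolutely_integrable_on A"
    have "(\<integral>\<^sup>+x. ennreal (indicator A x *\<^sub>R f x) \<partial>lebesgue) = ennreal (integral\<^sup>L lebesgue (\<lambda>x. indicator A x *\<^sub>R f x))"
      using i f unfolding set_integrable_def by (intro nn_integral_eq_integral) auto
    then show "(\<integral>\<^sup>+x. ennreal (f x) * indicator A x \<partial>lborel) = ennreal (integral A f)"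
      unfolding n using set_lebesgue_integral_eq_integral(2)[OF i] by (simp add: set_lebesgue_integral_def)
  qed
  note change = has_absolute_integral_change_of_variables_1'[OF T deriv inj, of F]
  show ?thesis
  proof (cases "F absolutely_integrable_on (g ` T)")
    case True
    then have "?a absolutely_integrable_on T" "integral T ?a = integral (g ` T) F"
      using change by blast+
    then show ?thesis
      using True F by (simp add: eq)
  next
    case False
    then have "\<not> ?a absolutely_integrable_on T"
      using change by blast
    then show ?thesis
      using False F by (simp add: finite_iff not_less top_unique)
  qed
qed

text \<open>On the hyperbola \<open>a\<^sup>2 - q\<^sup>2 = k\<close>, parametrised by \<open>a + q = \<epsilon> e\<^sup>t\<close>, one has \<open>dq / \<bar>a\<bar> = dt\<close>. The sign
  \<open>\<delta>\<close> selects the branch of \<open>a\<close>; for \<open>k < 0\<close> the branches for both \<open>\<delta>\<close> meet both half lines.\<close>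

lemma nn_integral_hyperbola:
  fixes f :: "real \<Rightarrow> real \<Rightarrow> real"
  assumes k: "k \<noteq> 0" and \<epsilon>: "\<epsilon> = 1 \<or> \<epsilon> = -1" and \<delta>: "\<delta> = 1 \<or> \<delta> = -1"
    and [measurable]: "case_prod f \<in> borel_measurable (borel \<Otimes>\<^sub>M borel)" and f: "\<And>a b. 0 \<le> f a b"
  shows "(\<integral>\<^sup>+q. ennreal (f (\<delta> * sqrt (q\<^sup>2 + k)) q / sqrt (q\<^sup>2 + k))
        * indicator {q. 0 < q\<^sup>2 + k \<and> 0 < \<epsilon> * (q + \<delta> * sqrt (q\<^sup>2 + k))} q \<partial>lborel)
    = (\<integral>\<^sup>+t. ennreal (f (\<epsilon> * (exp t + k * exp (- t)) / 2) (\<epsilon> * (exp t - k * exp (- t)) / 2))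
        * indicator {t. 0 < \<delta> * \<epsilon> * (exp t + k * exp (- t))} t \<partial>lborel)"
proof -
  define g where "g t = \<epsilon> * (exp t - k * exp (- t)) / 2" for t
  \<comment> \<open>\<open>g\<close> is the coordinate q, while \<open>g'\<close> is at once its
    derivative and the coordinate a; so the Jacobian cancels the denominator.\<close>
  define g' where "g' t = \<epsilon> * (exp t + k * exp (- t)) / 2" for t
  define T where "T = {t. 0 < \<delta> * \<epsilon> * (exp t + k * exp (- t))}"
  \<comment> \<open>The square root of a negative number is negative, so the cutoff is what makes
    \<open>F\<close> nonnegative everywhere.\<close>
  define F where "F q = (if 0 < q\<^sup>2 + k then f (\<delta> * sqrt (q\<^sup>2 + k)) q / sqrt (q\<^sup>2 + k) else 0)" for q
  have sq: "\<epsilon> * \<epsilon> = 1" "\<delta> * \<delta> = 1"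
    using \<epsilon> \<delta> by auto
  have ee: "exp t * exp (- t) = 1" for t :: real
    by (simp add: exp_minus)
  have hyp: "(g' t)\<^sup>2 = (g t)\<^sup>2 + k" for t
    using sq(1) ee[of t] unfolding g_def g'_def by (simp add: power2_eq_square field_simps)
  have sum: "g t + g' t = \<epsilon> * exp t" for t
    by (simp add: g_def g'_def field_simps)
  have T_iff: "t \<in> T \<longleftrightarrow> 0 < \<delta> * g' t" for t
  proof -
    have "\<delta> * g' t = \<delta> * \<epsilon> * (exp t + k * exp (- t)) / 2"
      by (simp add: g'_def)
    then show ?thesis
      unfolding T_def mem_Collect_eq by linarith
  qed
  have root: "\<delta> * sqrt ((g t)\<^sup>2 + k) = g' t" "sqrt ((g t)\<^sup>2 + k) = \<bar>g' t\<bar>" "g' t \<noteq> 0" if "t \<in> T" for t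
    using that \<delta> unfolding T_iff hyp[symmetric] by auto
  have image: "g ` T = {q. 0 < q\<^sup>2 + k \<and> 0 < \<epsilon> * (q + \<delta> * sqrt (q\<^sup>2 + k))}"
  proof (intro set_eqI iffI)
    fix q assume "q \<in> g ` T"
    then obtain t where t: "t \<in> T" "q = g t"
      by auto
    have "\<epsilon> * (\<epsilon> * exp t) > 0"
      using sq by (simp add: mult.assoc[symmetric])
    then show "q \<in> {q. 0 < q\<^sup>2 + k \<and> 0 < \<epsilon> * (q + \<delta> * sqrt (q\<^sup>2 + k))}"
      using t root[OF t(1)] hyp[of t, symmetric] sum[of t] by simp
  next
    fix q assume "q \<in> {q. 0 < q\<^sup>2 + k \<and> 0 < \<epsilon> * (q + \<delta> * sqrt (q\<^sup>2 + k))}"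
    then have q: "0 < q\<^sup>2 + k" "0 < \<epsilon> * (q + \<delta> * sqrt (q\<^sup>2 + k))"
      by auto
    define r t where "r = \<delta> * sqrt (q\<^sup>2 + k)" and "t = ln (\<epsilon> * (q + r))"
    have r2: "r\<^sup>2 = q\<^sup>2 + k" and r\<delta>: "0 < \<delta> * r"
      using q sq by (simp_all add: r_def power_mult_distrib mult.assoc[symmetric]) (simp add: power2_eq_square)
    have et: "exp t = \<epsilon> * (q + r)"
      using q by (simp add: t_def r_def)
    \<comment> \<open>From k = (r - q) (r + q), which turns the choice of \<open>exp t\<close> into
      a value for \<open>k * exp (- t)\<close>.\<close>
    have "k = (\<epsilon> * (r - q)) * exp t"
      using r2 sq(1) et by (simp add: power2_eq_square algebra_simps)
    then have ket: "k * exp (- t) = \<epsilon> * (r - q)"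
      by (simp add: exp_minus)
    have "g t = q" "g' t = r"
      unfolding g_def g'_def ket et using sq(1) by (simp_all add: algebra_simps)
    then show "q \<in> g ` T"
      using r\<delta> T_iff by force
  qed
  have inj: "inj_on g T"
  proof (rule inj_onI)
    fix t u assume "t \<in> T" "u \<in> T" "g t = g u"
    then have "g' t = g' u"
      using root(1) by metis
    then have "\<epsilon> * exp t = \<epsilon> * exp u"
      using sum \<open>g t = g u\<close> by metis
    then show "t = u"
      using \<epsilon> by auto
  qed
  have [measurable]: "T \<in> sets borel" "g ` T \<in> sets borel" "g \<in> borel_measurable borel"
    "g' \<in> borel_measurable borel" "F \<in> borel_measurable borel"
    unfolding image unfolding T_def F_def g_def g'_def by measurable
  have "(\<integral>\<^sup>+q. ennreal (F q) * indicator (g ` T) q \<partial>lborel)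
    = (\<integral>\<^sup>+t. ennreal (\<bar>g' t\<bar> * F (g t)) * indicator T t \<partial>lborel)"
  proof (rule nn_integral_substitution_inj)
    show "(g has_real_derivative g' t) (at t within T)" for t
      unfolding g_def[abs_def] g'_def by (auto intro!: derivative_eq_intros simp: field_simps)
    show "0 \<le> F q" for q
      using f by (simp add: F_def)
  qed (use inj in measurable)
  also have "\<dots> = (\<integral>\<^sup>+t. ennreal (f (g' t) (g t)) * indicator T t \<partial>lborel)"
  proof (intro nn_integral_cong)
    fix t
    show "ennreal (\<bar>g' t\<bar> * F (g t)) * indicator T t = ennreal (f (g' t) (g t)) * indicator T t"
    proof (cases "t \<in> T")
      case True
      have "F (g t) = f (\<delta> * sqrt ((g t)\<^sup>2 + k)) (g t) / sqrt ((g t)\<^sup>2 + k)"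
        using root(3)[OF True] by (simp add: F_def hyp[symmetric])
      moreover have "\<delta> * \<bar>g' t\<bar> = g' t"
        using root(1,2)[OF True] by simp
      ultimately have "F (g t) = f (g' t) (g t) / \<bar>g' t\<bar>"
        unfolding root(2)[OF True] by simp
      then show ?thesis
        using root(3)[OF True] by simp
    qed simp
  qed
  also have "(\<integral>\<^sup>+q. ennreal (F q) * indicator (g ` T) q \<partial>lborel)
      = (\<integral>\<^sup>+q. ennreal (f (\<delta> * sqrt (q\<^sup>2 + k)) q / sqrt (q\<^sup>2 + k)) * indicator (g ` T) q \<partial>lborel)"
    unfolding image by (intro nn_integral_cong) (auto simp: F_def indicator_def)
  finally show ?thesis
    unfolding image by (simp add: g_def g'_def T_def)
qed

text \<open>Lebesgue measure is characterised by its values on boxes, so the image of the product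
  measure under \<open>vector\<close> is \<open>lborel\<close>.\<close>

lemma nn_integral_lborel_vec3:
  fixes f :: "real^3 \<Rightarrow> ennreal"
  assumes [measurable]: "f \<in> borel_measurable borel"
  shows "(\<integral>\<^sup>+q. f q \<partial>lborel) = (\<integral>\<^sup>+y1. \<integral>\<^sup>+y2. \<integral>\<^sup>+y3. f (vector [y1, y2, y3]) \<partial>lborel \<partial>lborel \<partial>lborel)"
proof -
  have vec: "(vector [a, b, c] :: real^3) = a *\<^sub>R axis 1 1 + b *\<^sub>R axis 2 1 + c *\<^sub>R axis 3 1" for a b c
    by (simp add: vec_eq_iff forall_3 axis_def)
  have [measurable]: "(\<lambda>x. vector [a x, b x, c x] :: real^3) \<in> borel_measurable N"
    if [measurable]: "a \<in> borel_measurable N" "b \<in> borel_measurable N" "c \<in> borel_measurable N"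
    for N :: "'x measure" and a b c
    unfolding vec by measurable
  let ?L = "lborel \<Otimes>\<^sub>M (lborel \<Otimes>\<^sub>M lborel) :: (real \<times> real \<times> real) measure"
  let ?v = "\<lambda>(a, b, c). vector [a, b, c] :: real^3"
  have N: "sigma_finite_measure (lborel \<Otimes>\<^sub>M lborel :: (real \<times> real) measure)"
    unfolding lborel_prod by (rule lborel.sigma_finite_measure_axioms)
  have "lborel = distr ?L borel ?v"
  proof (rule lborel_eqI)
    fix l u :: "real^3" assume le: "\<And>b. b \<in> Basis \<Longrightarrow> l \<bullet> b \<le> u \<bullet> b"
    have le': "l $ i \<le> u $ i" for i
      using le[of "axis i 1"] by (simp add: inner_axis)
    have "?v -` box l u \<inter> space ?L = {l $ 1 <..< u $ 1} \<times> {l $ 2 <..< u $ 2} \<times> {l $ 3 <..< u $ 3}"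
      by (auto simp: mem_box_cart forall_3 space_pair_measure)
    then have "emeasure (distr ?L borel ?v) (box l u) = ennreal (u $ 1 - l $ 1) * (ennreal (u $ 2 - l $ 2) * ennreal (u $ 3 - l $ 3))"
      using le' by (simp add: emeasure_distr lborel.emeasure_pair_measure_Times sigma_finite_measure.emeasure_pair_measure_Times[OF N])
    also have "\<dots> = ennreal ((u $ 1 - l $ 1) * ((u $ 2 - l $ 2) * (u $ 3 - l $ 3)))"
      using le'[of 1] le'[of 2] le'[of 3] by (simp add: ennreal_mult)
    also have "(u $ 1 - l $ 1) * ((u $ 2 - l $ 2) * (u $ 3 - l $ 3)) = (\<Prod>i\<in>UNIV. (u - l) $ i)"
      unfolding UNIV_3 by simp
    also have "(\<Prod>i\<in>UNIV. (u - l) $ i) = (\<Prod>b\<in>Basis. (u - l) \<bullet> b)"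
      by (simp add: Basis_vec_def prod.UNION_disjoint axis_eq_axis inner_axis)
    finally show "emeasure (distr ?L borel ?v) (box l u) = ennreal (\<Prod>b\<in>Basis. (u - l) \<bullet> b)" .
  qed simp
  then have "(\<integral>\<^sup>+q. f q \<partial>lborel) = (\<integral>\<^sup>+q. f q \<partial>distr ?L borel ?v)"
    by simp
  also have "\<dots> = (\<integral>\<^sup>+z. f (?v z) \<partial>?L)"
    by (rule nn_integral_distr) measurable
  also have "\<dots> = (\<integral>\<^sup>+y1. \<integral>\<^sup>+z. f (?v (y1, z)) \<partial>(lborel \<Otimes>\<^sub>M lborel) \<partial>lborel)"
    by (rule sigma_finite_measure.nn_integral_fst[OF N, symmetric]) measurable
  also have "\<dots> = (\<integral>\<^sup>+y1. \<integral>\<^sup>+y2. \<integral>\<^sup>+y3. f (?v (y1, y2, y3)) \<partial>lborel \<partial>lborel \<partial>lborel)"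
    by (intro nn_integral_cong lborel.nn_integral_fst[symmetric]) measurable
  finally show ?thesis by simp
qed

text \<open>Covers \<open>\<Omega>\<^sub>m\<close> (\<open>s = m\<^sup>2\<close>) and \<open>\<Omega>\<^bsub>im\<^esub>\<close> (\<open>s = - m\<^sup>2\<close>) at once. The indicator also discards the \<open>q\<close> for which
  the square root takes its junk value for negative arguments.\<close>

definition shell_measure :: "real \<Rightarrow> real \<Rightarrow> (real^4) set \<Rightarrow> ennreal" where
  "shell_measure \<delta> s A =
     (\<integral>\<^sup>+q. ennreal (indicator A (pt (\<delta> * sqrt ((norm q)\<^sup>2 + s)) (q $ 1) (q $ 2) (q $ 3)) / sqrt ((norm q)\<^sup>2 + s))
        * indicator {q::real^3. 0 < (norm q)\<^sup>2 + s} q \<partial>lborel)"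

lemma shell_measure_measurable [measurable (raw)]:
  assumes [measurable]: "s \<in> borel_measurable M" "A \<in> sets borel"
  shows "(\<lambda>x. shell_measure \<delta> (s x) A) \<in> borel_measurable M"
  unfolding shell_measure_def by measurable

lemma norm_vec3_sq: "(norm (q::real^3))\<^sup>2 = (q $ 1)\<^sup>2 + (q $ 2)\<^sup>2 + (q $ 3)\<^sup>2"
  unfolding power2_norm_eq_inner inner_vec_def sum_3 by (simp add: power2_eq_square)

text \<open>The line of third momenta is split by the sign of x = q + \<delta> sqrt(q^2 + k). The
  value x = 0 would force k = 0; on each part the hyperbola substitution applies.\<close>

lemma shell_measure_fibre:
  fixes y1 y2 s :: real
  defines "k \<equiv> s + y1\<^sup>2 + y2\<^sup>2"
  assumes [measurable]: "A \<in> sets borel" and k: "k \<noteq> 0" and \<delta>: "\<delta> = 1 \<or> \<delta> = -1"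
  shows "(\<integral>\<^sup>+q. ennreal (indicator A (pt (\<delta> * sqrt (q\<^sup>2 + k)) y1 y2 q) / sqrt (q\<^sup>2 + k))
      * indicator {q. 0 < q\<^sup>2 + k} q \<partial>lborel)
    = (\<integral>\<^sup>+t. indicator A (light_cone s (exp t) y1 y2) * indicator {t. 0 < \<delta> * (exp t + k * exp (- t))} t \<partial>lborel)
    + (\<integral>\<^sup>+t. indicator A (light_cone s (- exp t) y1 y2) * indicator {t. 0 < - \<delta> * (exp t + k * exp (- t))} t \<partial>lborel)"
proof -
  let ?h = "\<lambda>q. ennreal (indicator A (pt (\<delta> * sqrt (q\<^sup>2 + k)) y1 y2 q) / sqrt (q\<^sup>2 + k))"
  let ?S = "\<lambda>\<epsilon>. {q. 0 < q\<^sup>2 + k \<and> 0 < \<epsilon> * (q + \<delta> * sqrt (q\<^sup>2 + k))}"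
  have nz: "q + \<delta> * sqrt (q\<^sup>2 + k) \<noteq> 0" if "0 < q\<^sup>2 + k" for q
  proof
    assume "q + \<delta> * sqrt (q\<^sup>2 + k) = 0"
    then have "q\<^sup>2 = (\<delta> * sqrt (q\<^sup>2 + k))\<^sup>2"
      by algebra
    also have "\<dots> = q\<^sup>2 + k"
      using \<delta> that by (auto simp: power_mult_distrib)
    finally show False
      using k by simp
  qed
  have "?h q * indicator {q. 0 < q\<^sup>2 + k} q = ?h q * indicator (?S 1) q + ?h q * indicator (?S (- 1)) q" for q
    using nz[of q] by (auto simp: indicator_def)
  then have "(\<integral>\<^sup>+q. ?h q * indicator {q. 0 < q\<^sup>2 + k} q \<partial>lborel)
    = (\<integral>\<^sup>+q. ?h q * indicator (?S 1) q \<partial>lborel) + (\<integral>\<^sup>+q. ?h q * indicator (?S (- 1)) q \<partial>lborel)"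
    by (simp add: nn_integral_add)
  moreover have "pt (\<epsilon> * (exp t + k * exp (- t)) / 2) y1 y2 (\<epsilon> * (exp t - k * exp (- t)) / 2) = light_cone s (\<epsilon> * exp t) y1 y2"
    if "\<epsilon> = 1 \<or> \<epsilon> = -1" for \<epsilon> t
    using that by (auto simp: light_cone_def k_def exp_minus field_simps vec4_eq_iff)
  then have "(\<integral>\<^sup>+q. ?h q * indicator (?S \<epsilon>) q \<partial>lborel) = (\<integral>\<^sup>+t. indicator A (light_cone s (\<epsilon> * exp t) y1 y2)
        * indicator {t. 0 < \<delta> * \<epsilon> * (exp t + k * exp (- t))} t \<partial>lborel)" if "\<epsilon> = 1 \<or> \<epsilon> = -1" for \<epsilon>
    using nn_integral_hyperbola[OF k that \<delta>, of "\<lambda>a q. indicator A (pt a y1 y2 q)"] that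
    by (simp add: ennreal_indicator)
  from this[of 1] this[of "- 1"] show ?thesis
    using calculation by simp
qed

text \<open>Discards the degenerate fibres: for k = 0 the hyperbola collapses into two crossing
  lines.\<close>

lemma AE_sum_squares_nonzero: "AE y2 in lborel. s + y1\<^sup>2 + y2\<^sup>2 \<noteq> (0::real)"
proof -
  have "finite {y2::real. s + y1\<^sup>2 + y2\<^sup>2 = 0}"
  proof (rule finite_subset)
    show "{y2. s + y1\<^sup>2 + y2\<^sup>2 = 0} \<subseteq> {sqrt (- s - y1\<^sup>2), - sqrt (- s - y1\<^sup>2)}"
    proof
      fix y2 assume "y2 \<in> {y2. s + y1\<^sup>2 + y2\<^sup>2 = 0}"
      then have "- s - y1\<^sup>2 = y2\<^sup>2"
        by simp
      then show "y2 \<in> {sqrt (- s - y1\<^sup>2), - sqrt (- s - y1\<^sup>2)}"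
        by (simp add: abs_if)
    qed
  qed simp
  from AE_not_in[OF finite_imp_null_set_lborel[OF this]] show ?thesis
    by simp
qed

lemma shell_measure_iterated:
  assumes [measurable]: "A \<in> sets borel"
  shows "shell_measure \<delta> s A = (\<integral>\<^sup>+y1. \<integral>\<^sup>+y2. \<integral>\<^sup>+q.
      ennreal (indicator A (pt (\<delta> * sqrt (q\<^sup>2 + (s + y1\<^sup>2 + y2\<^sup>2))) y1 y2 q) / sqrt (q\<^sup>2 + (s + y1\<^sup>2 + y2\<^sup>2)))
      * indicator {q. 0 < q\<^sup>2 + (s + y1\<^sup>2 + y2\<^sup>2)} q \<partial>lborel \<partial>lborel \<partial>lborel)"
proof -
  have eq: "y1\<^sup>2 + y2\<^sup>2 + q\<^sup>2 + s = q\<^sup>2 + (s + y1\<^sup>2 + y2\<^sup>2)" for y1 y2 q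
    by simp
  show ?thesis
    unfolding shell_measure_def
    by (subst nn_integral_lborel_vec3) (simp_all add: norm_vec3_sq eq indicator_def)
qed

text \<open>Almost every fibre has k > 0, and then p0 = (x + k/x)/2 has the sign of x, so energy
  branch and half shell coincide.\<close>

lemma shell_measure_nonneg:
  assumes [measurable]: "A \<in> sets borel" and "0 \<le> s" and \<delta>: "\<delta> = 1 \<or> \<delta> = -1"
  shows "shell_measure \<delta> s A = shell_integral \<delta> s (indicator A)"
  unfolding shell_measure_iterated[OF assms(1)] shell_integral_def
proof (rule nn_integral_cong, rule nn_integral_cong_AE)
  fix y1
  show "AE y2 in lborel. (\<integral>\<^sup>+q.
      ennreal (indicator A (pt (\<delta> * sqrt (q\<^sup>2 + (s + y1\<^sup>2 + y2\<^sup>2))) y1 y2 q) / sqrt (q\<^sup>2 + (s + y1\<^sup>2 + y2\<^sup>2)))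
      * indicator {q. 0 < q\<^sup>2 + (s + y1\<^sup>2 + y2\<^sup>2)} q \<partial>lborel)
    = (\<integral>\<^sup>+t. indicator A (light_cone s (\<delta> * exp t) y1 y2) \<partial>lborel)"
    using AE_sum_squares_nonzero[of s y1]
  proof eventually_elim
    case (elim y2)
    have "0 < s + y1\<^sup>2 + y2\<^sup>2"
      using elim \<open>0 \<le> s\<close> by (simp add: order_less_le)
    define w where "w t = exp t + (s + y1\<^sup>2 + y2\<^sup>2) * exp (- t)" for t
    have "0 < w t" for t
      using \<open>0 < s + y1\<^sup>2 + y2\<^sup>2\<close> by (simp add: w_def add_pos_pos)
    then show ?case
      unfolding shell_measure_fibre[OF assms(1) elim \<delta>] w_def[symmetric] using \<delta>
      by (auto simp: not_less less_imp_le)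
  qed
qed

text \<open>On a fibre with k < 0 the energy changes sign along each half, so each energy branch
  meets both halves. The four pieces are regrouped by the sign of x.\<close>

lemma shell_measure_both:
  assumes [measurable]: "A \<in> sets borel"
  shows "shell_measure 1 s A + shell_measure (- 1) s A
    = shell_integral 1 s (indicator A) + shell_integral (- 1) s (indicator A)"
proof -
  have "shell_measure 1 s A + shell_measure (- 1) s A = (\<integral>\<^sup>+y1. \<integral>\<^sup>+y2.
     (\<integral>\<^sup>+q. ennreal (indicator A (pt (1 * sqrt (q\<^sup>2 + (s + y1\<^sup>2 + y2\<^sup>2))) y1 y2 q) / sqrt (q\<^sup>2 + (s + y1\<^sup>2 + y2\<^sup>2)))
      * indicator {q. 0 < q\<^sup>2 + (s + y1\<^sup>2 + y2\<^sup>2)} q \<partial>lborel)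
   + (\<integral>\<^sup>+q. ennreal (indicator A (pt (- 1 * sqrt (q\<^sup>2 + (s + y1\<^sup>2 + y2\<^sup>2))) y1 y2 q) / sqrt (q\<^sup>2 + (s + y1\<^sup>2 + y2\<^sup>2)))
      * indicator {q. 0 < q\<^sup>2 + (s + y1\<^sup>2 + y2\<^sup>2)} q \<partial>lborel) \<partial>lborel \<partial>lborel)"
    unfolding shell_measure_iterated[OF assms]
    by (subst nn_integral_add[symmetric], measurable, intro nn_integral_cong, subst nn_integral_add[symmetric]) measurable
  also have "\<dots> = (\<integral>\<^sup>+y1. \<integral>\<^sup>+y2. (\<integral>\<^sup>+t. indicator A (light_cone s (1 * exp t) y1 y2) \<partial>lborel)
    + (\<integral>\<^sup>+t. indicator A (light_cone s (- 1 * exp t) y1 y2) \<partial>lborel) \<partial>lborel \<partial>lborel)"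
  proof (rule nn_integral_cong, rule nn_integral_cong_AE)
    fix y1
    show "AE y2 in lborel.
     (\<integral>\<^sup>+q. ennreal (indicator A (pt (1 * sqrt (q\<^sup>2 + (s + y1\<^sup>2 + y2\<^sup>2))) y1 y2 q) / sqrt (q\<^sup>2 + (s + y1\<^sup>2 + y2\<^sup>2)))
      * indicator {q. 0 < q\<^sup>2 + (s + y1\<^sup>2 + y2\<^sup>2)} q \<partial>lborel)
   + (\<integral>\<^sup>+q. ennreal (indicator A (pt (- 1 * sqrt (q\<^sup>2 + (s + y1\<^sup>2 + y2\<^sup>2))) y1 y2 q) / sqrt (q\<^sup>2 + (s + y1\<^sup>2 + y2\<^sup>2)))
      * indicator {q. 0 < q\<^sup>2 + (s + y1\<^sup>2 + y2\<^sup>2)} q \<partial>lborel)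
    = (\<integral>\<^sup>+t. indicator A (light_cone s (1 * exp t) y1 y2) \<partial>lborel)
    + (\<integral>\<^sup>+t. indicator A (light_cone s (- 1 * exp t) y1 y2) \<partial>lborel)"
      using AE_sum_squares_nonzero[of s y1]
    proof eventually_elim
      case (elim y2)
      let ?k = "s + y1\<^sup>2 + y2\<^sup>2"
      define w where "w t = exp t + ?k * exp (- t)" for t
      have [measurable]: "w \<in> borel_measurable borel"
        unfolding w_def[abs_def] by measurable
      let ?P = "{t. 0 < w t}" and ?N = "{t. w t < 0}"
      \<comment> \<open>A zero of \<open>w\<close> is a point of zero energy. There is at most one,
        so the strict sign conditions cover each half up to a null set.\<close>
      have "{t. w t = 0} \<subseteq> {ln (- ?k) / 2}"
      proof clarify
        fix t assume "w t = 0"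
        then have "exp t * exp t = - ?k"
          by (simp add: w_def exp_minus field_simps)
        then have "exp (2 * t) = - ?k"
          by (simp add: exp_double power2_eq_square)
        then show "t = ln (- ?k) / 2"
          by (metis ln_exp nonzero_mult_div_cancel_left zero_neq_numeral)
      qed
      then have "finite {t. w t = 0}"
        by (rule finite_subset) simp
      from AE_not_in[OF finite_imp_null_set_lborel[OF this]]
      have ae: "AE t in lborel. w t \<noteq> 0"
        by simp
      have split: "(\<integral>\<^sup>+t. f t * indicator ?P t \<partial>lborel) + (\<integral>\<^sup>+t. f t * indicator ?N t \<partial>lborel) = (\<integral>\<^sup>+t. f t \<partial>lborel)"
        if [measurable]: "f \<in> borel_measurable borel" for f :: "real \<Rightarrow> ennreal"
      proof -
        have "(\<integral>\<^sup>+t. f t * indicator ?P t \<partial>lborel) + (\<integral>\<^sup>+t. f t * indicator ?N t \<partial>lborel)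
            = (\<integral>\<^sup>+t. f t * indicator ?P t + f t * indicator ?N t \<partial>lborel)"
          by (rule nn_integral_add[symmetric]) measurable
        also have "\<dots> = (\<integral>\<^sup>+t. f t \<partial>lborel)"
          using ae by (intro nn_integral_cong_AE) (auto simp: indicator_def elim!: eventually_mono)
        finally show ?thesis .
      qed
      have comb: "(a + d) + (c + b) = (a + c) + (b + d)" for a b c d :: ennreal
        by (simp add: ac_simps)
      show ?case
        unfolding shell_measure_fibre[OF assms(1) elim disjI1[OF refl]]
          shell_measure_fibre[OF assms(1) elim disjI2[OF refl]] w_def[symmetric] comb
        using split[of "\<lambda>t. indicator A (light_cone s (exp t) y1 y2)"]
          split[of "\<lambda>t. indicator A (light_cone s (- exp t) y1 y2)"]
        by simp
    qed
  qed
  also have "\<dots> = shell_integral 1 s (indicator A) + shell_integral (- 1) s (indicator A)"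
    unfolding shell_integral_def
    by (subst nn_integral_add[symmetric], measurable, intro nn_integral_cong, subst nn_integral_add) measurable
  finally show ?thesis .
qed

section \<open>Identification of the shell measures with Omega and its imaginary-mass
  analogue\<close>

lemma spatial_nth [simp]: "spatial p $ 1 = p $ 1" "spatial p $ 2 = p $ 2" "spatial p $ 3 = p $ 3"
  by (simp_all add: spatial_def)

lemma norm_spatial_sq: "(norm (spatial p))\<^sup>2 + minkowski_sq p = (p $ 0)\<^sup>2"
  by (simp add: norm_vec3_sq minkowski_sq_def)

lemma spatial_pt: "spatial (pt a (q $ 1) (q $ 2) (q $ 3)) = q"
  by (simp add: vec_eq_iff forall_3)

text \<open>On one energy branch the spatial part determines the energy, so the projection has an
  explicit inverse. The closed version is for imaginary masses, the open one for real
  masses.\<close>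

lemma spatial_image_shell:
  assumes \<delta>: "\<delta> = 1 \<or> \<delta> = -1"
  shows "spatial ` {p \<in> \<Gamma>. minkowski_sq p = s \<and> 0 \<le> \<delta> * p $ 0}
    = {q. 0 \<le> (norm q)\<^sup>2 + s \<and> pt (\<delta> * sqrt ((norm q)\<^sup>2 + s)) (q $ 1) (q $ 2) (q $ 3) \<in> \<Gamma>}" (is "?L = ?R")
    and "spatial ` {p \<in> \<Gamma>. minkowski_sq p = s \<and> 0 < \<delta> * p $ 0}
    = {q. 0 < (norm q)\<^sup>2 + s \<and> pt (\<delta> * sqrt ((norm q)\<^sup>2 + s)) (q $ 1) (q $ 2) (q $ 3) \<in> \<Gamma>}" (is "?L' = ?R'")
proof -
  have 1: "0 \<le> (norm (spatial p))\<^sup>2 + s"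
    "pt (\<delta> * sqrt ((norm (spatial p))\<^sup>2 + s)) (spatial p $ 1) (spatial p $ 2) (spatial p $ 3) = p"
    "0 < \<delta> * p $ 0 \<Longrightarrow> 0 < (norm (spatial p))\<^sup>2 + s"
    if "minkowski_sq p = s" "0 \<le> \<delta> * p $ 0" for p
  proof -
    have e: "(norm (spatial p))\<^sup>2 + s = (p $ 0)\<^sup>2"
      using norm_spatial_sq[of p] that by simp
    show "0 \<le> (norm (spatial p))\<^sup>2 + s" "0 < \<delta> * p $ 0 \<Longrightarrow> 0 < (norm (spatial p))\<^sup>2 + s"
      unfolding e by (auto simp: zero_less_power2)
    show "pt (\<delta> * sqrt ((norm (spatial p))\<^sup>2 + s)) (spatial p $ 1) (spatial p $ 2) (spatial p $ 3) = p"
      unfolding e using \<delta> that(2) by (auto simp: vec4_eq_iff)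
  qed
  have 2: "minkowski_sq (pt (\<delta> * sqrt ((norm q)\<^sup>2 + s)) (q $ 1) (q $ 2) (q $ 3)) = s" if "0 \<le> (norm q)\<^sup>2 + s" for q :: "real^3"
    using that \<delta> by (auto simp: minkowski_sq_def norm_vec3_sq power_mult_distrib)
  have \<delta>2: "\<delta> * (\<delta> * x) = x" for x :: real
    using \<delta> by auto
  show "?L = ?R"
  proof (intro set_eqI iffI)
    fix q assume "q \<in> ?R"
    then show "q \<in> ?L"
      using 2[of q]
      by (intro image_eqI[where x="pt (\<delta> * sqrt ((norm q)\<^sup>2 + s)) (q $ 1) (q $ 2) (q $ 3)"])
         (auto simp: \<delta>2 spatial_pt)
  qed (use 1 in auto)
  show "?L' = ?R'"
  proof (intro set_eqI iffI)
    fix q assume "q \<in> ?R'"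
    then show "q \<in> ?L'"
      using 2[of q]
      by (intro image_eqI[where x="pt (\<delta> * sqrt ((norm q)\<^sup>2 + s)) (q $ 1) (q $ 2) (q $ 3)"])
         (auto simp: \<delta>2 spatial_pt)
  qed (use 1 in \<open>auto simp: less_imp_le\<close>)
qed

text \<open>The real-valued integral of a nonnegative function is \<open>enn2real\<close> of its
  extended integral, also when the latter is infinite: then both are 0.\<close>

lemma Omega_eq_shell_measure:
  assumes [measurable]: "\<Gamma> \<in> sets borel" and \<delta>: "\<delta> = 1 \<or> \<delta> = -1"
  shows "Omega \<delta> m \<Gamma> = enn2real (shell_measure \<delta> (m\<^sup>2) \<Gamma>)"
proof -
  have S: "spatial ` (\<Gamma> \<inter> mass_shell \<delta> m)
      = {q. 0 < (norm q)\<^sup>2 + m\<^sup>2 \<and> pt (\<delta> * sqrt ((norm q)\<^sup>2 + m\<^sup>2)) (q $ 1) (q $ 2) (q $ 3) \<in> \<Gamma>}"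
    unfolding spatial_image_shell(2)[OF \<delta>, symmetric] by (auto simp: mass_shell_def intro!: arg_cong[where f="image spatial"])
  have "Omega \<delta> m \<Gamma> = (\<integral>q. indicator {q. 0 < (norm q)\<^sup>2 + m\<^sup>2 \<and> pt (\<delta> * sqrt ((norm q)\<^sup>2 + m\<^sup>2)) (q $ 1) (q $ 2) (q $ 3) \<in> \<Gamma>} q
      * (1 / sqrt (m\<^sup>2 + (norm (q::real^3))\<^sup>2)) \<partial>lborel)"
    unfolding Omega_def S set_lebesgue_integral_def energy_def by simp
  also have "\<dots> = enn2real (\<integral>\<^sup>+q. ennreal (indicator {q. 0 < (norm q)\<^sup>2 + m\<^sup>2 \<and> pt (\<delta> * sqrt ((norm q)\<^sup>2 + m\<^sup>2)) (q $ 1) (q $ 2) (q $ 3) \<in> \<Gamma>} q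
      * (1 / sqrt (m\<^sup>2 + (norm (q::real^3))\<^sup>2))) \<partial>lborel)"
    by (rule integral_eq_nn_integral) auto
  also have "\<dots> = enn2real (shell_measure \<delta> (m\<^sup>2) \<Gamma>)"
    unfolding shell_measure_def
    by (intro arg_cong[where f=enn2real] nn_integral_cong) (auto simp: indicator_def add.commute)
  finally show ?thesis .
qed

lemma Omega_im_half_eq_shell_measure:
  assumes [measurable]: "\<Gamma> \<in> sets borel" and \<delta>: "\<delta> = 1 \<or> \<delta> = -1"
  shows "Omega_im_half \<delta> m \<Gamma> = enn2real (shell_measure \<delta> (- m\<^sup>2) \<Gamma>)"
proof -
  have S: "spatial ` (\<Gamma> \<inter> mass_shell_im \<delta> m)
      = {q. 0 \<le> (norm q)\<^sup>2 + - m\<^sup>2 \<and> pt (\<delta> * sqrt ((norm q)\<^sup>2 + - m\<^sup>2)) (q $ 1) (q $ 2) (q $ 3) \<in> \<Gamma>}"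
    unfolding spatial_image_shell(1)[OF \<delta>, symmetric] by (auto simp: mass_shell_im_def intro!: arg_cong[where f="image spatial"])
  have "Omega_im_half \<delta> m \<Gamma> = (\<integral>q. indicator {q. 0 \<le> (norm q)\<^sup>2 + - m\<^sup>2 \<and> pt (\<delta> * sqrt ((norm q)\<^sup>2 + - m\<^sup>2)) (q $ 1) (q $ 2) (q $ 3) \<in> \<Gamma>} q
      * (1 / sqrt ((norm (q::real^3))\<^sup>2 - m\<^sup>2)) \<partial>lborel)"
    unfolding Omega_im_half_def S set_lebesgue_integral_def energy_im_def by simp
  also have "\<dots> = enn2real (\<integral>\<^sup>+q. ennreal (indicator {q. 0 \<le> (norm q)\<^sup>2 + - m\<^sup>2 \<and> pt (\<delta> * sqrt ((norm q)\<^sup>2 + - m\<^sup>2)) (q $ 1) (q $ 2) (q $ 3) \<in> \<Gamma>} q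
      * (1 / sqrt ((norm (q::real^3))\<^sup>2 - m\<^sup>2))) \<partial>lborel)"
    by (rule integral_eq_nn_integral) (auto simp: indicator_def)
  \<comment> \<open>On the sphere \<open>norm q = m\<close> the integrand is 1 / 0 = 0, so the
    closed and the strict condition give the same integral.\<close>
  also have "\<dots> = enn2real (shell_measure \<delta> (- m\<^sup>2) \<Gamma>)"
    unfolding shell_measure_def
    by (intro arg_cong[where f=enn2real] nn_integral_cong) (auto simp: indicator_def)
  finally show ?thesis .
qed

section \<open>Disintegration of positive invariant measures\<close>

text \<open>A unit cube in the coordinates ln |x|, p1, p2, whence the bounds 1 and e; p^2 is left
  free.\<close>

definition slab :: "real \<Rightarrow> (real^4) set" where
  "slab \<epsilon> = {p. 1 \<le> \<epsilon> * plus_coord p \<and> \<epsilon> * plus_coord p \<le> exp 1 \<and> p $ 1 \<in> {0..1} \<and> p $ 2 \<in> {0..1}}"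

lemma slab_measurable [measurable]: "slab \<epsilon> \<in> sets borel"
  unfolding slab_def by measurable

text \<open>The set of admissible \<open>t\<close> may move with the transverse position as long as
  its measure stays 1; the flipped \<open>spacelike_box\<close> needs this.\<close>

lemma shell_integral_product:
  assumes "\<And>y1 y2 t. f (light_cone s (\<epsilon> * exp t) y1 y2) = a * (indicator I y1 * (indicator J y2 * indicator (K y1 y2) t))"
    and [measurable]: "I \<in> sets borel" "J \<in> sets borel"
    and K: "\<And>y1 y2. y1 \<in> I \<Longrightarrow> y2 \<in> J \<Longrightarrow> K y1 y2 \<in> sets borel \<and> emeasure lborel (K y1 y2) = 1"
  shows "shell_integral \<epsilon> s f = a * (emeasure lborel I * emeasure lborel J)"
proof -
  have "(\<integral>\<^sup>+t. f (light_cone s (\<epsilon> * exp t) y1 y2) \<partial>lborel) = a * indicator I y1 * indicator J y2" for y1 y2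
  proof (cases "y1 \<in> I \<and> y2 \<in> J")
    case True
    then show ?thesis
      using K[of y1 y2] by (simp add: assms(1) nn_integral_cmult_indicator)
  next
    case False
    then have "f (light_cone s (\<epsilon> * exp t) y1 y2) = 0" for t
      by (auto simp: assms(1))
    then show ?thesis
      using False by auto
  qed
  then show ?thesis
    by (simp add: shell_integral_def nn_integral_cmult nn_integral_multc mult_ac)
qed

lemma shell_integral_slab:
  assumes \<epsilon>: "\<epsilon> = 1 \<or> \<epsilon> = -1"
  shows "shell_integral \<epsilon> s (indicator (slab \<epsilon>)) = 1"
proof -
  have "shell_integral \<epsilon> s (indicator (slab \<epsilon>)) = 1 * (emeasure lborel {0..1::real} * emeasure lborel {0..1::real})"
  proof (rule shell_integral_product[where K="\<lambda>_ _. {0..1}"])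
    fix y1 y2 t :: real
    have "\<epsilon> * (\<epsilon> * exp t) = exp t"
      using \<epsilon> by auto
    then show "(indicator (slab \<epsilon>) (light_cone s (\<epsilon> * exp t) y1 y2) :: ennreal)
      = 1 * (indicator {0..1} y1 * (indicator {0..1} y2 * indicator {0..1} t))"
      by (auto simp: indicator_def slab_def mult.assoc[symmetric])
  qed auto
  then show ?thesis
    by simp
qed

lemma shell_integral_cmult_minkowski_sq:
  assumes [measurable]: "f \<in> borel_measurable borel" and \<epsilon>: "\<epsilon> = 1 \<or> \<epsilon> = -1"
  shows "shell_integral \<epsilon> s (\<lambda>p. \<psi> (minkowski_sq p) * f p) = \<psi> s * shell_integral \<epsilon> s f"
proof -
  have "\<epsilon> * exp t \<noteq> 0" for t
    using \<epsilon> by auto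
  then show ?thesis
    by (simp add: shell_integral_def minkowski_sq_light_cone nn_integral_cmult)
qed

text \<open>The box is chosen so that \<open>p\<^sup>0 - p\<^sup>3 < 0 < p\<^sup>0 + p\<^sup>3\<close> on it. Hence \<open>flip\<close>, the rotation by \<open>\<pi>\<close> about the
  first axis, which exchanges \<open>p\<^sup>0 + p\<^sup>3\<close> and \<open>p\<^sup>0 - p\<^sup>3\<close>, moves it to the other half of the shell.\<close>

definition spacelike_box :: "(real^4) set" where
  "spacelike_box = {p. minkowski_sq p < 0 \<and> 1 \<le> plus_coord p \<and> plus_coord p \<le> exp 1 \<and>
     0 < p $ 1 \<and> p $ 1 < sqrt (- minkowski_sq p) / 2 \<and> \<bar>p $ 2\<bar> < sqrt (- minkowski_sq p) / 2}"

definition flip :: "real^4 \<Rightarrow> real^4" where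
  "flip p = pt (p $ 0) (p $ 1) (- p $ 2) (- p $ 3)"

lemma spacelike_box_measurable [measurable]: "spacelike_box \<in> sets borel"
  unfolding spacelike_box_def by measurable

lemma flip_measurable [measurable (raw)]:
  assumes [measurable]: "f \<in> borel_measurable M"
  shows "(\<lambda>x. flip (f x)) \<in> borel_measurable M"
  unfolding flip_def by measurable

lemma minkowski_sq_flip [simp]: "minkowski_sq (flip p) = minkowski_sq p"
  by (simp add: flip_def minkowski_sq_def)

lemma plus_coord_mult_flip: "plus_coord p * plus_coord (flip p) = minkowski_sq p + (p $ 1)\<^sup>2 + (p $ 2)\<^sup>2"
  by (simp add: plus_coord_def flip_def minkowski_sq_def power2_eq_square algebra_simps)

text \<open>Each transverse square is below -s/4. The conclusion is the sign of (p0 + p3) (p0 -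
  p3).\<close>

lemma spacelike_boxD:
  assumes "s < 0" "\<bar>y1\<bar> < sqrt (- s) / 2" "\<bar>y2\<bar> < sqrt (- s) / 2"
  shows "s + y1\<^sup>2 + y2\<^sup>2 < 0"
proof -
  have "y\<^sup>2 < - s / 4" if "\<bar>y\<bar> < sqrt (- s) / 2" for y
  proof -
    have "\<bar>y\<bar>\<^sup>2 < (sqrt (- s) / 2)\<^sup>2"
      using that by (intro power_strict_mono) auto
    then show ?thesis
      using assms(1) by (simp add: power_divide)
  qed
  from this[OF assms(2)] this[OF assms(3)] show ?thesis
    using assms(1) by linarith
qed

text \<open>Both values are the transverse area r * 2 r with r = sqrt(-s)/2. Flipping replaces x by
  (s + y1^2 + y2^2)/x, which reflects and translates the unit interval of ln |x| without changing
  its length.\<close>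

lemma shell_integral_spacelike_box:
  assumes s: "s < 0"
  shows "shell_integral 1 s (indicator spacelike_box) = ennreal (- s / 2)"
    and "shell_integral (- 1) s (\<lambda>p. indicator spacelike_box (flip p)) = ennreal (- s / 2)"
proof -
  let ?r = "sqrt (- s) / 2"
  have r: "emeasure lborel {0 <..< ?r} * emeasure lborel {- ?r <..< ?r} = ennreal (- s / 2)"
    using s by (simp add: ennreal_mult[symmetric])
  have "shell_integral 1 s (indicator spacelike_box) = 1 * (emeasure lborel {0 <..< ?r} * emeasure lborel {- ?r <..< ?r})"
    by (rule shell_integral_product[where K="\<lambda>_ _. {0..1}"])
       (use s in \<open>auto simp: indicator_def spacelike_box_def minkowski_sq_light_cone\<close>)
  then show "shell_integral 1 s (indicator spacelike_box) = ennreal (- s / 2)"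
    unfolding r by simp
  let ?c = "\<lambda>y1 y2. - (s + y1\<^sup>2 + y2\<^sup>2)"
  have "shell_integral (- 1) s (\<lambda>p. indicator spacelike_box (flip p))
     = 1 * (emeasure lborel {0 <..< ?r} * emeasure lborel {- ?r <..< ?r})"
  proof (rule shell_integral_product[where K="\<lambda>y1 y2. {ln (?c y1 y2) - 1 .. ln (?c y1 y2)}"])
    fix y1 y2 t :: real
    let ?p = "light_cone s (- 1 * exp t) y1 y2"
    have m: "minkowski_sq ?p = s"
      by (simp add: minkowski_sq_light_cone)
    have "- exp t * plus_coord (flip ?p) = s + y1\<^sup>2 + y2\<^sup>2"
      using plus_coord_mult_flip[of ?p] m by simp
    then have x: "plus_coord (flip ?p) = ?c y1 y2 / exp t"
      by (simp add: field_simps)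
    have e: "(1 \<le> ?c y1 y2 / exp t \<and> ?c y1 y2 / exp t \<le> exp 1) \<longleftrightarrow> t \<in> {ln (?c y1 y2) - 1 .. ln (?c y1 y2)}"
      if "\<bar>y1\<bar> < ?r" "\<bar>y2\<bar> < ?r"
    proof -
      have c: "0 < ?c y1 y2"
        using spacelike_boxD[OF s that] by linarith
      then have "?c y1 y2 / exp t = exp (ln (?c y1 y2) - t)"
        by (simp add: exp_diff)
      then show ?thesis
        by (auto simp: one_le_exp_iff)
    qed
    have "flip ?p \<in> spacelike_box \<longleftrightarrow> (1 \<le> ?c y1 y2 / exp t \<and> ?c y1 y2 / exp t \<le> exp 1) \<and> 0 < y1 \<and> y1 < ?r \<and> \<bar>y2\<bar> < ?r"
      unfolding spacelike_box_def mem_Collect_eq minkowski_sq_flip m x using s by (auto simp: flip_def)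
    also have "\<dots> \<longleftrightarrow> y1 \<in> {0 <..< ?r} \<and> y2 \<in> {- ?r <..< ?r} \<and> t \<in> {ln (?c y1 y2) - 1 .. ln (?c y1 y2)}"
      using e by auto
    finally show "(indicator spacelike_box (flip ?p) :: ennreal)
      = 1 * (indicator {0 <..< ?r} y1 * (indicator {- ?r <..< ?r} y2 * indicator {ln (?c y1 y2) - 1 .. ln (?c y1 y2)} t))"
      by (simp add: indicator_def)
  qed auto
  then show "shell_integral (- 1) s (\<lambda>p. indicator spacelike_box (flip p)) = ennreal (- s / 2)"
    unfolding r by simp
qed

text \<open>Fits functions supported on a plane p0 + y = 0 with y a combination of transverse
  momenta: multiplied by 2 x its equation becomes a monic quadratic in x, so each transverse fibre
  has at most two points.\<close>

lemma shell_integral_linear_zero: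
  assumes "\<epsilon> = 1 \<or> \<epsilon> = -1" and [measurable]: "f \<in> borel_measurable borel"
    and "\<And>x y1 y2. f (light_cone s x y1 y2) \<noteq> 0 \<Longrightarrow> x\<^sup>2 + a y1 y2 * x + (s + y1\<^sup>2 + y2\<^sup>2) = 0"
  shows "shell_integral \<epsilon> s f = 0"
proof -
  have "(\<integral>\<^sup>+t. f (light_cone s (\<epsilon> * exp t) y1 y2) \<partial>lborel) = 0" for y1 y2
  proof -
    have "finite {x. poly [:s + y1\<^sup>2 + y2\<^sup>2, a y1 y2, 1:] x = 0}"
      by (rule poly_roots_finite) simp
    then have "finite ((\<lambda>t. \<epsilon> * exp t) -` {x. poly [:s + y1\<^sup>2 + y2\<^sup>2, a y1 y2, 1:] x = 0})"
      by (rule finite_vimageI) (use assms(1) in \<open>auto simp: inj_on_def\<close>)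
    from AE_not_in[OF finite_imp_null_set_lborel[OF this]]
    have "AE t in lborel. f (light_cone s (\<epsilon> * exp t) y1 y2) = 0"
      by eventually_elim (use assms(3) in \<open>force simp: power2_eq_square algebra_simps\<close>)
    then show ?thesis
      by (subst nn_integral_0_iff_AE) simp_all
  qed
  then show ?thesis
    by (simp add: shell_integral_def)
qed

text \<open>Since |x| \<ge> 1, p0 - p3 is bounded by |s| + p1^2 + p2^2 \<le> b + 2; together with
  |x| \<le> e < 3 this bounds p0 and p3.\<close>

lemma bounded_slab:
  assumes \<epsilon>: "\<epsilon> = 1 \<or> \<epsilon> = -1"
  shows "bounded (slab \<epsilon> \<inter> {p. \<bar>minkowski_sq p\<bar> \<le> b})"
proof (rule boundedI)
  fix p assume "p \<in> slab \<epsilon> \<inter> {p. \<bar>minkowski_sq p\<bar> \<le> b}"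
  then have x: "1 \<le> \<bar>plus_coord p\<bar>" "\<bar>plus_coord p\<bar> \<le> 3" and y: "0 \<le> p $ 1" "p $ 1 \<le> 1" "0 \<le> p $ 2" "p $ 2 \<le> 1"
    and s: "\<bar>minkowski_sq p\<bar> \<le> b"
    using \<epsilon> exp_le by (auto simp: slab_def)
  have "(p $ 1)\<^sup>2 \<le> 1" "(p $ 2)\<^sup>2 \<le> 1"
    using y by (auto simp: power_le_one)
  then have le: "\<bar>plus_coord p * (p $ 0 - p $ 3)\<bar> \<le> b + 2"
    using s plus_coord_mult_flip[of p] by (simp add: flip_def plus_coord_def abs_le_iff) (smt (verit) zero_le_power2)
  have "\<bar>p $ 0 - p $ 3\<bar> \<le> \<bar>plus_coord p\<bar> * \<bar>p $ 0 - p $ 3\<bar>"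
    using x(1) mult_right_mono[of 1 "\<bar>plus_coord p\<bar>" "\<bar>p $ 0 - p $ 3\<bar>"] by simp
  also have "\<dots> \<le> b + 2"
    using le by (simp add: abs_mult)
  finally have "\<bar>p $ 0\<bar> \<le> b + 5" "\<bar>p $ 3\<bar> \<le> b + 5"
    using x(2) s by (auto simp: plus_coord_def)
  moreover have "norm p \<le> \<bar>p $ 0\<bar> + \<bar>p $ 1\<bar> + \<bar>p $ 2\<bar> + \<bar>p $ 3\<bar>"
    using norm_le_l1_cart[of p] unfolding UNIV_4_zero by simp
  ultimately show "norm p \<le> (b + 5) + 1 + 1 + (b + 5)"
    using y by linarith
qed

section \<open>Disintegration over half shells\<close>

context lorentz_invariant_measure
begin

text \<open>The symmetry theorem against the slab, whose shell integral is 1. On the right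
  \<open>f\<close> enters only through its shell integrals, so \<open>M\<close> on the half space is
  determined by how p^2 is distributed on the slab.\<close>

lemma nn_integral_half_space:
  assumes \<epsilon>: "\<epsilon> = 1 \<or> \<epsilon> = -1" and [measurable]: "f \<in> borel_measurable borel"
  shows "(\<integral>\<^sup>+p. indicator {p. \<epsilon> * plus_coord p > 0} p * f p \<partial>M)
    = (\<integral>\<^sup>+p. indicator (slab \<epsilon>) p * shell_integral \<epsilon> (minkowski_sq p) f \<partial>M)"
proof -
  have "indicator {p. \<epsilon> * plus_coord p > 0} p * indicator (slab \<epsilon>) p = (indicator (slab \<epsilon>) p :: ennreal)" for p
    by (auto simp: indicator_def slab_def)
  then show ?thesis
    using shell_integral_symmetric[OF \<epsilon> assms(2), of "indicator (slab \<epsilon>)"]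
    by (simp add: shell_integral_slab[OF \<epsilon>])
qed

text \<open>Invariance turns the part of the plane x = 0 that \<open>L\<close> moves away into the
  set \<open>?Z\<close> off that plane, where the disintegration applies and every shell integral
  vanishes.\<close>

lemma null_rotated_plane:
  assumes L: "lorentz_map L" "\<And>p. L (L p) = p" and [measurable]: "L \<in> borel_measurable borel"
    and eq: "\<And>s x y1 y2. x \<noteq> 0 \<Longrightarrow> plus_coord (L (light_cone s x y1 y2)) = 0 \<Longrightarrow> x\<^sup>2 + a y1 y2 * x + (s + y1\<^sup>2 + y2\<^sup>2) = 0"
  shows "emeasure M {p. plus_coord p = 0 \<and> plus_coord (L p) \<noteq> 0} = 0"
proof -
  let ?Z = "{p. plus_coord (L p) = 0 \<and> plus_coord p \<noteq> 0}"
  have half: "(\<integral>\<^sup>+p. indicator {p. \<epsilon> * plus_coord p > 0} p * indicator ?Z p \<partial>M) = 0"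
    if \<epsilon>: "\<epsilon> = 1 \<or> \<epsilon> = -1" for \<epsilon>
  proof -
    have "shell_integral \<epsilon> s (indicator ?Z) = 0" for s
      by (rule shell_integral_linear_zero[OF \<epsilon>, where a=a]) (auto simp: indicator_def eq split: if_splits)
    then show ?thesis
      by (simp add: nn_integral_half_space[OF \<epsilon>])
  qed
  have "emeasure M {p. plus_coord p = 0 \<and> plus_coord (L p) \<noteq> 0} = (\<integral>\<^sup>+p. indicator ?Z (L p) \<partial>M)"
    by (subst nn_integral_indicator[symmetric], measurable, intro nn_integral_cong) (auto simp: indicator_def L)
  also have "\<dots> = (\<integral>\<^sup>+p. indicator ?Z p \<partial>M)"
    by (rule nn_integral_lorentz_map[OF _ L(1)]) (auto simp: L)
  also have "\<dots> = (\<integral>\<^sup>+p. indicator {p. 1 * plus_coord p > 0} p * indicator ?Z p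
      + indicator {p. - 1 * plus_coord p > 0} p * indicator ?Z p \<partial>M)"
    by (intro nn_integral_cong) (auto simp: indicator_def)
  also have "\<dots> = (\<integral>\<^sup>+p. indicator {p. 1 * plus_coord p > 0} p * indicator ?Z p \<partial>M)
      + (\<integral>\<^sup>+p. indicator {p. - 1 * plus_coord p > 0} p * indicator ?Z p \<partial>M)"
    by (rule nn_integral_add) measurable
  also have "\<dots> = 0"
    using half[of 1] half[of "- 1"] by simp
  finally show ?thesis .
qed

lemma null_plane: "emeasure M {p. plus_coord p = 0 \<and> p \<noteq> 0} = 0"
proof -
  let ?L1 = "\<lambda>p::real^4. pt (p $ 0) (p $ 3) (- p $ 2) (p $ 1)"
  let ?L2 = "\<lambda>p::real^4. pt (p $ 0) (- p $ 3) (- p $ 2) (- p $ 1)"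
  let ?L3 = "\<lambda>p::real^4. pt (p $ 0) (- p $ 1) (p $ 3) (p $ 2)"
  let ?N = "\<lambda>L. {p. plus_coord p = 0 \<and> plus_coord (L p) \<noteq> 0}"
  \<comment> \<open>On a shell p0 = (x + k/x)/2, and the rotated x is p0 plus or minus a transverse
    momentum.\<close>
  have quad: "(x + k / x) / 2 + y = 0 \<Longrightarrow> x\<^sup>2 + (2 * y) * x + k = 0" if "x \<noteq> 0" for x k y :: real
    using that by (simp add: field_simps power2_eq_square)
  have [measurable]: "?L1 \<in> borel_measurable borel" "?L2 \<in> borel_measurable borel" "?L3 \<in> borel_measurable borel"
    by measurable
  have "emeasure M (?N ?L1) = 0"
    by (rule null_rotated_plane[where a="\<lambda>y1 y2. 2 * y1", OF lorentz_map_rotations(2)])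
       (use quad in \<open>auto simp: vec4_eq_iff plus_coord_def light_cone_def\<close>)
  moreover have "emeasure M (?N ?L2) = 0"
    by (rule null_rotated_plane[where a="\<lambda>y1 y2. 2 * (- y1)", OF lorentz_map_rotations(3)])
       (use quad[of _ _ "- _"] in \<open>auto simp: vec4_eq_iff plus_coord_def light_cone_def\<close>)
  moreover have "emeasure M (?N ?L3) = 0"
    by (rule null_rotated_plane[where a="\<lambda>y1 y2. 2 * y2", OF lorentz_map_rotations(4)])
       (use quad in \<open>auto simp: vec4_eq_iff plus_coord_def light_cone_def\<close>)
  ultimately have "?N ?L1 \<union> (?N ?L2 \<union> ?N ?L3) \<in> null_sets M"
    by (intro null_sets.Un) (auto simp: null_sets_def)
  then have "emeasure M (?N ?L1 \<union> (?N ?L2 \<union> ?N ?L3)) = 0"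
    by (rule null_setsD1)
  \<comment> \<open>A point kept in the plane by all three rotations has p0 + p3 = p0 + p1 = p0 - p1
    = p0 + p2 = 0, so it is the origin.\<close>
  moreover have "{p. plus_coord p = 0 \<and> p \<noteq> 0} = ?N ?L1 \<union> (?N ?L2 \<union> ?N ?L3)"
    by (auto simp: plus_coord_def vec4_eq_iff)
  ultimately show ?thesis
    by simp
qed

lemma spacelike_symmetric:
  assumes [measurable]: "\<psi> \<in> borel_measurable borel" and \<psi>: "\<And>s. 0 \<le> s \<Longrightarrow> \<psi> s = 0"
  shows "(\<integral>\<^sup>+p. indicator (slab 1) p * \<psi> (minkowski_sq p) \<partial>M)
    = (\<integral>\<^sup>+p. indicator (slab (- 1)) p * \<psi> (minkowski_sq p) \<partial>M)"
proof -
  \<comment> \<open>The factor is the reciprocal of -s/2, the shell integral of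
    \<open>spacelike_box\<close> and of its flipped copy.\<close>
  define \<phi> where "\<phi> s = \<psi> s * ennreal (2 / - s)" for s
  have [measurable]: "\<phi> \<in> borel_measurable borel"
    unfolding \<phi>_def[abs_def] by measurable
  have *: "(\<integral>\<^sup>+p. indicator (slab \<epsilon>) p * \<psi> (minkowski_sq p) \<partial>M) = (\<integral>\<^sup>+p. \<phi> (minkowski_sq p) * h p \<partial>M)"
    if \<epsilon>: "\<epsilon> = 1 \<or> \<epsilon> = -1" and [measurable]: "h \<in> borel_measurable borel"
      and h: "\<And>s. s < 0 \<Longrightarrow> shell_integral \<epsilon> s h = ennreal (- s / 2)"
      and pos: "\<And>p. h p \<noteq> 0 \<Longrightarrow> \<epsilon> * plus_coord p > 0" for \<epsilon> h
  proof -
    have "(\<integral>\<^sup>+p. \<phi> (minkowski_sq p) * h p \<partial>M)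
        = (\<integral>\<^sup>+p. indicator {p. \<epsilon> * plus_coord p > 0} p * (\<phi> (minkowski_sq p) * h p) \<partial>M)"
      using pos by (intro nn_integral_cong) (auto simp: indicator_def)
    also have "\<dots> = (\<integral>\<^sup>+p. indicator (slab \<epsilon>) p * (\<phi> (minkowski_sq p) * shell_integral \<epsilon> (minkowski_sq p) h) \<partial>M)"
      by (subst nn_integral_half_space[OF \<epsilon>], measurable, subst shell_integral_cmult_minkowski_sq[OF _ \<epsilon>]) simp_all
    also have "\<dots> = (\<integral>\<^sup>+p. indicator (slab \<epsilon>) p * \<psi> (minkowski_sq p) \<partial>M)"
    proof (intro nn_integral_cong arg_cong2[where f="(*)"] refl)
      fix p
      show "\<phi> (minkowski_sq p) * shell_integral \<epsilon> (minkowski_sq p) h = \<psi> (minkowski_sq p)"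
      proof (cases "minkowski_sq p < 0")
        case True
        then have "ennreal (2 / - minkowski_sq p) * ennreal (- minkowski_sq p / 2) = 1"
          by (subst ennreal_mult[symmetric]) (auto simp: field_simps)
        then show ?thesis
          by (simp only: \<phi>_def h[OF True] mult.assoc mult_1_right)
      qed (simp add: \<phi>_def \<psi>)
    qed
    finally show ?thesis ..
  qed
  have flip: "flip (flip p) = p" for p
    by (simp add: flip_def vec4_eq_iff)
  have "(\<integral>\<^sup>+p. indicator (slab 1) p * \<psi> (minkowski_sq p) \<partial>M)
      = (\<integral>\<^sup>+p. \<phi> (minkowski_sq p) * indicator spacelike_box p \<partial>M)"
  proof (rule *)
    fix p assume "(indicator spacelike_box p :: ennreal) \<noteq> 0"
    then show "1 * plus_coord p > 0"
      by (auto simp: spacelike_box_def indicator_def split: if_splits)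
  qed (simp_all add: shell_integral_spacelike_box)
  also have "\<dots> = (\<integral>\<^sup>+p. \<phi> (minkowski_sq (flip p)) * indicator spacelike_box (flip p) \<partial>M)"
    by (rule nn_integral_lorentz_map[where g=flip, symmetric])
       (use lorentz_map_rotations(1) in \<open>auto simp: flip flip_def[abs_def, symmetric]\<close>)
  also have "\<dots> = (\<integral>\<^sup>+p. indicator (slab (- 1)) p * \<psi> (minkowski_sq p) \<partial>M)"
    unfolding minkowski_sq_flip
  proof (rule *[symmetric])
    fix p assume "(indicator spacelike_box (flip p) :: ennreal) \<noteq> 0"
    then have p: "flip p \<in> spacelike_box"
      by (auto simp: indicator_def split: if_splits)
    \<comment> \<open>The product of x with its flipped value is negative on the box, so the flipped
      box lies in x < 0.\<close>
    then have "minkowski_sq p + (p $ 1)\<^sup>2 + (p $ 2)\<^sup>2 < 0"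
      by (intro spacelike_boxD) (auto simp: spacelike_box_def flip_def[of p] simp flip: minkowski_sq_flip[of p])
    then have "plus_coord p * plus_coord (flip p) < 0"
      by (simp add: plus_coord_mult_flip)
    moreover have "0 < plus_coord (flip p)"
      using p by (auto simp: spacelike_box_def)
    ultimately show "- 1 * plus_coord p > 0"
      by (simp add: mult_less_0_iff)
  qed (auto simp: shell_integral_spacelike_box)
  finally show ?thesis .
qed

end

section \<open>Mass distributions and the decomposition of a positive measure\<close>

lemma emeasure_eq_measure_finite: "emeasure M A < \<infinity> \<Longrightarrow> emeasure M A = ennreal (measure M A)"
  by (simp add: emeasure_eq_ennreal_measure)

lemma relcompact_borel_atLeast0D:
  assumes "B \<in> relcompact_borel {0::real..}"
  shows "B \<in> sets borel" "B \<subseteq> {0..}" "\<exists>b\<ge>0. B \<subseteq> {0..b}"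
proof -
  show B: "B \<in> sets borel" "B \<subseteq> {0..}"
    using assms by (auto simp: relcompact_borel_iff)
  have "bounded ({0..} \<inter> closure B)"
    using assms by (auto simp: relcompact_borel_iff intro: compact_imp_bounded)
  then have "bounded B"
    by (rule bounded_subset) (use B closure_subset in auto)
  then obtain b where "\<And>x. x \<in> B \<Longrightarrow> norm x \<le> b"
    unfolding bounded_iff by blast
  then show "\<exists>b\<ge>0. B \<subseteq> {0..b}"
    using B(2) by (intro exI[of _ "max b 0"]) (force simp: max_def)
qed

lemma relcompact_borel_UNIV_iff:
  fixes A :: "'a::euclidean_space set"
  shows "A \<in> relcompact_borel UNIV \<longleftrightarrow> A \<in> sets borel \<and> bounded A"
  by (simp add: relcompact_borel_iff)

context lorentz_invariant_measure
begin

text \<open>The law of the mass under \<open>M\<close> weighted by \<open>w\<close>. The absolute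
  value lets one definition serve real and imaginary masses; the weight selects the sign of
  p^2.\<close>

definition mass_distribution :: "(real^4 \<Rightarrow> ennreal) \<Rightarrow> real measure" where
  "mass_distribution w = distr (density M w) (restrict_space borel {0..}) (\<lambda>p. sqrt \<bar>minkowski_sq p\<bar>)"

lemma sets_mass_distribution [simp]: "sets (mass_distribution w) = sets (restrict_space borel {0..})"
  by (simp add: mass_distribution_def)

lemma nn_integral_mass_distribution:
  assumes [measurable]: "w \<in> borel_measurable borel" "F \<in> borel_measurable borel"
  shows "(\<integral>\<^sup>+m. F m \<partial>mass_distribution w) = (\<integral>\<^sup>+p. w p * F (sqrt \<bar>minkowski_sq p\<bar>) \<partial>M)"
proof -
  have "(\<lambda>p. sqrt \<bar>minkowski_sq p\<bar>) \<in> density M w \<rightarrow>\<^sub>M restrict_space borel {0..}"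
    by (rule measurable_restrict_space2) auto
  then have "(\<integral>\<^sup>+m. F m \<partial>mass_distribution w) = (\<integral>\<^sup>+p. F (sqrt \<bar>minkowski_sq p\<bar>) \<partial>density M w)"
    unfolding mass_distribution_def by (rule nn_integral_distr) (simp add: measurable_restrict_space1)
  also have "\<dots> = (\<integral>\<^sup>+p. w p * F (sqrt \<bar>minkowski_sq p\<bar>) \<partial>M)"
    by (rule nn_integral_density) auto
  finally show ?thesis .
qed

text \<open>Bounded masses confine p^2, and the slab with p^2 confined is bounded; so local
  finiteness passes from \<open>M\<close> to the mass distributions.\<close>

lemma mass_distribution_finite:
  assumes [measurable]: "w \<in> borel_measurable borel" and w: "\<And>p. w p \<le> indicator (slab \<epsilon>) p"
    and \<epsilon>: "\<epsilon> = 1 \<or> \<epsilon> = -1" and B: "B \<in> relcompact_borel {0..}"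
  shows "emeasure (mass_distribution w) B < \<infinity>"
proof -
  obtain b where b: "b \<ge> 0" "B \<subseteq> {0..b}"
    using relcompact_borel_atLeast0D[OF B] by blast
  have [measurable]: "B \<in> sets borel" and BS: "B \<in> sets (mass_distribution w)"
    using relcompact_borel_atLeast0D[OF B] B by (auto simp: relcompact_borel_def)
  have "emeasure (mass_distribution w) B = (\<integral>\<^sup>+m. indicator B m \<partial>mass_distribution w)"
    using BS by simp
  also have "\<dots> = (\<integral>\<^sup>+p. w p * indicator B (sqrt \<bar>minkowski_sq p\<bar>) \<partial>M)"
    by (rule nn_integral_mass_distribution) auto
  also have "\<dots> \<le> (\<integral>\<^sup>+p. indicator (slab \<epsilon> \<inter> {p. \<bar>minkowski_sq p\<bar> \<le> b\<^sup>2}) p \<partial>M)"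
  proof (rule nn_integral_mono)
    fix p
    have "\<bar>minkowski_sq p\<bar> \<le> b\<^sup>2" if "sqrt \<bar>minkowski_sq p\<bar> \<in> B"
      using that b by (auto simp: real_sqrt_le_iff' dest!: subsetD)
    then show "w p * indicator B (sqrt \<bar>minkowski_sq p\<bar>) \<le> indicator (slab \<epsilon> \<inter> {p. \<bar>minkowski_sq p\<bar> \<le> b\<^sup>2}) p"
      using w[of p] by (auto simp: indicator_def split: if_splits)
  qed
  also have "\<dots> < \<infinity>"
    using finite_bounded[OF _ bounded_slab[OF \<epsilon>, of "b\<^sup>2"]] by simp
  finally show ?thesis .
qed

text \<open>The cone p^2 = 0 is counted here because its forward and backward halves may carry
  different mass, while \<open>Omega_im\<close> at m = 0 offers only their sum.\<close>

definition timelike_weight :: "real \<Rightarrow> real^4 \<Rightarrow> ennreal" where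
  "timelike_weight \<epsilon> p = indicator (slab \<epsilon>) p * indicator {p. 0 \<le> minkowski_sq p} p"

definition spacelike_weight :: "real \<Rightarrow> real^4 \<Rightarrow> ennreal" where
  "spacelike_weight \<epsilon> p = indicator (slab \<epsilon>) p * indicator {p. minkowski_sq p < 0} p"

lemma weight_measurable [measurable]:
  "timelike_weight \<epsilon> \<in> borel_measurable borel" "spacelike_weight \<epsilon> \<in> borel_measurable borel"
  unfolding timelike_weight_def[abs_def] spacelike_weight_def[abs_def] by measurable

lemma weight_le:
  "timelike_weight \<epsilon> p \<le> indicator (slab \<epsilon>) p" "spacelike_weight \<epsilon> p \<le> indicator (slab \<epsilon>) p"
  by (auto simp: timelike_weight_def spacelike_weight_def indicator_def)

lemma emeasure_decomposition:
  assumes [measurable]: "\<Gamma> \<in> sets borel"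
  shows "emeasure M \<Gamma> = emeasure M {0} * indicator \<Gamma> 0
    + (\<integral>\<^sup>+m. shell_measure 1 (m\<^sup>2) \<Gamma> \<partial>mass_distribution (timelike_weight 1))
    + (\<integral>\<^sup>+m. shell_measure (- 1) (m\<^sup>2) \<Gamma> \<partial>mass_distribution (timelike_weight (- 1)))
    + (\<integral>\<^sup>+m. shell_measure 1 (- m\<^sup>2) \<Gamma> + shell_measure (- 1) (- m\<^sup>2) \<Gamma> \<partial>mass_distribution (spacelike_weight 1))"
proof -
  let ?J = "\<lambda>\<epsilon> p. shell_integral \<epsilon> (minkowski_sq p) (indicator \<Gamma>)"
  let ?H = "\<lambda>\<epsilon>. \<integral>\<^sup>+p. indicator {p. \<epsilon> * plus_coord p > 0} p * indicator \<Gamma> p \<partial>M"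
  have time: "(\<integral>\<^sup>+p. timelike_weight \<epsilon> p * ?J \<epsilon> p \<partial>M)
      = (\<integral>\<^sup>+m. shell_measure \<epsilon> (m\<^sup>2) \<Gamma> \<partial>mass_distribution (timelike_weight \<epsilon>))"
    if \<epsilon>: "\<epsilon> = 1 \<or> \<epsilon> = -1" for \<epsilon>
    by (subst nn_integral_mass_distribution, measurable, intro nn_integral_cong)
       (auto simp: timelike_weight_def indicator_def shell_measure_nonneg[OF _ _ \<epsilon>])
  have half: "?H \<epsilon> = (\<integral>\<^sup>+p. timelike_weight \<epsilon> p * ?J \<epsilon> p \<partial>M) + (\<integral>\<^sup>+p. spacelike_weight \<epsilon> p * ?J \<epsilon> p \<partial>M)"
    if \<epsilon>: "\<epsilon> = 1 \<or> \<epsilon> = -1" for \<epsilon>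
  proof -
    have "?H \<epsilon> = (\<integral>\<^sup>+p. indicator (slab \<epsilon>) p * ?J \<epsilon> p \<partial>M)"
      by (rule nn_integral_half_space[OF \<epsilon>]) simp
    also have "\<dots> = (\<integral>\<^sup>+p. timelike_weight \<epsilon> p * ?J \<epsilon> p + spacelike_weight \<epsilon> p * ?J \<epsilon> p \<partial>M)"
      by (intro nn_integral_cong) (auto simp: timelike_weight_def spacelike_weight_def indicator_def)
    also have "\<dots> = (\<integral>\<^sup>+p. timelike_weight \<epsilon> p * ?J \<epsilon> p \<partial>M) + (\<integral>\<^sup>+p. spacelike_weight \<epsilon> p * ?J \<epsilon> p \<partial>M)"
      by (rule nn_integral_add) measurable
    finally show ?thesis .
  qed
  \<comment> \<open>Both spacelike halves are now integrated against the same distribution, as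
    \<open>shell_measure_both\<close> requires.\<close>
  have "(\<integral>\<^sup>+p. spacelike_weight (- 1) p * ?J (- 1) p \<partial>M) = (\<integral>\<^sup>+p. spacelike_weight 1 p * ?J (- 1) p \<partial>M)"
    using spacelike_symmetric[of "\<lambda>s. indicator {..<0} s * shell_integral (- 1) s (indicator \<Gamma>)"]
    by (simp add: spacelike_weight_def indicator_def mult.assoc)
  then have "(\<integral>\<^sup>+p. spacelike_weight 1 p * ?J 1 p \<partial>M) + (\<integral>\<^sup>+p. spacelike_weight (- 1) p * ?J (- 1) p \<partial>M)
      = (\<integral>\<^sup>+p. spacelike_weight 1 p * ?J 1 p + spacelike_weight 1 p * ?J (- 1) p \<partial>M)"
    by (subst nn_integral_add) simp_all
  also have "\<dots> = (\<integral>\<^sup>+m. shell_measure 1 (- m\<^sup>2) \<Gamma> + shell_measure (- 1) (- m\<^sup>2) \<Gamma> \<partial>mass_distribution (spacelike_weight 1))"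
    by (subst nn_integral_mass_distribution, measurable, intro nn_integral_cong)
       (auto simp: spacelike_weight_def indicator_def shell_measure_both)
  finally have space: "(\<integral>\<^sup>+p. spacelike_weight 1 p * ?J 1 p \<partial>M) + (\<integral>\<^sup>+p. spacelike_weight (- 1) p * ?J (- 1) p \<partial>M)
      = (\<integral>\<^sup>+m. shell_measure 1 (- m\<^sup>2) \<Gamma> + shell_measure (- 1) (- m\<^sup>2) \<Gamma> \<partial>mass_distribution (spacelike_weight 1))" .
  have "{p. plus_coord p = 0 \<and> p \<noteq> 0} \<in> null_sets M"
    using null_plane by (simp add: null_sets_def)
  from AE_not_in[OF this]
  have "AE p in M. indicator \<Gamma> p = indicator \<Gamma> 0 * indicator {0} p + (indicator {p. 1 * plus_coord p > 0} p * indicator \<Gamma> p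
      + indicator {p. - 1 * plus_coord p > 0} p * (indicator \<Gamma> p :: ennreal))"
    by eventually_elim (auto simp: indicator_def plus_coord_def)
  from nn_integral_cong_AE[OF this]
  have "emeasure M \<Gamma> = (\<integral>\<^sup>+p. indicator \<Gamma> 0 * indicator {0} p + (indicator {p. 1 * plus_coord p > 0} p * indicator \<Gamma> p
      + indicator {p. - 1 * plus_coord p > 0} p * indicator \<Gamma> p) \<partial>M)"
    by (simp only: nn_integral_indicator[of \<Gamma> M] sets_M assms)
  also have "\<dots> = (\<integral>\<^sup>+p. indicator \<Gamma> 0 * indicator {0} p \<partial>M) + (?H 1 + ?H (- 1))"
    by (subst nn_integral_add, measurable, subst nn_integral_add) measurable
  also have "(\<integral>\<^sup>+p. indicator \<Gamma> 0 * indicator {0} p \<partial>M) = emeasure M {0} * indicator \<Gamma> 0"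
    by (subst nn_integral_cmult_indicator) (simp_all add: mult.commute)
  also have "?H 1 + ?H (- 1) = (\<integral>\<^sup>+p. timelike_weight 1 p * ?J 1 p \<partial>M) + (\<integral>\<^sup>+p. timelike_weight (- 1) p * ?J (- 1) p \<partial>M)
      + ((\<integral>\<^sup>+p. spacelike_weight 1 p * ?J 1 p \<partial>M) + (\<integral>\<^sup>+p. spacelike_weight (- 1) p * ?J (- 1) p \<partial>M))"
    unfolding half[OF disjI1[OF refl]] half[OF disjI2[OF refl]] by (simp only: ac_simps)
  finally show ?thesis
    unfolding space time[OF disjI1[OF refl]] time[OF disjI2[OF refl]] by (simp only: add.assoc)
qed

end

lemma nn_integral_enn2real:
  assumes "f \<in> borel_measurable M" "(\<integral>\<^sup>+x. f x \<partial>M) < \<infinity>"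
  shows "(\<integral>\<^sup>+x. ennreal (enn2real (f x)) \<partial>M) = (\<integral>\<^sup>+x. f x \<partial>M)"
proof -
  have "AE x in M. f x \<noteq> \<infinity>"
    using assms by (intro nn_integral_PInf_AE) auto
  then show ?thesis
    by (intro nn_integral_cong_AE) (auto simp: less_top elim!: eventually_mono)
qed

definition locally_finite_mass :: "real measure \<Rightarrow> bool" where
  "locally_finite_mass \<rho> \<longleftrightarrow> sets \<rho> = sets (restrict_space borel {0..}) \<and>
     (\<forall>B\<in>relcompact_borel {0..}. emeasure \<rho> B < \<infinity>)"

lemma Omega_measurable [measurable]:
  assumes [measurable]: "\<Gamma> \<in> sets borel"
  shows "(\<lambda>m. Omega 1 m \<Gamma>) \<in> borel_measurable borel" "(\<lambda>m. Omega (- 1) m \<Gamma>) \<in> borel_measurable borel"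
    "(\<lambda>m. Omega_im m \<Gamma>) \<in> borel_measurable borel"
  by (simp_all add: Omega_eq_shell_measure Omega_im_def Omega_im_half_eq_shell_measure)

lemma Omega_nonneg:
  assumes [measurable]: "\<Gamma> \<in> sets borel"
  shows "0 \<le> Omega 1 m \<Gamma>" "0 \<le> Omega (- 1) m \<Gamma>" "0 \<le> Omega_im m \<Gamma>"
  by (simp_all add: Omega_eq_shell_measure Omega_im_def Omega_im_half_eq_shell_measure)

text \<open>Finiteness of \<open>M\<close> on the bounded set makes every term of the extended
  decomposition finite, so the shell measures are finite for almost all masses and passing to real
  values loses nothing.\<close>

lemma (in lorentz_invariant_measure) decomposition:
  obtains c \<rho>1 \<rho>2 \<rho>3 where "locally_finite_mass \<rho>1" "locally_finite_mass \<rho>2" "locally_finite_mass \<rho>3"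
    and "\<And>\<Gamma>. \<Gamma> \<in> relcompact_borel UNIV \<Longrightarrow>
      (\<integral>\<^sup>+m. ennreal (Omega 1 m \<Gamma>) \<partial>\<rho>1) < \<infinity> \<and> (\<integral>\<^sup>+m. ennreal (Omega (- 1) m \<Gamma>) \<partial>\<rho>2) < \<infinity> \<and>
      (\<integral>\<^sup>+m. ennreal (Omega_im m \<Gamma>) \<partial>\<rho>3) < \<infinity> \<and>
      measure M \<Gamma> = c * indicator \<Gamma> 0 + (\<integral>m. Omega 1 m \<Gamma> \<partial>\<rho>1) + (\<integral>m. Omega (- 1) m \<Gamma> \<partial>\<rho>2)
        + (\<integral>m. Omega_im m \<Gamma> \<partial>\<rho>3)"
proof -
  let ?\<rho>1 = "mass_distribution (timelike_weight 1)" and ?\<rho>2 = "mass_distribution (timelike_weight (- 1))"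
    and ?\<rho>3 = "mass_distribution (spacelike_weight 1)"
  have meas: "f \<in> borel_measurable (mass_distribution w)" if "f \<in> borel_measurable borel" for w and f :: "real \<Rightarrow> 'b::topological_space"
    using measurable_restrict_space1[OF that] measurable_cong_sets[OF sets_mass_distribution refl] by blast
  have "(\<integral>\<^sup>+m. ennreal (Omega 1 m \<Gamma>) \<partial>?\<rho>1) < \<infinity> \<and> (\<integral>\<^sup>+m. ennreal (Omega (- 1) m \<Gamma>) \<partial>?\<rho>2) < \<infinity> \<and>
      (\<integral>\<^sup>+m. ennreal (Omega_im m \<Gamma>) \<partial>?\<rho>3) < \<infinity> \<and>
      measure M \<Gamma> = measure M {0} * indicator \<Gamma> 0 + (\<integral>m. Omega 1 m \<Gamma> \<partial>?\<rho>1) + (\<integral>m. Omega (- 1) m \<Gamma> \<partial>?\<rho>2)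
        + (\<integral>m. Omega_im m \<Gamma> \<partial>?\<rho>3)" if \<Gamma>: "\<Gamma> \<in> relcompact_borel UNIV" for \<Gamma>
  proof -
    have [measurable]: "\<Gamma> \<in> sets borel" and "bounded \<Gamma>"
      using \<Gamma> by (auto simp: relcompact_borel_UNIV_iff)
    then have fin: "emeasure M \<Gamma> < \<infinity>"
      by (rule finite_bounded)
    have fin0: "emeasure M {0} < \<infinity>"
      by (rule finite_bounded) auto
    let ?S1 = "\<lambda>m. shell_measure 1 (m\<^sup>2) \<Gamma>" and ?S2 = "\<lambda>m. shell_measure (- 1) (m\<^sup>2) \<Gamma>"
    let ?S3 = "\<lambda>m. shell_measure 1 (- m\<^sup>2) \<Gamma> + shell_measure (- 1) (- m\<^sup>2) \<Gamma>"
    have S: "(\<integral>\<^sup>+m. ?S1 m \<partial>?\<rho>1) < \<infinity>" "(\<integral>\<^sup>+m. ?S2 m \<partial>?\<rho>2) < \<infinity>" "(\<integral>\<^sup>+m. ?S3 m \<partial>?\<rho>3) < \<infinity>"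
      using fin unfolding emeasure_decomposition[OF \<open>\<Gamma> \<in> sets borel\<close>] by (auto simp: less_top)
    have [measurable]: "?S1 \<in> borel_measurable ?\<rho>1" "?S2 \<in> borel_measurable ?\<rho>2" "?S3 \<in> borel_measurable ?\<rho>3"
      by (intro meas; measurable)+
    \<comment> \<open>\<open>Omega_im\<close> adds two separately converted values, and
      \<open>enn2real\<close> is additive when both are finite.\<close>
    have "AE m in ?\<rho>3. ?S3 m \<noteq> \<infinity>"
      using S(3) by (intro nn_integral_PInf_AE) auto
    then have "AE m in ?\<rho>3. ennreal (Omega_im m \<Gamma>) = ?S3 m"
    proof eventually_elim
      case (elim m)
      then have "shell_measure 1 (- m\<^sup>2) \<Gamma> < top" "shell_measure (- 1) (- m\<^sup>2) \<Gamma> < top"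
        by (auto simp: less_top)
      then show ?case
        by (simp add: Omega_im_def Omega_im_half_eq_shell_measure ennreal_plus)
    qed
    then have O3: "(\<integral>\<^sup>+m. ennreal (Omega_im m \<Gamma>) \<partial>?\<rho>3) = (\<integral>\<^sup>+m. ?S3 m \<partial>?\<rho>3)"
      by (rule nn_integral_cong_AE)
    have O12: "(\<integral>\<^sup>+m. ennreal (Omega 1 m \<Gamma>) \<partial>?\<rho>1) = (\<integral>\<^sup>+m. ?S1 m \<partial>?\<rho>1)"
      "(\<integral>\<^sup>+m. ennreal (Omega (- 1) m \<Gamma>) \<partial>?\<rho>2) = (\<integral>\<^sup>+m. ?S2 m \<partial>?\<rho>2)"
      using nn_integral_enn2real[OF _ S(1)] nn_integral_enn2real[OF _ S(2)]
      by (simp_all add: Omega_eq_shell_measure)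
    have int: "ennreal (\<integral>m. f m \<partial>mass_distribution w) = (\<integral>\<^sup>+m. ennreal (f m) \<partial>mass_distribution w)"
      if [measurable]: "f \<in> borel_measurable borel" and f: "\<And>m. 0 \<le> f m"
        and "(\<integral>\<^sup>+m. ennreal (f m) \<partial>mass_distribution w) < \<infinity>" for f w
      using that meas[OF that(1)] by (subst integral_eq_nn_integral) (auto simp: less_top)
    note nn = Omega_nonneg[OF \<open>\<Gamma> \<in> sets borel\<close>] and om = Omega_measurable[OF \<open>\<Gamma> \<in> sets borel\<close>]
    note S' = S[folded O12 O3]
    have "ennreal (measure M \<Gamma>) = ennreal (measure M {0} * indicator \<Gamma> 0 + (\<integral>m. Omega 1 m \<Gamma> \<partial>?\<rho>1)
       + (\<integral>m. Omega (- 1) m \<Gamma> \<partial>?\<rho>2) + (\<integral>m. Omega_im m \<Gamma> \<partial>?\<rho>3))"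
      using emeasure_decomposition[OF \<open>\<Gamma> \<in> sets borel\<close>] nn
      unfolding O12[symmetric] O3[symmetric] emeasure_eq_measure_finite[OF fin] emeasure_eq_measure_finite[OF fin0]
        int[OF om(1) nn(1) S'(1), symmetric] int[OF om(2) nn(2) S'(2), symmetric]
        int[OF om(3) nn(3) S'(3), symmetric]
      by (simp add: ennreal_mult ennreal_indicator)
    then have "measure M \<Gamma> = measure M {0} * indicator \<Gamma> 0 + (\<integral>m. Omega 1 m \<Gamma> \<partial>?\<rho>1)
       + (\<integral>m. Omega (- 1) m \<Gamma> \<partial>?\<rho>2) + (\<integral>m. Omega_im m \<Gamma> \<partial>?\<rho>3)"
      using nn by (subst (asm) ennreal_inj) auto
    then show ?thesis
      using S' by blast
  qed
  moreover have "locally_finite_mass ?\<rho>1" "locally_finite_mass ?\<rho>2" "locally_finite_mass ?\<rho>3"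
    unfolding locally_finite_mass_def
    using mass_distribution_finite[OF weight_measurable(1) weight_le(1)]
      mass_distribution_finite[OF weight_measurable(2) weight_le(2)]
    by auto
  ultimately show ?thesis
    using that by blast
qed

section \<open>Complex measures\<close>

lemma lorentz_image_relcompact:
  assumes \<Lambda>: "\<Lambda> \<in> proper_orthochronous_lorentz"
  shows "A \<in> relcompact_borel UNIV \<Longrightarrow> (*v) \<Lambda> ` A \<in> relcompact_borel UNIV"
    and "B \<in> relcompact_borel UNIV \<Longrightarrow> \<exists>A\<in>relcompact_borel UNIV. (*v) \<Lambda> ` A = B"
proof -
  have "invertible \<Lambda>"
    using \<Lambda> by (simp add: invertible_det_nz proper_orthochronous_lorentz_def)
  then obtain \<Lambda>' where inv: "\<Lambda> ** \<Lambda>' = mat 1" "\<Lambda>' ** \<Lambda> = mat 1"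
    by (auto simp: invertible_def)
  have vinv: "\<Lambda> *v (\<Lambda>' *v p) = p" "\<Lambda>' *v (\<Lambda> *v p) = p" for p
    using inv by (simp_all add: matrix_vector_mul_assoc)
  have image: "(*v) L ` A \<in> relcompact_borel UNIV"
    if A: "A \<in> relcompact_borel UNIV" and L: "\<And>p. L *v (L' *v p) = p" "\<And>p. L' *v (L *v p) = p"
    for L L' :: "real^4^4" and A
  proof -
    have "(*v) L ` A = (*v) L' -` A"
      using L by (auto simp: image_iff) metis
    moreover have "(*v) L' \<in> borel_measurable borel"
      by (intro borel_measurable_continuous_onI linear_continuous_on matrix_vector_mul_bounded_linear)
    ultimately have "(*v) L ` A \<in> sets borel"
      using A measurable_sets_borel[of "(*v) L'" borel A] by (simp add: relcompact_borel_UNIV_iff)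
    moreover have "bounded ((*v) L ` A)"
      using A by (intro bounded_linear_image matrix_vector_mul_bounded_linear) (simp add: relcompact_borel_UNIV_iff)
    ultimately show ?thesis
      by (simp add: relcompact_borel_UNIV_iff)
  qed
  show "(*v) \<Lambda> ` A \<in> relcompact_borel UNIV" if "A \<in> relcompact_borel UNIV"
    using that by (rule image) (rule vinv)+
  show "\<exists>A\<in>relcompact_borel UNIV. (*v) \<Lambda> ` A = B" if "B \<in> relcompact_borel UNIV"
  proof
    show "(*v) \<Lambda>' ` B \<in> relcompact_borel UNIV"
      using that by (rule image) (rule vinv)+
    show "(*v) \<Lambda> ` (*v) \<Lambda>' ` B = B"
      by (simp add: image_image vinv)
  qed
qed

text \<open>\<open>\<Lambda>\<close> permutes the relatively compact Borel sets and preserves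
  \<open>\<nu>\<close> on them, so the suprema for a set and for its image run over the same
  values.\<close>

lemma lorentz_invariant_pos_variation:
  fixes \<nu> :: "(real^4) set \<Rightarrow> real"
  assumes "signed_borel UNIV \<nu>"
    and inv: "\<And>\<Lambda> A. \<Lambda> \<in> proper_orthochronous_lorentz \<Longrightarrow> A \<in> relcompact_borel UNIV \<Longrightarrow> \<nu> ((*v) \<Lambda> ` A) = \<nu> A"
  shows "lorentz_invariant_measure (pos_variation UNIV \<nu>)"
proof -
  interpret signed_borel UNIV \<nu> by fact
  show ?thesis
  proof
    show sets: "sets (pos_variation UNIV \<nu>) = sets borel"
      by simp
    fix A :: "(real^4) set" assume A: "A \<in> sets borel"
    show "emeasure (pos_variation UNIV \<nu>) A < \<infinity>" if "bounded A"
      using upper_variation_finite[of A] A that by (simp add: emeasure_pos_variation relcompact_borel_UNIV_iff)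
    fix \<Lambda> :: "real^4^4" assume \<Lambda>: "\<Lambda> \<in> proper_orthochronous_lorentz"
    have inj: "inj ((*v) \<Lambda>)"
      using \<Lambda> by (simp add: invertible_det_nz[symmetric] proper_orthochronous_lorentz_def inj_matrix_vector_mult invertible_det_nz)
    have \<Lambda>A: "(*v) \<Lambda> ` A \<in> sets borel"
    proof -
      \<comment> \<open>\<open>A\<close> may be unbounded; its image is Borel as a countable union
        of images of bounded pieces.\<close>
      have "A = (\<Union>n. A \<inter> ball 0 (real n))"
        by (auto intro: reals_Archimedean2)
      then have "(*v) \<Lambda> ` A = (\<Union>n. (*v) \<Lambda> ` (A \<inter> ball 0 (real n)))"
        by (metis image_UN)
      moreover have "(*v) \<Lambda> ` (A \<inter> ball 0 (real n)) \<in> sets borel" for n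
        using lorentz_image_relcompact(1)[OF \<Lambda>, of "A \<inter> ball 0 (real n)"] A
        by (simp add: relcompact_borel_UNIV_iff bounded_Int)
      ultimately show ?thesis
        by auto
    qed
    have "upper_variation ((*v) \<Lambda> ` A) = upper_variation A"
      unfolding upper_variation_def
    proof (rule SUP_eq)
      fix B assume "B \<in> {B \<in> relcompact_borel UNIV. B \<subseteq> (*v) \<Lambda> ` A}"
      then have B: "B \<in> relcompact_borel UNIV" "B \<subseteq> (*v) \<Lambda> ` A"
        by auto
      obtain C where C: "C \<in> relcompact_borel UNIV" "(*v) \<Lambda> ` C = B"
        using lorentz_image_relcompact(2)[OF \<Lambda> B(1)] by blast
      then have "C \<subseteq> A"
        using B(2) inj by (auto simp: inj_image_subset_iff)
      then show "\<exists>C\<in>{C \<in> relcompact_borel UNIV. C \<subseteq> A}. ennreal (\<nu> B) \<le> ennreal (\<nu> C)"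
        using C inv[OF \<Lambda> C(1)] by auto
    next
      fix B assume "B \<in> {B \<in> relcompact_borel UNIV. B \<subseteq> A}"
      then show "\<exists>C\<in>{C \<in> relcompact_borel UNIV. C \<subseteq> (*v) \<Lambda> ` A}. ennreal (\<nu> B) \<le> ennreal (\<nu> C)"
        using lorentz_image_relcompact(1)[OF \<Lambda>, of B] inv[OF \<Lambda>, of B]
        by (intro bexI[of _ "(*v) \<Lambda> ` B"]) auto
    qed
    then show "emeasure (pos_variation UNIV \<nu>) ((*v) \<Lambda> ` A) = emeasure (pos_variation UNIV \<nu>) A"
      using A \<Lambda>A by (simp add: emeasure_pos_variation)
  qed
qed

lemma locally_finite_mass_difference:
  assumes "locally_finite_mass \<rho>a" "locally_finite_mass \<rho>b"
  defines "\<tau> \<equiv> \<lambda>B. measure \<rho>a B - measure \<rho>b B"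
  shows "signed_borel {0..} \<tau>"
    and "f \<in> borel_measurable borel \<Longrightarrow> (\<And>x. 0 \<le> f x) \<Longrightarrow>
      (\<integral>\<^sup>+x. ennreal (f x) \<partial>\<rho>a) < \<infinity> \<Longrightarrow> (\<integral>\<^sup>+x. ennreal (f x) \<partial>\<rho>b) < \<infinity> \<Longrightarrow>
      integrable (pos_variation {0..} \<tau>) f \<and> integrable (neg_variation {0..} \<tau>) f \<and>
      integral\<^sup>L (pos_variation {0..} \<tau>) f - integral\<^sup>L (neg_variation {0..} \<tau>) f
        = integral\<^sup>L \<rho>a f - integral\<^sup>L \<rho>b f"
proof -
  have S: "{0::real..} \<in> sets borel"
    by simp
  have K: "{0..real n} \<in> relcompact_borel {0..}" for n
  proof -
    have "{0..} \<inter> {0..real n} = {0..real n}"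
      by auto
    then show ?thesis
      by (auto simp: relcompact_borel_iff)
  qed
  have inc: "incseq (\<lambda>n. {0..real n})"
    by (auto simp: incseq_def)
  have UN: "(\<Union>n. {0..real n}) = {0..}"
    by (auto intro: real_arch_simple)
  note difference = relcompact_borel_measure_difference[OF S K inc UN, of \<rho>a \<rho>b]
  show "signed_borel {0..} \<tau>"
    unfolding \<tau>_def using assms(1,2) by (intro difference(1)) (auto simp: locally_finite_mass_def)
  assume "f \<in> borel_measurable borel" "\<And>x. 0 \<le> f x" "(\<integral>\<^sup>+x. ennreal (f x) \<partial>\<rho>a) < \<infinity>" "(\<integral>\<^sup>+x. ennreal (f x) \<partial>\<rho>b) < \<infinity>"
  then show "integrable (pos_variation {0..} \<tau>) f \<and> integrable (neg_variation {0..} \<tau>) f \<and>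
      integral\<^sup>L (pos_variation {0..} \<tau>) f - integral\<^sup>L (neg_variation {0..} \<tau>) f
        = integral\<^sup>L \<rho>a f - integral\<^sup>L \<rho>b f"
    unfolding \<tau>_def using assms(1,2)
    by (intro difference(2)) (auto simp: locally_finite_mass_def measurable_restrict_space1)
qed

text \<open>The decompositions of the two variations are subtracted, and
  \<open>locally_finite_mass_difference\<close> rewrites the result in terms of the Jordan
  decomposition of each difference.\<close>

lemma real_decomposition:
  fixes \<nu> :: "(real^4) set \<Rightarrow> real"
  assumes \<nu>: "signed_borel UNIV \<nu>"
    and inv: "\<And>\<Lambda> A. \<Lambda> \<in> proper_orthochronous_lorentz \<Longrightarrow> A \<in> relcompact_borel UNIV \<Longrightarrow> \<nu> ((*v) \<Lambda> ` A) = \<nu> A"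
  obtains c \<tau>1 \<tau>2 \<tau>3 where "signed_borel {0..} \<tau>1" "signed_borel {0..} \<tau>2" "signed_borel {0..} \<tau>3"
    and "\<And>\<Gamma>. \<Gamma> \<in> relcompact_borel UNIV \<Longrightarrow>
      integrable (pos_variation {0..} \<tau>1) (\<lambda>m. Omega 1 m \<Gamma>) \<and>
      integrable (neg_variation {0..} \<tau>1) (\<lambda>m. Omega 1 m \<Gamma>) \<and>
      integrable (pos_variation {0..} \<tau>2) (\<lambda>m. Omega (- 1) m \<Gamma>) \<and>
      integrable (neg_variation {0..} \<tau>2) (\<lambda>m. Omega (- 1) m \<Gamma>) \<and>
      integrable (pos_variation {0..} \<tau>3) (\<lambda>m. Omega_im m \<Gamma>) \<and>
      integrable (neg_variation {0..} \<tau>3) (\<lambda>m. Omega_im m \<Gamma>) \<and>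
      \<nu> \<Gamma> = c * indicator \<Gamma> 0
        + ((\<integral>m. Omega 1 m \<Gamma> \<partial>pos_variation {0..} \<tau>1) - (\<integral>m. Omega 1 m \<Gamma> \<partial>neg_variation {0..} \<tau>1))
        + ((\<integral>m. Omega (- 1) m \<Gamma> \<partial>pos_variation {0..} \<tau>2) - (\<integral>m. Omega (- 1) m \<Gamma> \<partial>neg_variation {0..} \<tau>2))
        + ((\<integral>m. Omega_im m \<Gamma> \<partial>pos_variation {0..} \<tau>3) - (\<integral>m. Omega_im m \<Gamma> \<partial>neg_variation {0..} \<tau>3))"
proof -
  interpret signed_borel UNIV \<nu> by fact
  interpret P: lorentz_invariant_measure "pos_variation UNIV \<nu>"
    using \<nu> inv by (rule lorentz_invariant_pos_variation)
  interpret N: lorentz_invariant_measure "neg_variation UNIV \<nu>"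
    unfolding neg_variation_def
    by (intro lorentz_invariant_pos_variation signed_borel_uminus \<nu>) (simp add: inv)
  obtain ca \<rho>1a \<rho>2a \<rho>3a where a: "locally_finite_mass \<rho>1a" "locally_finite_mass \<rho>2a" "locally_finite_mass \<rho>3a"
    "\<And>\<Gamma>. \<Gamma> \<in> relcompact_borel UNIV \<Longrightarrow>
      (\<integral>\<^sup>+m. ennreal (Omega 1 m \<Gamma>) \<partial>\<rho>1a) < \<infinity> \<and> (\<integral>\<^sup>+m. ennreal (Omega (- 1) m \<Gamma>) \<partial>\<rho>2a) < \<infinity> \<and>
      (\<integral>\<^sup>+m. ennreal (Omega_im m \<Gamma>) \<partial>\<rho>3a) < \<infinity> \<and>
      measure (pos_variation UNIV \<nu>) \<Gamma> = ca * indicator \<Gamma> 0 + (\<integral>m. Omega 1 m \<Gamma> \<partial>\<rho>1a) + (\<integral>m. Omega (- 1) m \<Gamma> \<partial>\<rho>2a)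
        + (\<integral>m. Omega_im m \<Gamma> \<partial>\<rho>3a)"
    by (rule P.decomposition, rule that)
  obtain cb \<rho>1b \<rho>2b \<rho>3b where b: "locally_finite_mass \<rho>1b" "locally_finite_mass \<rho>2b" "locally_finite_mass \<rho>3b"
    "\<And>\<Gamma>. \<Gamma> \<in> relcompact_borel UNIV \<Longrightarrow>
      (\<integral>\<^sup>+m. ennreal (Omega 1 m \<Gamma>) \<partial>\<rho>1b) < \<infinity> \<and> (\<integral>\<^sup>+m. ennreal (Omega (- 1) m \<Gamma>) \<partial>\<rho>2b) < \<infinity> \<and>
      (\<integral>\<^sup>+m. ennreal (Omega_im m \<Gamma>) \<partial>\<rho>3b) < \<infinity> \<and>
      measure (neg_variation UNIV \<nu>) \<Gamma> = cb * indicator \<Gamma> 0 + (\<integral>m. Omega 1 m \<Gamma> \<partial>\<rho>1b) + (\<integral>m. Omega (- 1) m \<Gamma> \<partial>\<rho>2b)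
        + (\<integral>m. Omega_im m \<Gamma> \<partial>\<rho>3b)"
    by (rule N.decomposition, rule that)
  let ?\<tau>1 = "\<lambda>B. measure \<rho>1a B - measure \<rho>1b B" and ?\<tau>2 = "\<lambda>B. measure \<rho>2a B - measure \<rho>2b B"
    and ?\<tau>3 = "\<lambda>B. measure \<rho>3a B - measure \<rho>3b B"
  show ?thesis
  proof (rule that)
    show "signed_borel {0..} ?\<tau>1" "signed_borel {0..} ?\<tau>2" "signed_borel {0..} ?\<tau>3"
      using a(1-3) b(1-3) by (auto intro: locally_finite_mass_difference(1))
    fix \<Gamma> :: "(real^4) set" assume \<Gamma>: "\<Gamma> \<in> relcompact_borel UNIV"
    then have "\<Gamma> \<in> sets borel"
      by (simp add: relcompact_borel_UNIV_iff)
    note om = Omega_measurable[OF this] and nn = Omega_nonneg[OF this]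
    have d: "integrable (pos_variation {0..} ?\<tau>1) (\<lambda>m. Omega 1 m \<Gamma>) \<and> integrable (neg_variation {0..} ?\<tau>1) (\<lambda>m. Omega 1 m \<Gamma>) \<and>
        (\<integral>m. Omega 1 m \<Gamma> \<partial>pos_variation {0..} ?\<tau>1) - (\<integral>m. Omega 1 m \<Gamma> \<partial>neg_variation {0..} ?\<tau>1)
        = (\<integral>m. Omega 1 m \<Gamma> \<partial>\<rho>1a) - (\<integral>m. Omega 1 m \<Gamma> \<partial>\<rho>1b)"
      "integrable (pos_variation {0..} ?\<tau>2) (\<lambda>m. Omega (- 1) m \<Gamma>) \<and> integrable (neg_variation {0..} ?\<tau>2) (\<lambda>m. Omega (- 1) m \<Gamma>) \<and>
        (\<integral>m. Omega (- 1) m \<Gamma> \<partial>pos_variation {0..} ?\<tau>2) - (\<integral>m. Omega (- 1) m \<Gamma> \<partial>neg_variation {0..} ?\<tau>2)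
        = (\<integral>m. Omega (- 1) m \<Gamma> \<partial>\<rho>2a) - (\<integral>m. Omega (- 1) m \<Gamma> \<partial>\<rho>2b)"
      "integrable (pos_variation {0..} ?\<tau>3) (\<lambda>m. Omega_im m \<Gamma>) \<and> integrable (neg_variation {0..} ?\<tau>3) (\<lambda>m. Omega_im m \<Gamma>) \<and>
        (\<integral>m. Omega_im m \<Gamma> \<partial>pos_variation {0..} ?\<tau>3) - (\<integral>m. Omega_im m \<Gamma> \<partial>neg_variation {0..} ?\<tau>3)
        = (\<integral>m. Omega_im m \<Gamma> \<partial>\<rho>3a) - (\<integral>m. Omega_im m \<Gamma> \<partial>\<rho>3b)"
      using a(4)[OF \<Gamma>] b(4)[OF \<Gamma>]
      by (intro locally_finite_mass_difference(2) a b om nn; blast)+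
    have "\<nu> \<Gamma> = measure (pos_variation UNIV \<nu>) \<Gamma> - measure (neg_variation UNIV \<nu>) \<Gamma>"
      using measure_pos_minus_neg[OF \<Gamma>] by simp
    also have "\<dots> = (ca - cb) * indicator \<Gamma> 0
        + ((\<integral>m. Omega 1 m \<Gamma> \<partial>\<rho>1a) - (\<integral>m. Omega 1 m \<Gamma> \<partial>\<rho>1b))
        + ((\<integral>m. Omega (- 1) m \<Gamma> \<partial>\<rho>2a) - (\<integral>m. Omega (- 1) m \<Gamma> \<partial>\<rho>2b))
        + ((\<integral>m. Omega_im m \<Gamma> \<partial>\<rho>3a) - (\<integral>m. Omega_im m \<Gamma> \<partial>\<rho>3b))"
      using a(4)[OF \<Gamma>] b(4)[OF \<Gamma>] by (simp add: left_diff_distrib)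
    finally have "\<nu> \<Gamma> = (ca - cb) * indicator \<Gamma> 0
        + ((\<integral>m. Omega 1 m \<Gamma> \<partial>\<rho>1a) - (\<integral>m. Omega 1 m \<Gamma> \<partial>\<rho>1b))
        + ((\<integral>m. Omega (- 1) m \<Gamma> \<partial>\<rho>2a) - (\<integral>m. Omega (- 1) m \<Gamma> \<partial>\<rho>2b))
        + ((\<integral>m. Omega_im m \<Gamma> \<partial>\<rho>3a) - (\<integral>m. Omega_im m \<Gamma> \<partial>\<rho>3b))" .
    with d show "integrable (pos_variation {0..} ?\<tau>1) (\<lambda>m. Omega 1 m \<Gamma>) \<and>
      integrable (neg_variation {0..} ?\<tau>1) (\<lambda>m. Omega 1 m \<Gamma>) \<and>
      integrable (pos_variation {0..} ?\<tau>2) (\<lambda>m. Omega (- 1) m \<Gamma>) \<and>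
      integrable (neg_variation {0..} ?\<tau>2) (\<lambda>m. Omega (- 1) m \<Gamma>) \<and>
      integrable (pos_variation {0..} ?\<tau>3) (\<lambda>m. Omega_im m \<Gamma>) \<and>
      integrable (neg_variation {0..} ?\<tau>3) (\<lambda>m. Omega_im m \<Gamma>) \<and>
      \<nu> \<Gamma> = (ca - cb) * indicator \<Gamma> 0
        + ((\<integral>m. Omega 1 m \<Gamma> \<partial>pos_variation {0..} ?\<tau>1) - (\<integral>m. Omega 1 m \<Gamma> \<partial>neg_variation {0..} ?\<tau>1))
        + ((\<integral>m. Omega (- 1) m \<Gamma> \<partial>pos_variation {0..} ?\<tau>2) - (\<integral>m. Omega (- 1) m \<Gamma> \<partial>neg_variation {0..} ?\<tau>2))
        + ((\<integral>m. Omega_im m \<Gamma> \<partial>pos_variation {0..} ?\<tau>3) - (\<integral>m. Omega_im m \<Gamma> \<partial>neg_variation {0..} ?\<tau>3))"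
      by presburger
  qed
qed

lemma borel_complex_measure_Complex:
  fixes \<tau> \<tau>' :: "real set \<Rightarrow> real"
  assumes "signed_borel {0..} \<tau>" "signed_borel {0..} \<tau>'"
  shows "borel_complex_measure {0..} (\<lambda>B. Complex (\<tau> B) (\<tau>' B))"
  unfolding borel_complex_measure_def complex_measure_def
proof (intro ballI allI impI)
  fix C :: "real set" and A :: "nat \<Rightarrow> real set"
  assume C: "C \<in> relcompact_borel {0..}" and A: "range A \<subseteq> sets (restrict_space borel C)" "disjoint_family A"
  have "A i \<in> sets borel \<and> A i \<subseteq> C" for i
    using subsetD[OF A(1) rangeI, of i] relcompact_borel_atLeast0D(1)[OF C] by (simp add: sets_restrict_space_iff)
  then have "(\<lambda>i. \<tau> (A i)) sums \<tau> (\<Union>i. A i)" "(\<lambda>i. \<tau>' (A i)) sums \<tau>' (\<Union>i. A i)"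
    using A(2) C by (auto intro!: signed_borel.countably_additive[OF assms(1)] signed_borel.countably_additive[OF assms(2)])
  then show "(\<lambda>i. Complex (\<tau> (A i)) (\<tau>' (A i))) sums Complex (\<tau> (\<Union>i. A i)) (\<tau>' (\<Union>i. A i))"
    by (simp add: sums_complex_iff)
qed

lemma signed_borel_Re_Im:
  fixes \<mu> :: "'a::topological_space set \<Rightarrow> complex"
  assumes "borel_complex_measure UNIV \<mu>"
  shows "signed_borel UNIV (\<lambda>A. Re (\<mu> A))" "signed_borel UNIV (\<lambda>A. Im (\<mu> A))"
proof -
  have *: "(\<lambda>i. \<mu> (A i)) sums \<mu> (\<Union>i. A i)"
    if "C \<in> relcompact_borel UNIV" "\<And>i. A i \<in> sets borel" "disjoint_family A" "(\<Union>i. A i) \<subseteq> C"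
    for C and A :: "nat \<Rightarrow> 'a set"
    using assms that
    by (intro complex_measure_restrict_borelD[of C]) (auto simp: borel_complex_measure_def relcompact_borel_iff)
  show "signed_borel UNIV (\<lambda>A. Re (\<mu> A))" "signed_borel UNIV (\<lambda>A. Im (\<mu> A))"
    by (unfold_locales; use * in \<open>auto intro: sums_Re sums_Im\<close>)+
qed

theorem theorem1:
  fixes \<mu> :: "(real^4) set \<Rightarrow> complex"
  assumes "borel_complex_measure UNIV \<mu>"
    and "lorentz_invariant \<mu>"
  shows "\<exists>(c::complex) (\<sigma>1::real set \<Rightarrow> complex) (\<sigma>2::real set \<Rightarrow> complex) (\<sigma>3::real set \<Rightarrow> complex).
    borel_complex_measure {0..} \<sigma>1 \<and>
    borel_complex_measure {0..} \<sigma>2 \<and>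
    borel_complex_measure {0..} \<sigma>3 \<and>
    (\<forall>\<Gamma>\<in>relcompact_borel (UNIV :: (real^4) set).
       cm_integrable {0..} \<sigma>1 (\<lambda>m. Omega 1 m \<Gamma>) \<and>
       cm_integrable {0..} \<sigma>2 (\<lambda>m. Omega (-1) m \<Gamma>) \<and>
       cm_integrable {0..} \<sigma>3 (\<lambda>m. Omega_im m \<Gamma>) \<and>
       \<mu> \<Gamma> = c * indicator \<Gamma> 0
            + cm_integral {0..} \<sigma>1 (\<lambda>m. Omega 1 m \<Gamma>)
            + cm_integral {0..} \<sigma>2 (\<lambda>m. Omega (-1) m \<Gamma>)
            + cm_integral {0..} \<sigma>3 (\<lambda>m. Omega_im m \<Gamma>))"
proof -
  have inv: "\<mu> ((*v) \<Lambda> ` A) = \<mu> A" if "\<Lambda> \<in> proper_orthochronous_lorentz" "A \<in> relcompact_borel UNIV" for \<Lambda> A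
    using assms(2) that by (simp add: lorentz_invariant_def)
  have Re_inv: "Re (\<mu> ((*v) \<Lambda> ` A)) = Re (\<mu> A)" if "\<Lambda> \<in> proper_orthochronous_lorentz" "A \<in> relcompact_borel UNIV" for \<Lambda> A
    using inv[OF that] by simp
  obtain c \<tau>1 \<tau>2 \<tau>3 where re: "signed_borel {0..} \<tau>1" "signed_borel {0..} \<tau>2" "signed_borel {0..} \<tau>3"
    "\<And>\<Gamma>. \<Gamma> \<in> relcompact_borel UNIV \<Longrightarrow>
      integrable (pos_variation {0..} \<tau>1) (\<lambda>m. Omega 1 m \<Gamma>) \<and>
      integrable (neg_variation {0..} \<tau>1) (\<lambda>m. Omega 1 m \<Gamma>) \<and>
      integrable (pos_variation {0..} \<tau>2) (\<lambda>m. Omega (- 1) m \<Gamma>) \<and>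
      integrable (neg_variation {0..} \<tau>2) (\<lambda>m. Omega (- 1) m \<Gamma>) \<and>
      integrable (pos_variation {0..} \<tau>3) (\<lambda>m. Omega_im m \<Gamma>) \<and>
      integrable (neg_variation {0..} \<tau>3) (\<lambda>m. Omega_im m \<Gamma>) \<and>
      Re (\<mu> \<Gamma>) = c * indicator \<Gamma> 0
        + ((\<integral>m. Omega 1 m \<Gamma> \<partial>pos_variation {0..} \<tau>1) - (\<integral>m. Omega 1 m \<Gamma> \<partial>neg_variation {0..} \<tau>1))
        + ((\<integral>m. Omega (- 1) m \<Gamma> \<partial>pos_variation {0..} \<tau>2) - (\<integral>m. Omega (- 1) m \<Gamma> \<partial>neg_variation {0..} \<tau>2))
        + ((\<integral>m. Omega_im m \<Gamma> \<partial>pos_variation {0..} \<tau>3) - (\<integral>m. Omega_im m \<Gamma> \<partial>neg_variation {0..} \<tau>3))"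
    by (rule real_decomposition[OF signed_borel_Re_Im(1)[OF assms(1)] Re_inv], assumption, assumption, rule that)
  have Im_inv: "Im (\<mu> ((*v) \<Lambda> ` A)) = Im (\<mu> A)" if "\<Lambda> \<in> proper_orthochronous_lorentz" "A \<in> relcompact_borel UNIV" for \<Lambda> A
    using inv[OF that] by simp
  obtain c' \<tau>1' \<tau>2' \<tau>3' where im: "signed_borel {0..} \<tau>1'" "signed_borel {0..} \<tau>2'" "signed_borel {0..} \<tau>3'"
    "\<And>\<Gamma>. \<Gamma> \<in> relcompact_borel UNIV \<Longrightarrow>
      integrable (pos_variation {0..} \<tau>1') (\<lambda>m. Omega 1 m \<Gamma>) \<and>
      integrable (neg_variation {0..} \<tau>1') (\<lambda>m. Omega 1 m \<Gamma>) \<and>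
      integrable (pos_variation {0..} \<tau>2') (\<lambda>m. Omega (- 1) m \<Gamma>) \<and>
      integrable (neg_variation {0..} \<tau>2') (\<lambda>m. Omega (- 1) m \<Gamma>) \<and>
      integrable (pos_variation {0..} \<tau>3') (\<lambda>m. Omega_im m \<Gamma>) \<and>
      integrable (neg_variation {0..} \<tau>3') (\<lambda>m. Omega_im m \<Gamma>) \<and>
      Im (\<mu> \<Gamma>) = c' * indicator \<Gamma> 0
        + ((\<integral>m. Omega 1 m \<Gamma> \<partial>pos_variation {0..} \<tau>1') - (\<integral>m. Omega 1 m \<Gamma> \<partial>neg_variation {0..} \<tau>1'))
        + ((\<integral>m. Omega (- 1) m \<Gamma> \<partial>pos_variation {0..} \<tau>2') - (\<integral>m. Omega (- 1) m \<Gamma> \<partial>neg_variation {0..} \<tau>2'))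
        + ((\<integral>m. Omega_im m \<Gamma> \<partial>pos_variation {0..} \<tau>3') - (\<integral>m. Omega_im m \<Gamma> \<partial>neg_variation {0..} \<tau>3'))"
    by (rule real_decomposition[OF signed_borel_Re_Im(2)[OF assms(1)] Im_inv], assumption, assumption, rule that)
  let ?\<sigma>1 = "\<lambda>B. Complex (\<tau>1 B) (\<tau>1' B)" and ?\<sigma>2 = "\<lambda>B. Complex (\<tau>2 B) (\<tau>2' B)" and ?\<sigma>3 = "\<lambda>B. Complex (\<tau>3 B) (\<tau>3' B)"
  show ?thesis
  proof (rule exI[of _ "Complex c c'"], rule exI[of _ ?\<sigma>1], rule exI[of _ ?\<sigma>2], rule exI[of _ ?\<sigma>3],
      intro conjI ballI)
    show "borel_complex_measure {0..} ?\<sigma>1" "borel_complex_measure {0..} ?\<sigma>2" "borel_complex_measure {0..} ?\<sigma>3"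
      using re(1-3) im(1-3) by (auto intro: borel_complex_measure_Complex)
    fix \<Gamma> :: "(real^4) set" assume \<Gamma>: "\<Gamma> \<in> relcompact_borel UNIV"
    show "cm_integrable {0..} ?\<sigma>1 (\<lambda>m. Omega 1 m \<Gamma>)" "cm_integrable {0..} ?\<sigma>2 (\<lambda>m. Omega (-1) m \<Gamma>)"
      "cm_integrable {0..} ?\<sigma>3 (\<lambda>m. Omega_im m \<Gamma>)"
      using re(4)[OF \<Gamma>] im(4)[OF \<Gamma>] by (simp_all add: cm_integrable_def)
    have ind: "(indicator \<Gamma> 0 :: complex) = complex_of_real (indicator \<Gamma> 0)"
      by (simp add: indicator_def)
    show "\<mu> \<Gamma> = Complex c c' * indicator \<Gamma> 0
            + cm_integral {0..} ?\<sigma>1 (\<lambda>m. Omega 1 m \<Gamma>)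
            + cm_integral {0..} ?\<sigma>2 (\<lambda>m. Omega (-1) m \<Gamma>)
            + cm_integral {0..} ?\<sigma>3 (\<lambda>m. Omega_im m \<Gamma>)"
      using re(4)[OF \<Gamma>] im(4)[OF \<Gamma>] unfolding ind by (simp add: complex_eq_iff cm_integral_def)
  qed
qed

end
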